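(* Let $k$ be an algebraically closed field of characteristic $0$, $V$ a $4$-dimensional $k$-vector space, and $G=\mathrm{Gr}(2,\mathrm{Sym}^2V^\vee)$. The repeated-root locus $F_\infty\subseteq G$ decomposes as $$F_\infty=T\cup Z,$$ where $T$ (the tangency locus) is an irreducible divisor and $Z$ has codimension at least $2$ in $G$. In particular, $T$ is the unique divisorial component of $F_\infty$, and $$T=\overline{\mathcal O_{\mathrm{node}}}.$$
   Context: A point $W=\langle Q_0,Q_1\rangle\in G$ is a pencil of quadrics in $\mathbb P(V)\cong\mathbb P^3$ (coordinates $x_0,\dots,x_3$); quadratic forms are identified with symmetric $4\times4$ matrices. Its discriminant quartic is $\Delta_W(s,t)=\det(sQ_0+tQ_1)$. Let $R\subseteq G$ be the locus of pencils whose discriminant quartic has a repeated root, and $F_\infty:=\overline R\subseteq G$. Let $D\subset\mathbb P^9=\mathbb P(\mathrm{Sym}^2V^\vee)$ be the quartic hypersurface $\det=0$ of singular quadrics, and let $\ell_W=\mathbb P(W)\subset\mathbb P^9$ be the line corresponding to $W$. The tangency locus is $$T:=\overline{\{W\in G:\ \ell_W\text{ is tangent to }D\text{ at a smooth point of }D,\text{ and otherwise transverse to }D\}}.$$ $\mathcal O_{\mathrm{node}}$ is the $\mathrm{PGL}(V)$-orbit of the pencil $W_{\mathrm{node}}=\langle x_0^2+x_1^2+x_2^2,\ x_0x_3+x_1^2+2x_2^2\rangle$. A divisorial component is an irreducible component of codimension one in $G$. *)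

theory Defs
  imports
    "HOL-Analysis.Determinants"
    "HOL-Analysis.Abstract_Topology"
    "HOL-Library.Poly_Mapping"
    "HOL-Library.Extended_Nat"
    "HOL-Computational_Algebra.Polynomial"
begin

section \<open>Irreducibility, components and codimension in a topological space\<close>

definition irreducible_in :: "'a topology \<Rightarrow> 'a set \<Rightarrow> bool" where
  "irreducible_in X S \<longleftrightarrow> S \<subseteq> topspace X \<and> S \<noteq> {} \<and>
     (\<forall>A B. closedin X A \<longrightarrow> closedin X B \<longrightarrow> S \<subseteq> A \<union> B \<longrightarrow> S \<subseteq> A \<or> S \<subseteq> B)"

definition irreducible_components :: "'a topology \<Rightarrow> 'a set \<Rightarrow> 'a set set" where
  "irreducible_components X S =
     {Y. Y \<subseteq> S \<and> irreducible_in X Y \<and>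
         (\<forall>Y'. Y \<subseteq> Y' \<longrightarrow> Y' \<subseteq> S \<longrightarrow> irreducible_in X Y' \<longrightarrow> Y' = Y)}"

definition irreducible_closed :: "'a topology \<Rightarrow> 'a set \<Rightarrow> bool" where
  "irreducible_closed X Y \<longleftrightarrow> closedin X Y \<and> irreducible_in X Y"

text \<open>The supremum of the lengths \<open>n\<close> of chains \<open>Y = C 0 \<subset> \<dots> \<subset> C n\<close> of irreducible closed subsets
  of \<open>X\<close>.\<close>

definition codim_irreducible :: "'a topology \<Rightarrow> 'a set \<Rightarrow> enat" where
  "codim_irreducible X Y =
     Sup {enat n | n. \<exists>C :: nat \<Rightarrow> 'a set. C 0 = Y \<and>
            (\<forall>i\<le>n. irreducible_closed X (C i)) \<and> (\<forall>i<n. C i \<subset> C (Suc i))}"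

text \<open>The codimension of a closed subset is the infimum of the codimensions of its irreducible closed
  subsets; in particular the empty set has codimension \<open>\<infinity>\<close>.\<close>

definition codim :: "'a topology \<Rightarrow> 'a set \<Rightarrow> enat" where
  "codim X Z = (INF Y\<in>{Y. irreducible_closed X Y \<and> Y \<subseteq> Z}. codim_irreducible X Y)"


section \<open>Quadratic forms in four variables and pencils\<close>

text \<open>Here \<open>V = k\<^sup>4\<close>; the coordinates \<open>x\<^sub>0, \<dots>, x\<^sub>3\<close> are indexed by the four-element ring \<open>4\<close>.\<close>

type_synonym 'k mat4 = "'k^4^4"

definition quadratic_form :: "'k::field mat4 \<Rightarrow> 'k^4 \<Rightarrow> 'k" where
  "quadratic_form Q x = (\<Sum>i\<in>UNIV. \<Sum>j\<in>UNIV. Q $ i $ j * x $ i * x $ j)"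

definition Sym2 :: "'k::field mat4 set" where
  "Sym2 = {Q. transpose Q = Q}"

definition mscale :: "'k::field \<Rightarrow> 'k mat4 \<Rightarrow> 'k mat4" where
  "mscale c Q = (\<chi> i j. c * Q $ i $ j)"

lemma mscale_nth [simp]: "mscale c Q $ i $ j = c * Q $ i $ j"
  by (simp add: mscale_def)

interpretation mat4: vector_space "mscale :: 'k::field \<Rightarrow> 'k mat4 \<Rightarrow> 'k mat4"
  by unfold_locales (simp_all add: vec_eq_iff algebra_simps)

definition Gr :: "'k::field mat4 set set" where
  "Gr = {W. mat4.subspace W \<and> mat4.dim W = 2 \<and> W \<subseteq> Sym2}"


section \<open>The Zariski topology on the Grassmannian\<close>

text \<open>A polynomial in variables indexed by \<open>'i\<close> is a finitely supported function from exponent vectors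
  to coefficients.\<close>

type_synonym ('i, 'k) mvpoly = "('i \<Rightarrow>\<^sub>0 nat) \<Rightarrow>\<^sub>0 'k"

definition mv_eval :: "('i::finite, 'k::field) mvpoly \<Rightarrow> ('i \<Rightarrow> 'k) \<Rightarrow> 'k" where
  "mv_eval f x =
     (\<Sum>m\<in>Poly_Mapping.keys f. Poly_Mapping.lookup f m * (\<Prod>i\<in>UNIV. x i ^ Poly_Mapping.lookup m i))"

definition mv_homogeneous :: "nat \<Rightarrow> ('i::finite, 'k::field) mvpoly \<Rightarrow> bool" where
  "mv_homogeneous d f \<longleftrightarrow>
     (\<forall>m\<in>Poly_Mapping.keys f. (\<Sum>i\<in>UNIV. Poly_Mapping.lookup m i) = d)"

text \<open>The coordinates of \<open>P \<and> Q\<close>, all \<open>2 \<times> 2\<close> minors of the \<open>2 \<times> 16\<close> matrix of entries of \<open>P\<close> and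
  \<open>Q\<close>. For symmetric \<open>P\<close> and \<open>Q\<close> these are the Pluecker coordinates with respect to the ten
  coordinates of \<open>Sym2\<close>, up to repetitions, signs and zeros.\<close>

definition pluecker :: "'k::field mat4 \<Rightarrow> 'k mat4 \<Rightarrow> (4 \<times> 4) \<times> (4 \<times> 4) \<Rightarrow> 'k" where
  "pluecker P Q = (\<lambda>((i, j), (k, l)). P $ i $ j * Q $ k $ l - P $ k $ l * Q $ i $ j)"

definition zero_locus :: "((4 \<times> 4) \<times> (4 \<times> 4), 'k::field) mvpoly set \<Rightarrow> 'k mat4 set set" where
  "zero_locus F = {W \<in> Gr. \<forall>f\<in>F. \<forall>P Q. W = mat4.span {P, Q} \<longrightarrow> mv_eval f (pluecker P Q) = 0}"

definition zariski_closed :: "'k::field mat4 set set \<Rightarrow> bool" where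
  "zariski_closed S \<longleftrightarrow> (\<exists>F. (\<forall>f\<in>F. \<exists>d. mv_homogeneous d f) \<and> S = zero_locus F)"

definition zariski :: "'k::field mat4 set topology" where
  "zariski = topology (\<lambda>U. U \<subseteq> Gr \<and> zariski_closed (Gr - U))"


subsection \<open>\<open>zariski\<close> is a topology with the expected closed sets\<close>

lemma mv_eval_superset:
  assumes "finite A" "Poly_Mapping.keys f \<subseteq> A"
  shows "mv_eval f x =
    (\<Sum>m\<in>A. Poly_Mapping.lookup f m * (\<Prod>i\<in>UNIV. x i ^ Poly_Mapping.lookup m i))"
  unfolding mv_eval_def using assms
  by (intro sum.mono_neutral_left) (auto simp: in_keys_iff)

lemma mv_eval_add: "mv_eval (f + g) x = mv_eval f x + mv_eval g x"
proof -
  let ?A = "Poly_Mapping.keys f \<union> Poly_Mapping.keys g"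
  have A: "finite ?A" by simp
  show ?thesis
    using mv_eval_superset[OF A, of f x] mv_eval_superset[OF A, of g x]
      mv_eval_superset[OF A keys_add, of x]
    by (simp add: lookup_add algebra_simps sum.distrib)
qed

lemma mv_eval_single:
  "mv_eval (Poly_Mapping.single m c) x = c * (\<Prod>i\<in>UNIV. x i ^ Poly_Mapping.lookup m i)"
  by (subst mv_eval_superset[of "{m}"]) auto

lemma poly_mapping_update_eq:
  assumes "a \<notin> Poly_Mapping.keys f"
  shows "Poly_Mapping.update a b f = f + Poly_Mapping.single a (b :: 'b::comm_monoid_add)"
  using assms
  by (intro poly_mapping_eqI) (auto simp: lookup_update lookup_add lookup_single when_def in_keys_iff)

lemma mv_eval_mult_single:
  "mv_eval (Poly_Mapping.single m c * g) x = mv_eval (Poly_Mapping.single m c) x * mv_eval g x"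
proof (induction g rule: update_induct)
  case const
  then show ?case by (simp add: mv_eval_def)
next
  case (update g a b)
  then show ?case
    by (simp add: poly_mapping_update_eq distrib_left mv_eval_add mult_single mv_eval_single
        lookup_add power_add prod.distrib)
qed

lemma mv_eval_mult: "mv_eval (f * g) x = mv_eval f x * mv_eval g x"
proof (induction f rule: update_induct)
  case const
  then show ?case by (simp add: mv_eval_def)
next
  case (update f a b)
  then show ?case
    by (simp add: poly_mapping_update_eq distrib_right mv_eval_add mv_eval_mult_single)
qed

lemma mv_homogeneous_mult:
  assumes "mv_homogeneous d f" "mv_homogeneous e g"
  shows "mv_homogeneous (d + e) (f * g)"
  unfolding mv_homogeneous_def
proof
  fix m assume "m \<in> Poly_Mapping.keys (f * g)"
  then obtain a b where "m = a + b" "a \<in> Poly_Mapping.keys f" "b \<in> Poly_Mapping.keys g"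
    using keys_mult by blast
  then show "(\<Sum>i\<in>UNIV. Poly_Mapping.lookup m i) = d + e"
    using assms by (simp add: mv_homogeneous_def lookup_add sum.distrib)
qed

lemma mv_eval_homogeneous:
  assumes "mv_homogeneous d f"
  shows "mv_eval f (\<lambda>i. c * x i) = c ^ d * mv_eval f x"
proof -
  have "(\<Prod>i\<in>UNIV. (c * x i) ^ Poly_Mapping.lookup m i) =
      c ^ d * (\<Prod>i\<in>UNIV. x i ^ Poly_Mapping.lookup m i)"
    if "m \<in> Poly_Mapping.keys f" for m
    using assms that
    by (simp add: mv_homogeneous_def power_mult_distrib prod.distrib flip: power_sum)
  then show ?thesis
    by (simp add: mv_eval_def sum_distrib_left algebra_simps)
qed

lemma mat4_span_pair:
  assumes "R \<in> mat4.span {P, Q}"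
  obtains a b where "R = mscale a P + mscale b Q"
proof -
  obtain a where "R - mscale a P \<in> mat4.span {Q}"
    using assms by (auto simp: mat4.span_insert)
  then obtain b where "R - mscale a P = mscale b Q"
    by (auto simp: mat4.span_singleton)
  then show thesis
    by (intro that[of a b]) (simp add: diff_eq_eq add.commute)
qed

lemma pluecker_change:
  assumes "P' \<in> mat4.span {P, Q}" "Q' \<in> mat4.span {P, Q}"
  obtains c where "pluecker P' Q' = (\<lambda>i. c * pluecker P Q i)"
proof -
  obtain a b where P': "P' = mscale a P + mscale b Q"
    using assms(1) by (rule mat4_span_pair)
  obtain a' b' where Q': "Q' = mscale a' P + mscale b' Q"
    using assms(2) by (rule mat4_span_pair)
  have "pluecker P' Q' = (\<lambda>i. (a * b' - b * a') * pluecker P Q i)"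
    unfolding P' Q' pluecker_def
    by (rule ext) (simp add: split_beta algebra_simps)
  then show thesis by (rule that)
qed

lemma zero_locus_basis:
  assumes "mv_homogeneous d f" "mat4.span {P, Q} = mat4.span {P', Q'}"
    and "mv_eval f (pluecker P Q) = 0"
  shows "mv_eval f (pluecker P' Q') = 0"
proof -
  have "P' \<in> mat4.span {P, Q}" "Q' \<in> mat4.span {P, Q}"
    unfolding assms(2) by (simp_all add: mat4.span_base)
  then obtain c where c: "pluecker P' Q' = (\<lambda>i. c * pluecker P Q i)"
    by (rule pluecker_change)
  show ?thesis
    unfolding c using assms(1,3) by (simp add: mv_eval_homogeneous)
qed

lemma zero_locus_Un:
  assumes F: "\<forall>f\<in>F. \<exists>d. mv_homogeneous d f" and G: "\<forall>g\<in>G. \<exists>d. mv_homogeneous d g"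
  shows "zero_locus F \<union> zero_locus G = zero_locus {f * g | f g. f \<in> F \<and> g \<in> G}"
proof
  show "zero_locus F \<union> zero_locus G \<subseteq> zero_locus {f * g | f g. f \<in> F \<and> g \<in> G}"
    by (auto simp: zero_locus_def mv_eval_mult)
  show "zero_locus {f * g | f g. f \<in> F \<and> g \<in> G} \<subseteq> zero_locus F \<union> zero_locus G"
  proof (rule subsetI, rule ccontr)
    fix W assume W: "W \<in> zero_locus {f * g | f g. f \<in> F \<and> g \<in> G}"
      and n: "W \<notin> zero_locus F \<union> zero_locus G"
    have WG: "W \<in> Gr" using W by (simp add: zero_locus_def)
    obtain f P Q where f: "f \<in> F" "W = mat4.span {P, Q}" "mv_eval f (pluecker P Q) \<noteq> 0"
      using n WG by (auto simp: zero_locus_def)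
    obtain g P' Q' where g: "g \<in> G" "W = mat4.span {P', Q'}" "mv_eval g (pluecker P' Q') \<noteq> 0"
      using n WG by (auto simp: zero_locus_def)
    obtain d where "mv_homogeneous d g" using G g(1) by blast
    then have "mv_eval g (pluecker P Q) \<noteq> 0"
      using zero_locus_basis[of d g P Q P' Q'] f(2) g(2,3) by metis
    moreover have "mv_eval (f * g) (pluecker P Q) = 0"
      using W f(1,2) g(1) unfolding zero_locus_def by blast
    ultimately show False using f(3) by (simp add: mv_eval_mult)
  qed
qed

lemma zariski_closed_Un: "zariski_closed A \<Longrightarrow> zariski_closed B \<Longrightarrow> zariski_closed (A \<union> B)"
proof -
  assume "zariski_closed A" "zariski_closed B"
  then obtain F G where F: "\<forall>f\<in>F. \<exists>d. mv_homogeneous d f" "A = zero_locus F"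
    and G: "\<forall>g\<in>G. \<exists>d. mv_homogeneous d g" "B = zero_locus G"
    unfolding zariski_closed_def by blast
  show ?thesis
    unfolding zariski_closed_def F(2) G(2) zero_locus_Un[OF F(1) G(1)]
  proof (rule exI, intro conjI ballI)
    fix h assume "h \<in> {f * g | f g. f \<in> F \<and> g \<in> G}"
    then obtain f g where "h = f * g" "f \<in> F" "g \<in> G" by blast
    moreover obtain d e where "mv_homogeneous d f" "mv_homogeneous e g"
      using F(1) G(1) \<open>f \<in> F\<close> \<open>g \<in> G\<close> by meson
    ultimately show "\<exists>d. mv_homogeneous d h"
      using mv_homogeneous_mult by blast
  qed (rule refl)
qed

lemma zariski_closed_Inter:
  assumes "\<And>A. A \<in> \<A> \<Longrightarrow> zariski_closed A"
  shows "zariski_closed (Gr \<inter> \<Inter>\<A>)"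
proof -
  have "\<forall>A\<in>\<A>. \<exists>F. (\<forall>f\<in>F. \<exists>d. mv_homogeneous d f) \<and> A = zero_locus F"
    using assms by (simp add: zariski_closed_def)
  from bchoice[OF this] obtain F
    where F: "\<forall>A\<in>\<A>. (\<forall>f\<in>F A. \<exists>d. mv_homogeneous d f) \<and> A = zero_locus (F A)" ..
  have "\<Inter>\<A> = (\<Inter>A\<in>\<A>. zero_locus (F A))"
    using F by simp
  then have "Gr \<inter> \<Inter>\<A> = zero_locus (\<Union>A\<in>\<A>. F A)"
    by (auto simp: zero_locus_def)
  moreover have "\<forall>f\<in>(\<Union>A\<in>\<A>. F A). \<exists>d. mv_homogeneous d f"
    using F by simp
  ultimately show ?thesis
    unfolding zariski_closed_def by (intro exI conjI)
qed

lemma zariski_closed_subset: "zariski_closed A \<Longrightarrow> A \<subseteq> Gr"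
  by (auto simp: zariski_closed_def zero_locus_def)

lemma istopology_zariski:
  "istopology (\<lambda>U :: 'k::field mat4 set set. U \<subseteq> Gr \<and> zariski_closed (Gr - U))"
  unfolding istopology_def
proof (intro conjI allI impI)
  fix S T :: "'k mat4 set set"
  assume S: "S \<subseteq> Gr \<and> zariski_closed (Gr - S)" and T: "T \<subseteq> Gr \<and> zariski_closed (Gr - T)"
  show "S \<inter> T \<subseteq> Gr" using S by blast
  show "zariski_closed (Gr - S \<inter> T)"
    using S T zariski_closed_Un[of "Gr - S" "Gr - T"] by (simp add: Diff_Int)
next
  fix \<K> :: "'k mat4 set set set"
  assume K: "\<forall>K\<in>\<K>. K \<subseteq> Gr \<and> zariski_closed (Gr - K)"
  show "\<Union>\<K> \<subseteq> Gr" using K by (simp add: Sup_le_iff)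
  have eq: "Gr - \<Union>\<K> = Gr \<inter> \<Inter>((\<lambda>K. Gr - K) ` \<K>)" by auto
  show "zariski_closed (Gr - \<Union>\<K>)"
    unfolding eq using K by (intro zariski_closed_Inter) (elim imageE, simp)
qed

lemma openin_zariski: "openin zariski U \<longleftrightarrow> U \<subseteq> Gr \<and> zariski_closed (Gr - U)"
  unfolding zariski_def topology_inverse'[OF istopology_zariski] by (rule refl)

lemma topspace_zariski: "topspace (zariski :: 'k::field mat4 set topology) = Gr"
proof
  show "topspace (zariski :: 'k mat4 set topology) \<subseteq> Gr"
    using openin_topspace openin_zariski by blast
  have "zero_locus {1} = ({} :: 'k mat4 set set)"
  proof -
    have "\<exists>P Q. W = mat4.span {P, Q}" if "W \<in> Gr" for W :: "'k mat4 set"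
    proof -
      obtain B where B: "B \<subseteq> W" "mat4.independent B" "W \<subseteq> mat4.span B" "card B = mat4.dim W"
        by (rule mat4.basis_exists)
      have "card B = 2" using B(4) that by (simp add: Gr_def)
      then obtain P Q where "B = {P, Q}" by (auto simp: card_2_iff)
      moreover have "mat4.span B \<subseteq> W"
        using B(1) that by (simp add: Gr_def mat4.span_minimal)
      ultimately show ?thesis using B(3) by blast
    qed
    moreover have "mv_eval 1 x = 1" for x :: "(4 \<times> 4) \<times> (4 \<times> 4) \<Rightarrow> 'k"
      using mv_eval_single[of 0 1 x] by simp
    ultimately show ?thesis by (auto simp: zero_locus_def)
  qed
  moreover have "mv_homogeneous 0 (1 :: ((4 \<times> 4) \<times> (4 \<times> 4), 'k) mvpoly)"
    by (simp add: mv_homogeneous_def)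
  ultimately have "zariski_closed ({} :: 'k mat4 set set)"
    unfolding zariski_closed_def by blast
  then have "openin zariski (Gr :: 'k mat4 set set)" by (simp add: openin_zariski)
  then show "Gr \<subseteq> topspace (zariski :: 'k mat4 set topology)" by (rule openin_subset)
qed

lemma closedin_zariski: "closedin zariski S \<longleftrightarrow> zariski_closed S"
proof -
  have "S \<subseteq> Gr \<Longrightarrow> Gr - (Gr - S) = S" by blast
  then show ?thesis
    using zariski_closed_subset[of S]
    by (auto simp: closedin_def topspace_zariski openin_zariski)
qed


section \<open>The repeated-root locus\<close>

text \<open>Polynomials in two variables are elements of \<open>k[s][t]\<close>.\<close>

abbreviation const2 :: "'k::field \<Rightarrow> 'k poly poly" where
  "const2 c \<equiv> [:[:c:]:]"

abbreviation s_var :: "'k::field poly poly" where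
  "s_var \<equiv> [:[:0, 1:]:]"

abbreviation t_var :: "'k::field poly poly" where
  "t_var \<equiv> [:0, 1:]"

definition discriminant_quartic :: "'k::field mat4 \<Rightarrow> 'k mat4 \<Rightarrow> 'k poly poly" where
  "discriminant_quartic Q0 Q1 =
     det (\<chi> i j. s_var * const2 (Q0 $ i $ j) + t_var * const2 (Q1 $ i $ j))"

text \<open>The form \<open>f(s,t)\<close> has a root of multiplicity at least two at the point \<open>[a : b]\<close> of the
  projective line iff it is divisible by \<open>(b s - a t)\<^sup>2\<close>. In particular the zero form has a repeated
  root.\<close>

definition has_repeated_root :: "'k::field poly poly \<Rightarrow> bool" where
  "has_repeated_root f \<longleftrightarrow>
     (\<exists>a b. (a, b) \<noteq> (0, 0) \<and> (const2 b * s_var - const2 a * t_var)\<^sup>2 dvd f)"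

definition repeated_root_pencils :: "'k::field mat4 set set" where
  "repeated_root_pencils =
     {W \<in> Gr. \<exists>Q0 Q1. W = mat4.span {Q0, Q1} \<and> has_repeated_root (discriminant_quartic Q0 Q1)}"

definition F_inf :: "'k::field mat4 set set" where
  "F_inf = zariski closure_of repeated_root_pencils"


section \<open>The tangency locus\<close>

text \<open>Points of projective space are given by nonzero representatives. The derivative of \<open>det\<close> at \<open>Q\<close>
  in the direction \<open>M\<close> is the coefficient of \<open>u\<close> in \<open>det (Q + u M)\<close>.\<close>

definition det_derivative :: "'k::field mat4 \<Rightarrow> 'k mat4 \<Rightarrow> 'k" where
  "det_derivative Q M = poly.coeff (det (\<chi> i j. [:Q $ i $ j, M $ i $ j:])) 1"

definition on_D :: "'k::field mat4 \<Rightarrow> bool" where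
  "on_D Q \<longleftrightarrow> Q \<in> Sym2 \<and> Q \<noteq> 0 \<and> det Q = 0"

text \<open>The Jacobian criterion, for the equation \<open>det = 0\<close> on the space of symmetric matrices.\<close>

definition smooth_point_D :: "'k::field mat4 \<Rightarrow> bool" where
  "smooth_point_D Q \<longleftrightarrow> on_D Q \<and> (\<exists>M\<in>Sym2. det_derivative Q M \<noteq> 0)"

text \<open>The linear subspace of \<open>Sym2\<close> whose projectivization is the embedded projective tangent space
  of \<open>D\<close> at the point \<open>Q\<close>.\<close>

definition tangent_space_D :: "'k::field mat4 \<Rightarrow> 'k mat4 set" where
  "tangent_space_D Q = {M \<in> Sym2. det_derivative Q M = 0}"

definition tangent_to_D_at :: "'k::field mat4 set \<Rightarrow> 'k mat4 \<Rightarrow> bool" where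
  "tangent_to_D_at W Q \<longleftrightarrow> Q \<in> W \<and> smooth_point_D Q \<and> W \<subseteq> tangent_space_D Q"

definition transverse_to_D_at :: "'k::field mat4 set \<Rightarrow> 'k mat4 \<Rightarrow> bool" where
  "transverse_to_D_at W Q \<longleftrightarrow> Q \<in> W \<and> smooth_point_D Q \<and> \<not> W \<subseteq> tangent_space_D Q"

definition tangent_pencils :: "'k::field mat4 set set" where
  "tangent_pencils =
     {W \<in> Gr. \<exists>Q. tangent_to_D_at W Q \<and>
        (\<forall>Q'\<in>W. on_D Q' \<and> Q' \<notin> mat4.span {Q} \<longrightarrow> transverse_to_D_at W Q')}"

definition tangency_locus :: "'k::field mat4 set set" where
  "tangency_locus = zariski closure_of tangent_pencils"


section \<open>The nodal orbit\<close>

definition node_Q0 :: "'k::field mat4" where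
  "node_Q0 = (\<chi> i j. if i = j \<and> i \<noteq> 3 then 1 else 0)"

definition node_Q1 :: "'k::field mat4" where
  "node_Q1 = (\<chi> i j. if (i, j) = (0, 3) \<or> (i, j) = (3, 0) then 1 / 2
                     else if (i, j) = (1, 1) then 1
                     else if (i, j) = (2, 2) then 2 else 0)"

lemma node_Q0_form: "quadratic_form node_Q0 x = (x $ 0)\<^sup>2 + (x $ 1)\<^sup>2 + (x $ 2)\<^sup>2"
proof -
  have "x $ 4 = x $ 0" by (rule arg_cong[where f = "($) x"]) simp
  then show ?thesis
    by (simp add: quadratic_form_def node_Q0_def sum_4 power2_eq_square)
qed

lemma node_Q1_form:
  fixes x :: "'k::field^4"
  assumes "(2 :: 'k) \<noteq> 0"
  shows "quadratic_form node_Q1 x = x $ 0 * x $ 3 + (x $ 1)\<^sup>2 + 2 * (x $ 2)\<^sup>2"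
proof -
  have "x $ 4 = x $ 0" by (rule arg_cong[where f = "($) x"]) simp
  then show ?thesis
    using assms
    by (simp add: quadratic_form_def node_Q1_def sum_4 power2_eq_square field_simps)
qed

definition W_node :: "'k::field mat4 set" where
  "W_node = mat4.span {node_Q0, node_Q1}"

text \<open>The action of \<open>PGL(V)\<close> by linear substitution, through representatives in \<open>GL(V)\<close>: \<open>g\<close> sends
  \<open>Q(x)\<close> to \<open>Q(g x)\<close>.\<close>

definition act :: "'k::field mat4 \<Rightarrow> 'k mat4 set \<Rightarrow> 'k mat4 set" where
  "act g W = (\<lambda>Q. transpose g ** Q ** g) ` W"

definition O_node :: "'k::field mat4 set set" where
  "O_node = {act g W_node | g. invertible g}"

end

theory Submission
  imports Defs
begin

text \<open>
  All three closures agree: \<open>F_inf\<close>, the tangency locus and the closure \<open>T\<close> of the nodal orbit, so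
  that \<open>Z\<close> may be taken empty. Indeed \<open>O_node\<close> consists of tangent pencils, and a tangent pencil
  has a repeated root. Conversely, if \<open>det (P + u Q)\<close> vanishes to second order at \<open>u = 0\<close>, then the kernel of
  \<open>P\<close> contains a nonzero vector that is isotropic for \<open>Q\<close>. With this vector as last basis vector, such
  pairs form a linear space that contains the nodal pair, and on the line from \<open>(P, Q)\<close> to the nodal pair all
  but finitely many members have two further distinct eigenvalues and are equivalent to the nodal pencil;
  hence \<open>\<langle>P, Q\<rangle>\<close> lies in \<open>T\<close>.

  To see that an irreducible closed \<open>Y\<close> with \<open>T \<subset> Y\<close> is everything, take an affine chart of the
  Grassmannian and view its coordinate ring as \<open>A[z]\<close>, where \<open>z\<close> is one matrix entry. The vanishing ideal
  \<open>K\<close> of \<open>T\<close> meets \<open>A\<close> trivially, because for generic values of the other coordinates a suitable change of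
  two diagonal entries creates a double root. If the vanishing ideal \<open>J \<subseteq> K\<close> of \<open>Y\<close> is nonzero, then
  both generate the same ideal of the principal ideal domain \<open>Frac(A)[z]\<close>, so \<open>J = K\<close>.
\<close>

section \<open>Determinants of 4 by 4 matrices\<close>

text \<open>Codimension is measured by chains, so codimension one of \<open>T\<close> means that
  \<open>T\<close> is not \<open>Gr\<close> and that nothing irreducible and closed lies strictly
  between. The first holds because the discriminant of the quartic vanishes on the orbit. For the
  second no equation of \<open>T\<close> is used, only that \<open>T\<close> contains every pencil
  with a double root. Let f be the quartic det (P + u Q) and b its upper left 3 by 3 minor, as
  polynomials in u. Adding z and w to the last diagonal entries of P and Q replaces f by f + (z + w
  u) b. For b(t) nonzero, a double root at t means that f/b + z + w u vanishes at t together with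
  its derivative: w = -(f/b)'(t), and z is then determined. If (f/b)' is not constant, infinitely
  many w occur, while a nonzero polynomial in w has finitely many zeros. Division in Frac(A)[z]
  reads c g = q h, with h nonzero of least degree in \<open>K\<close> and c a nonzero element of A,
  hence outside \<open>K\<close>. The ideal \<open>J\<close> is prime: taking for g a nonzero
  element of least degree in \<open>J\<close> puts h into \<open>J\<close>, and then any g in
  \<open>K\<close> lies in \<open>J\<close>.\<close>

lemma sum_UNIV4: "sum f (UNIV :: 4 set) = f 0 + f 1 + f 2 + f 3"
proof -
  \<comment> \<open>The general formula runs over the indices 1 to 4, and 4 is another name of 0 in
    this ring.\<close>
  have "(4 :: 4) = 0" by simp
  then show ?thesis by (simp only: sum_4 ac_simps)
qed

lemma all_UNIV4: "(\<forall>i :: 4. P i) \<longleftrightarrow> P 0 \<and> P 1 \<and> P 2 \<and> P 3"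
proof -
  have "(4 :: 4) = 0" by simp
  then show ?thesis unfolding forall_4 by metis
qed

lemma UNIV4: "(UNIV :: 4 set) = {0, 1, 2, 3}"
  using all_UNIV4[of "\<lambda>i. i \<in> {0, 1, 2, 3}"] by auto

text \<open>Nested expansion along first rows, written out so that later determinant identities
  become polynomial identities in the entries.\<close>

lemma det_UNIV4:
  "det (A :: 'a::comm_ring_1^4^4) =
     A $ 0 $ 0 * (A $ 1 $ 1 * (A $ 2 $ 2 * A $ 3 $ 3 - A $ 2 $ 3 * A $ 3 $ 2)
        - A $ 1 $ 2 * (A $ 2 $ 1 * A $ 3 $ 3 - A $ 2 $ 3 * A $ 3 $ 1)
        + A $ 1 $ 3 * (A $ 2 $ 1 * A $ 3 $ 2 - A $ 2 $ 2 * A $ 3 $ 1))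
   - A $ 0 $ 1 * (A $ 1 $ 0 * (A $ 2 $ 2 * A $ 3 $ 3 - A $ 2 $ 3 * A $ 3 $ 2)
        - A $ 1 $ 2 * (A $ 2 $ 0 * A $ 3 $ 3 - A $ 2 $ 3 * A $ 3 $ 0)
        + A $ 1 $ 3 * (A $ 2 $ 0 * A $ 3 $ 2 - A $ 2 $ 2 * A $ 3 $ 0))
   + A $ 0 $ 2 * (A $ 1 $ 0 * (A $ 2 $ 1 * A $ 3 $ 3 - A $ 2 $ 3 * A $ 3 $ 1)
        - A $ 1 $ 1 * (A $ 2 $ 0 * A $ 3 $ 3 - A $ 2 $ 3 * A $ 3 $ 0)
        + A $ 1 $ 3 * (A $ 2 $ 0 * A $ 3 $ 1 - A $ 2 $ 1 * A $ 3 $ 0))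
   - A $ 0 $ 3 * (A $ 1 $ 0 * (A $ 2 $ 1 * A $ 3 $ 2 - A $ 2 $ 2 * A $ 3 $ 1)
        - A $ 1 $ 1 * (A $ 2 $ 0 * A $ 3 $ 2 - A $ 2 $ 2 * A $ 3 $ 0)
        + A $ 1 $ 2 * (A $ 2 $ 0 * A $ 3 $ 1 - A $ 2 $ 1 * A $ 3 $ 0))"
proof -
  have f: "finite {1 :: 4, 2, 3}" "0 \<notin> {1 :: 4, 2, 3}" "finite {2 :: 4, 3}" "1 \<notin> {2 :: 4, 3}"
    "finite {3 :: 4}" "2 \<notin> {3 :: 4}" "finite ({} :: 4 set)" "3 \<notin> ({} :: 4 set)"
    by auto
  show ?thesis
    unfolding det_def UNIV4
    unfolding sum_over_permutations_insert[OF f(1,2)]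
    unfolding sum_over_permutations_insert[OF f(3,4)]
    unfolding sum_over_permutations_insert[OF f(5,6)]
    unfolding permutes_sing
    by (simp add: sign_swap_id permutation_swap_id sign_compose sign_id swap_id_eq permutation_compose
        transpose_def)
      (simp add: algebra_simps)
qed

text \<open>The determinant is an integer polynomial in the entries. The lemma serves to evaluate
  determinants of polynomial matrices at a point.\<close>

lemma det_hom:
  fixes A :: "'a::comm_ring_1^'n^'n" and h :: "'a \<Rightarrow> 'b::comm_ring_1"
  assumes "h 1 = 1" "\<And>x y. h (x + y) = h x + h y" "\<And>x y. h (x * y) = h x * h y"
  shows "h (det A) = det (\<chi> i j. h (A $ i $ j))"
proof -
  have h0: "h 0 = 0" using assms(2)[of 0 0] by simp
  have hm: "h (- x) = - h x" for x
    using assms(2)[of x "- x"] by (simp add: h0 eq_neg_iff_add_eq_0 add.commute)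
  have hs: "h (sum f S) = (\<Sum>x\<in>S. h (f x))" for f :: "('n \<Rightarrow> 'n) \<Rightarrow> 'a" and S
    by (induction S rule: infinite_finite_induct) (simp_all add: h0 assms(2))
  have hp: "h (prod f S) = (\<Prod>x\<in>S. h (f x))" for f :: "'n \<Rightarrow> 'a" and S
    by (induction S rule: infinite_finite_induct) (simp_all add: assms(1,3))
  have hi: "h (of_int (sign p)) = of_int (sign p)" for p :: "'n \<Rightarrow> 'n"
    by (simp add: sign_def assms(1) hm)
  show ?thesis by (simp add: det_def hs hp hi assms(3))
qed

section \<open>Polynomial families of pencils\<close>

text \<open>Only the function is recorded, not a representing polynomial: what matters is closure
  under ring operations and the finiteness of the zeros.\<close>

definition poly_fun :: "('k::field \<Rightarrow> 'k) \<Rightarrow> bool" where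
  "poly_fun f \<longleftrightarrow> (\<exists>p. \<forall>u. f u = poly p u)"

lemma poly_fun_const [intro, simp]: "poly_fun (\<lambda>u. c)"
  unfolding poly_fun_def by (rule exI[of _ "[:c:]"]) simp

lemma poly_fun_id [intro, simp]: "poly_fun (\<lambda>u. u)"
  unfolding poly_fun_def by (rule exI[of _ "[:0, 1:]"]) simp

lemma poly_fun_add [intro, simp]: "poly_fun f \<Longrightarrow> poly_fun g \<Longrightarrow> poly_fun (\<lambda>u. f u + g u)"
  unfolding poly_fun_def by (metis poly_add)

lemma poly_fun_diff [intro, simp]: "poly_fun f \<Longrightarrow> poly_fun g \<Longrightarrow> poly_fun (\<lambda>u. f u - g u)"
  unfolding poly_fun_def by (metis poly_diff)

lemma poly_fun_mult [intro, simp]: "poly_fun f \<Longrightarrow> poly_fun g \<Longrightarrow> poly_fun (\<lambda>u. f u * g u)"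
  unfolding poly_fun_def by (metis poly_mult)

lemma poly_fun_power [intro, simp]: "poly_fun f \<Longrightarrow> poly_fun (\<lambda>u. f u ^ n)"
  by (induction n) simp_all

lemma poly_fun_sum [intro]: "(\<And>i. i \<in> S \<Longrightarrow> poly_fun (f i)) \<Longrightarrow> poly_fun (\<lambda>u. \<Sum>i\<in>S. f i u)"
  by (induction S rule: infinite_finite_induct) simp_all

lemma poly_fun_prod [intro]: "(\<And>i. i \<in> S \<Longrightarrow> poly_fun (f i)) \<Longrightarrow> poly_fun (\<lambda>u. \<Prod>i\<in>S. f i u)"
  by (induction S rule: infinite_finite_induct) simp_all

lemma poly_fun_finite_zeros:
  assumes "poly_fun f" "f u \<noteq> 0"
  shows "finite {u. f u = 0}"
proof -
  obtain p where p: "\<And>u. f u = poly p u" using assms(1) by (auto simp: poly_fun_def)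
  have "p \<noteq> 0" using assms(2) p[of u] by auto
  then show ?thesis by (simp add: p poly_roots_finite)
qed

lemma poly_fun_det:
  fixes A :: "'k::field \<Rightarrow> 'k^'n^'n"
  assumes "\<And>i j. poly_fun (\<lambda>u. A u $ i $ j)"
  shows "poly_fun (\<lambda>u. det (A u))"
  unfolding det_def
  by (intro poly_fun_sum poly_fun_mult poly_fun_prod poly_fun_const assms)

lemma poly_fun_matrix_mult:
  assumes "\<And>i j. poly_fun (\<lambda>u. A u $ i $ j)" "\<And>i j. poly_fun (\<lambda>u. B u $ i $ j)"
  shows "poly_fun (\<lambda>u. (A u ** B u) $ i $ j)"
  unfolding matrix_matrix_mult_def by (auto intro!: poly_fun_mult poly_fun_sum assms)

lemma poly_fun_transpose:
  assumes "\<And>i j. poly_fun (\<lambda>u. A u $ i $ j)"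
  shows "poly_fun (\<lambda>u. transpose (A u) $ i $ j)"
  by (simp add: transpose_def assms)

lemma poly_fun_mv_eval:
  fixes A B :: "'k::field \<Rightarrow> 'k mat4"
  assumes "\<And>i j. poly_fun (\<lambda>u. A u $ i $ j)" "\<And>i j. poly_fun (\<lambda>u. B u $ i $ j)"
  shows "poly_fun (\<lambda>u. mv_eval f (pluecker (A u) (B u)))"
proof -
  have "poly_fun (\<lambda>u. pluecker (A u) (B u) x)" for x
    unfolding pluecker_def split_beta by (intro poly_fun_mult poly_fun_diff assms)
  then show ?thesis
    unfolding mv_eval_def by (intro poly_fun_sum poly_fun_mult poly_fun_prod poly_fun_power poly_fun_const)
qed

definition line :: "'k::field mat4 \<Rightarrow> 'k mat4 \<Rightarrow> 'k \<Rightarrow> 'k mat4" where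
  "line A B u = mscale (1 - u) A + mscale u B"

lemma line_0 [simp]: "line A B 0 = A" and line_1 [simp]: "line A B 1 = B"
  by (simp_all add: line_def vec_eq_iff)

lemma line_nth: "line A B u $ i $ j = (1 - u) * A $ i $ j + u * B $ i $ j"
  by (simp add: line_def)

lemma poly_fun_line: "poly_fun (\<lambda>u. line A B u $ i $ j)"
  by (simp add: line_nth)

lemma Sym2_iff: "Q \<in> Sym2 \<longleftrightarrow> (\<forall>i j. Q $ i $ j = Q $ j $ i)"
  by (auto simp: Sym2_def transpose_def vec_eq_iff)

lemma line_Sym2: "A \<in> Sym2 \<Longrightarrow> B \<in> Sym2 \<Longrightarrow> line A B u \<in> Sym2"
  by (simp add: Sym2_iff line_nth)

section \<open>Bases of pencils and their Pluecker coordinates\<close>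

lemma Gr_span:
  assumes "W \<in> Gr" obtains P Q where "W = mat4.span {P, Q}"
proof -
  obtain B where B: "B \<subseteq> W" "mat4.independent B" "W \<subseteq> mat4.span B" "card B = mat4.dim W"
    by (rule mat4.basis_exists)
  have "card B = 2" using B(4) assms by (simp add: Gr_def)
  then obtain P Q where "B = {P, Q}" by (auto simp: card_2_iff)
  moreover have "mat4.span B \<subseteq> W"
    using B(1) assms by (simp add: Gr_def mat4.span_minimal)
  ultimately show ?thesis using B(3) that by blast
qed

lemma pair_in_span: "mscale a P + mscale b Q \<in> mat4.span {P, Q}"
  by (intro mat4.span_add mat4.span_scale mat4.span_base) auto

lemma pluecker_eq_0_if_dependent:
  assumes "mscale a P + mscale b Q = 0" "(a, b) \<noteq> (0, 0)"
  shows "pluecker P Q x = 0"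
proof -
  obtain i j k l where x: "x = ((i, j), (k, l))" by (metis surj_pair)
  have e: "a * P $ i $ j + b * Q $ i $ j = 0" for i j
    using assms(1) by (simp add: vec_eq_iff)
  have "a * pluecker P Q x = (a * P $ i $ j + b * Q $ i $ j) * Q $ k $ l - (a * P $ k $ l + b * Q $ k $ l) * Q $ i $ j"
    unfolding x pluecker_def by (simp add: algebra_simps)
  moreover have "b * pluecker P Q x = (a * P $ k $ l + b * Q $ k $ l) * P $ i $ j - (a * P $ i $ j + b * Q $ i $ j) * P $ k $ l"
    unfolding x pluecker_def by (simp add: algebra_simps)
  ultimately have "a * pluecker P Q x = 0" "b * pluecker P Q x = 0" by (simp_all add: e)
  then show ?thesis using assms(2) by auto
qed

text \<open>If all 2 by 2 minors vanish, a nonzero entry of \<open>Q\<close> exhibits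
  \<open>P\<close> as a multiple of \<open>Q\<close>. Independence thus becomes the nonvanishing of
  a polynomial, a condition that can be followed along a curve.\<close>

lemma independent_pair_iff:
  "mat4.independent {P, Q} \<and> P \<noteq> Q \<longleftrightarrow> (\<exists>x. pluecker P Q x \<noteq> 0)"
proof
  assume r: "\<exists>x. pluecker P Q x \<noteq> 0"
  then obtain x where x: "pluecker P Q x \<noteq> 0" ..
  have "Q \<noteq> 0"
  proof
    assume "Q = 0"
    then have "mscale 0 P + mscale 1 Q = 0" by (simp add: vec_eq_iff)
    then show False using x pluecker_eq_0_if_dependent[of 0 P 1 Q] by simp
  qed
  moreover have "P \<noteq> mscale k Q" for k
  proof
    assume "P = mscale k Q"
    then have "mscale 1 P + mscale (- k) Q = 0" by (simp add: vec_eq_iff)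
    then show False using x pluecker_eq_0_if_dependent[of 1 P "- k" Q] by simp
  qed
  moreover have "P \<noteq> Q" using \<open>\<And>k. P \<noteq> mscale k Q\<close>[of 1] by (auto simp: vec_eq_iff)
  ultimately show "mat4.independent {P, Q} \<and> P \<noteq> Q"
    by (auto simp: mat4.independent_insert mat4.span_singleton)
next
  assume i: "mat4.independent {P, Q} \<and> P \<noteq> Q"
  show "\<exists>x. pluecker P Q x \<noteq> 0"
  proof (rule ccontr)
    assume "\<nexists>x. pluecker P Q x \<noteq> 0"
    then have "pluecker P Q ((i, j), (k, l)) = 0" for i j k l by blast
    then have z: "P $ i $ j * Q $ k $ l = P $ k $ l * Q $ i $ j" for i j k l
      by (simp add: pluecker_def)
    have "Q \<noteq> 0" "P \<notin> mat4.span {Q}"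
      using i by (auto simp: mat4.independent_insert split: if_splits)
    then obtain k l where q: "Q $ k $ l \<noteq> 0" by (auto simp: vec_eq_iff)
    have "P = mscale (P $ k $ l / Q $ k $ l) Q"
      using q z[of _ _ k l] by (simp add: vec_eq_iff field_simps)
    then show False using \<open>P \<notin> mat4.span {Q}\<close> by (auto simp: mat4.span_singleton)
  qed
qed

lemma span_in_Gr_iff:
  "mat4.span {P, Q} \<in> Gr \<longleftrightarrow> P \<in> Sym2 \<and> Q \<in> Sym2 \<and> (\<exists>x. pluecker P Q x \<noteq> 0)"
proof
  assume g: "mat4.span {P, Q} \<in> Gr"
  then have d: "mat4.dim {P, Q} = 2" and "P \<in> Sym2" "Q \<in> Sym2"
    by (auto simp: Gr_def mat4.span_base)
  have d1: "\<not> {P, Q} \<subseteq> mat4.span {R}" for R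
    using mat4.dim_le_card[of "{P, Q}" "{R}"] d by auto
  have "P \<notin> mat4.span {Q}" using d1[of Q] by (auto simp: mat4.span_base)
  moreover have "Q \<noteq> 0" using d1[of P] by (auto simp: mat4.span_base mat4.span_zero)
  ultimately have "mat4.independent {P, Q} \<and> P \<noteq> Q"
    by (auto simp: mat4.independent_insert mat4.span_base)
  then show "P \<in> Sym2 \<and> Q \<in> Sym2 \<and> (\<exists>x. pluecker P Q x \<noteq> 0)"
    using \<open>P \<in> Sym2\<close> \<open>Q \<in> Sym2\<close> independent_pair_iff by blast
next
  assume r: "P \<in> Sym2 \<and> Q \<in> Sym2 \<and> (\<exists>x. pluecker P Q x \<noteq> 0)"
  then have i: "mat4.independent {P, Q}" "P \<noteq> Q" using independent_pair_iff by blast+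
  have "mat4.subspace Sym2"
    by (auto simp: mat4.subspace_def Sym2_iff)
  then have "mat4.span {P, Q} \<subseteq> Sym2" using r by (intro mat4.span_minimal) auto
  then show "mat4.span {P, Q} \<in> Gr"
    using mat4.dim_eq_card_independent[OF i(1)] i(2) by (simp add: Gr_def)
qed

lemma span_change:
  assumes "a * d - b * c \<noteq> 0"
  shows "mat4.span {mscale a P + mscale b Q, mscale c P + mscale d Q} = mat4.span {P, Q}"
    (is "mat4.span {?P, ?Q} = _")
proof
  show "mat4.span {?P, ?Q} \<subseteq> mat4.span {P, Q}"
    by (intro mat4.span_minimal) (auto simp: pair_in_span)
  define e where "e = a * d - b * c"
  have e: "e \<noteq> 0" using assms by (simp add: e_def)
  have P: "P = mscale (d / e) ?P + mscale (- b / e) ?Q"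
  proof -
    have "d * (a * x + b * y) - b * (c * x + d * y) = e * x" for x y by (simp add: e_def algebra_simps)
    then have "x = d / e * (a * x + b * y) + - b / e * (c * x + d * y)" for x y
      using e by (simp add: nonzero_eq_divide_eq flip: diff_divide_distrib)
    then show ?thesis by (simp add: vec_eq_iff)
  qed
  have Q: "Q = mscale (- c / e) ?P + mscale (a / e) ?Q"
  proof -
    have "a * (c * x + d * y) - c * (a * x + b * y) = e * y" for x y by (simp add: e_def algebra_simps)
    then have "y = - c / e * (a * x + b * y) + a / e * (c * x + d * y)" for x y
      using e by (simp add: nonzero_eq_divide_eq flip: diff_divide_distrib)
    then show ?thesis by (simp add: vec_eq_iff)
  qed
  have "P \<in> mat4.span {?P, ?Q}" "Q \<in> mat4.span {?P, ?Q}"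
    by (subst P, rule pair_in_span) (subst Q, rule pair_in_span)
  then show "mat4.span {P, Q} \<subseteq> mat4.span {?P, ?Q}"
    by (intro mat4.span_minimal) auto
qed

section \<open>Closed sets, closures and irreducibility tested along curves\<close>

lemma in_zero_locus_iff:
  assumes "mv_homogeneous d f" "mat4.span {P, Q} \<in> Gr"
  shows "mat4.span {P, Q} \<in> zero_locus {f} \<longleftrightarrow> mv_eval f (pluecker P Q) = 0"
proof
  show "mv_eval f (pluecker P Q) = 0" if "mat4.span {P, Q} \<in> zero_locus {f}"
    using that by (auto simp: zero_locus_def)
  show "mat4.span {P, Q} \<in> zero_locus {f}" if z: "mv_eval f (pluecker P Q) = 0"
  proof -
    have "mv_eval f (pluecker P' Q') = 0" if "mat4.span {P, Q} = mat4.span {P', Q'}" for P' Q'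
      by (rule zero_locus_basis[OF assms(1) that z])
    then show ?thesis using assms(2) by (simp add: zero_locus_def)
  qed
qed

lemma closedin_zero_locus:
  assumes "closedin zariski S" "W \<in> Gr" "W \<notin> S" "W = mat4.span {P, Q}"
  obtains d f where "mv_homogeneous d f" "mv_eval f (pluecker P Q) \<noteq> 0" "S \<subseteq> zero_locus {f}"
proof -
  obtain F where F: "\<forall>f\<in>F. \<exists>d. mv_homogeneous d f" "S = zero_locus F"
    using assms(1) by (auto simp: closedin_zariski zariski_closed_def)
  obtain f P' Q' where f: "f \<in> F" "W = mat4.span {P', Q'}" "mv_eval f (pluecker P' Q') \<noteq> 0"
    using assms(2,3) F(2) by (auto simp: zero_locus_def)
  obtain d where d: "mv_homogeneous d f" using F(1) f(1) by blast
  show thesis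
  proof (rule that[OF d])
    show "mv_eval f (pluecker P Q) \<noteq> 0"
      using zero_locus_basis[OF d] f(2,3) assms(4) by metis
    show "S \<subseteq> zero_locus {f}" using f(1) by (auto simp: F(2) zero_locus_def)
  qed
qed

lemma closedin_zero_locus_single: "mv_homogeneous d f \<Longrightarrow> closedin zariski (zero_locus {f})"
  unfolding closedin_zariski zariski_closed_def by (intro exI[of _ "{f}"]) auto

text \<open>An equation that holds on \<open>S\<close> but fails at \<open>u0\<close> has finitely
  many zeros along the curve, whereas it holds wherever \<open>\<phi>\<close> is nonzero, that is,
  for all but finitely many \<open>u\<close> in an infinite field. The parameter \<open>u0\<close>
  may itself be a zero of \<open>\<phi>\<close>; \<open>u1\<close> certifies that
  \<open>\<phi>\<close> is not identically zero.\<close>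

lemma closure_curve:
  fixes A B :: "'k::field_char_0 \<Rightarrow> 'k mat4"
  assumes "\<And>i j. poly_fun (\<lambda>u. A u $ i $ j)" "\<And>i j. poly_fun (\<lambda>u. B u $ i $ j)"
    and "mat4.span {A u0, B u0} \<in> Gr" "S \<subseteq> Gr"
    and phi: "poly_fun \<phi>" "\<phi> u1 \<noteq> 0" and S: "\<And>u. \<phi> u \<noteq> 0 \<Longrightarrow> mat4.span {A u, B u} \<in> S"
  shows "mat4.span {A u0, B u0} \<in> zariski closure_of S"
proof (rule ccontr)
  assume n: "mat4.span {A u0, B u0} \<notin> zariski closure_of S"
  obtain d f where f: "mv_homogeneous d f" "mv_eval f (pluecker (A u0) (B u0)) \<noteq> 0"
      "zariski closure_of S \<subseteq> zero_locus {f}"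
    by (rule closedin_zero_locus[OF closedin_closure_of assms(3) n refl]) blast
  have "S \<subseteq> zero_locus {f}"
    using f(3) closure_of_subset[of S zariski] assms(4) by (auto simp: topspace_zariski)
  then have "{u. \<phi> u \<noteq> 0} \<subseteq> {u. mv_eval f (pluecker (A u) (B u)) = 0}"
    using S assms(4) by (auto simp: zero_locus_def)
  moreover have "finite {u. mv_eval f (pluecker (A u) (B u)) = 0}"
    by (rule poly_fun_finite_zeros[where f = "\<lambda>u. mv_eval f (pluecker (A u) (B u))", OF poly_fun_mv_eval[OF assms(1,2)] f(2)])
  moreover have "finite {u. \<phi> u = 0}" by (rule poly_fun_finite_zeros[OF phi])
  ultimately have "finite ({u. \<phi> u \<noteq> 0} \<union> {u. \<phi> u = 0})"
    using finite_subset by blast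
  moreover have "{u. \<phi> u \<noteq> 0} \<union> {u. \<phi> u = 0} = UNIV" by auto
  ultimately show False using infinite_UNIV_char_0[where 'a = 'k] by simp
qed

text \<open>Let \<open>W\<close> avoid \<open>X\<close> and \<open>W'\<close> avoid
  \<open>Y\<close>. An equation of \<open>X\<close> failing at \<open>W\<close> and one of
  \<open>Y\<close> failing at \<open>W'\<close> have finitely many zeros on a curve through both
  pencils, so some member of \<open>S\<close> on the curve lies in neither closed set.\<close>

lemma irreducible_by_curves:
  fixes S :: "'k::field_char_0 mat4 set set"
  assumes "S \<subseteq> Gr" "S \<noteq> {}"
    and curve: "\<And>W W'. W \<in> S \<Longrightarrow> W' \<in> S \<Longrightarrow> \<exists>A B \<phi> u0 u1.
      (\<forall>i j. poly_fun (\<lambda>u. A u $ i $ j)) \<and> (\<forall>i j. poly_fun (\<lambda>u. B u $ i $ j)) \<and>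
      poly_fun \<phi> \<and> \<phi> u0 \<noteq> 0 \<and> W = mat4.span {A u0, B u0} \<and> W' = mat4.span {A u1, B u1} \<and>
      (\<forall>u. \<phi> u \<noteq> 0 \<longrightarrow> mat4.span {A u, B u} \<in> S)"
  shows "irreducible_in zariski S"
  unfolding irreducible_in_def
proof (intro conjI allI impI)
  show "S \<subseteq> topspace zariski" "S \<noteq> {}" using assms by (auto simp: topspace_zariski)
  fix X Y assume X: "closedin zariski X" and Y: "closedin zariski Y" and XY: "S \<subseteq> X \<union> Y"
  show "S \<subseteq> X \<or> S \<subseteq> Y"
  proof (rule ccontr)
    assume "\<not> (S \<subseteq> X \<or> S \<subseteq> Y)"
    then obtain W W' where W: "W \<in> S" "W \<notin> X" "W' \<in> S" "W' \<notin> Y" by blast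
    obtain A B \<phi> u0 u1 where AB: "\<And>i j. poly_fun (\<lambda>u. A u $ i $ j)" "\<And>i j. poly_fun (\<lambda>u. B u $ i $ j)"
      and phi: "poly_fun \<phi>" "\<phi> u0 \<noteq> 0" and W01: "W = mat4.span {A u0, B u0}" "W' = mat4.span {A u1, B u1}"
      and S: "\<And>u. \<phi> u \<noteq> 0 \<Longrightarrow> mat4.span {A u, B u} \<in> S"
      using curve[OF W(1,3)] by blast
    have "W \<in> Gr" "W' \<in> Gr" using W assms(1) by auto
    obtain d f where f: "mv_homogeneous d f" "mv_eval f (pluecker (A u0) (B u0)) \<noteq> 0" "X \<subseteq> zero_locus {f}"
      by (rule closedin_zero_locus[OF X \<open>W \<in> Gr\<close> W(2) W01(1)]) blast
    obtain e g where g: "mv_homogeneous e g" "mv_eval g (pluecker (A u1) (B u1)) \<noteq> 0" "Y \<subseteq> zero_locus {g}"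
      by (rule closedin_zero_locus[OF Y \<open>W' \<in> Gr\<close> W(4) W01(2)]) blast
    have "finite {u. mv_eval f (pluecker (A u) (B u)) = 0}" "finite {u. mv_eval g (pluecker (A u) (B u)) = 0}"
      using poly_fun_finite_zeros[OF poly_fun_mv_eval[OF AB] f(2)]
        poly_fun_finite_zeros[OF poly_fun_mv_eval[OF AB] g(2)] by simp_all
    moreover have "finite {u. \<phi> u = 0}" by (rule poly_fun_finite_zeros[OF phi])
    moreover have "{u. \<phi> u = 0} \<union> {u. mv_eval f (pluecker (A u) (B u)) = 0} \<union>
        {u. mv_eval g (pluecker (A u) (B u)) = 0} = UNIV"
    proof -
      have "mv_eval f (pluecker (A u) (B u)) = 0 \<or> mv_eval g (pluecker (A u) (B u)) = 0" if "\<phi> u \<noteq> 0" for u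
      proof -
        have "mat4.span {A u, B u} \<in> zero_locus {f} \<union> zero_locus {g}"
          using S[OF that] XY f(3) g(3) by blast
        then show ?thesis by (auto simp: zero_locus_def)
      qed
      then show ?thesis by blast
    qed
    ultimately show False
      using infinite_UNIV_char_0[where 'a = 'k] by (metis (no_types, lifting) finite_Un)
  qed
qed

lemma irreducible_closure_of:
  assumes "irreducible_in X S"
  shows "irreducible_closed X (X closure_of S)"
proof -
  have S: "S \<subseteq> topspace X" "S \<noteq> {}" using assms by (auto simp: irreducible_in_def)
  have sub: "S \<subseteq> X closure_of S" by (rule closure_of_subset[OF S(1)])
  have "X closure_of S \<subseteq> A \<or> X closure_of S \<subseteq> B"
    if "closedin X A" "closedin X B" "X closure_of S \<subseteq> A \<union> B" for A B
  proof -
    have "S \<subseteq> A \<or> S \<subseteq> B" using assms that sub unfolding irreducible_in_def by blast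
    then show ?thesis using that(1,2) closure_of_minimal by blast
  qed
  moreover have "X closure_of S \<noteq> {}" using S(2) sub by auto
  ultimately show ?thesis
    by (simp add: irreducible_closed_def irreducible_in_def closure_of_subset_topspace)
qed

section \<open>The action of the general linear group\<close>

definition subst :: "'k::field mat4 \<Rightarrow> 'k mat4 \<Rightarrow> 'k mat4" where
  "subst g Q = transpose g ** Q ** g"

text \<open>The entry is the bilinear form of \<open>Q\<close> at the columns \<open>i\<close> and
  \<open>j\<close> of \<open>g\<close>; in this shape, kernel vectors and eigenvectors placed in the
  columns can be exploited.\<close>

lemma subst_nth: "subst g Q $ i $ j = (\<Sum>k\<in>UNIV. g $ k $ i * (Q *v column j g) $ k)"
  unfolding subst_def matrix_mul_assoc[symmetric]
  by (simp add: transpose_def column_def matrix_matrix_mult_def matrix_vector_mult_def)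

lemma mscale_vector: "mscale a P *v x = a *s (P *v x)"
  by (simp add: vec_eq_iff matrix_vector_mult_def sum_distrib_left mult.assoc)

lemma subst_pair: "subst g (mscale a P + mscale b Q) = mscale a (subst g P) + mscale b (subst g Q)"
  by (simp add: vec_eq_iff subst_nth matrix_vector_mult_add_rdistrib mscale_vector sum_distrib_left
      sum.distrib algebra_simps)

lemma subst_subst: "subst g (subst h Q) = subst (h ** g) Q"
  by (simp add: subst_def matrix_transpose_mul matrix_mul_assoc)

lemma subst_mat_1 [simp]: "subst (mat 1) Q = Q"
  by (simp add: subst_def)

lemma subst_Sym2: "Q \<in> Sym2 \<Longrightarrow> subst g Q \<in> Sym2"
  by (simp add: Sym2_def subst_def matrix_transpose_mul matrix_mul_assoc)

lemma det_subst: "det (subst g Q) = det g * det g * det Q"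
  by (simp add: subst_def det_mul)

lemma span_pair: "mat4.span {P, Q} = {mscale a P + mscale b Q | a b. True}"
  using mat4_span_pair pair_in_span by blast

lemma act_span: "act g (mat4.span {P, Q}) = mat4.span {subst g P, subst g Q}"
proof -
  have "subst g ` {mscale a P + mscale b Q | a b. True} =
      {subst g (mscale a P + mscale b Q) | a b. True}" by auto
  then show ?thesis by (simp add: act_def span_pair subst_pair flip: subst_def)
qed

lemma act_act: "act g (act h W) = act (h ** g) W"
  by (simp add: act_def image_image subst_subst flip: subst_def)

lemma act_mat_1 [simp]: "act (mat 1) W = W"
  by (simp add: act_def flip: subst_def)

lemma O_node_act:
  assumes "invertible g"
  shows "act g W \<in> O_node \<longleftrightarrow> W \<in> O_node"
proof -
  have *: "act g W \<in> O_node" if "invertible g" "W \<in> O_node" for g and W :: "'a mat4 set"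
    using that act_act[of g _ W_node] by (auto simp: O_node_def) (metis invertible_mult)
  obtain g' where g': "g ** g' = mat 1" "g' ** g = mat 1" using assms by (auto simp: invertible_def)
  have "invertible g'" using g' by (auto simp: invertible_def)
  then show ?thesis using *[of g W] *[of g' "act g W"] assms g' by (auto simp: act_act)
qed

lemma W_node_in_O_node: "W_node \<in> O_node"
  using act_mat_1[of W_node] invertible_def matrix_mul_lid unfolding O_node_def by blast

lemma kernel_iff_det: "(\<exists>x. x \<noteq> 0 \<and> A *v x = 0) \<longleftrightarrow> det A = 0" for A :: "'k::field^'n^'n"
proof -
  have "invertible A \<longleftrightarrow> (\<forall>x. A *v x = 0 \<longrightarrow> x = 0)"
    using matrix_left_invertible_ker[of A] by (simp add: invertible_left_inverse)
  then show ?thesis using invertible_det_nz[of A] by blast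
qed

lemma square_root_exists: "\<exists>x :: 'k::alg_closed_field. x * x = a"
  using nth_root_exists[of 2 a] by (auto simp: power2_eq_square)

text \<open>Basis vectors 1 and 2 are eigenvectors for \<open>l1\<close> and \<open>l2\<close>;
  vector 3 is a null vector of \<open>A\<close> that is isotropic for \<open>B\<close>. Since
  columns 1 and 2 of the two forms are proportional, one completion of the square works for both.
  Scaling then normalizes the entries, and the entry \<open>c\<close> pairing vectors 0 and 3
  absorbs the remaining square in the second form. The condition on the kernel keeps the last
  diagonal coefficient of \<open>A\<close> nonzero.\<close>

lemma node_normal_form:
  fixes A B :: "'k::{alg_closed_field, field_char_0} mat4"
  assumes sym: "A \<in> Sym2" "B \<in> Sym2"
    and A3: "\<And>i. A $ i $ 3 = 0" and B33: "B $ 3 $ 3 = 0"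
    and B1: "\<And>i. B $ i $ 1 = l1 * A $ i $ 1" and B2: "\<And>i. B $ i $ 2 = l2 * A $ i $ 2"
    and l: "l1 \<noteq> l2" and d: "det (B - mscale l A) \<noteq> 0"
    and ker: "\<And>x. A *v x = 0 \<Longrightarrow> x $ 0 = 0"
  shows "mat4.span {A, B} \<in> O_node"
proof -
  have sA: "A $ i $ j = A $ j $ i" and sB: "B $ i $ j = B $ j $ i" for i j
    using sym by (auto simp: Sym2_iff)
  define a p q b1 b2 m c where abbr: "a = A $ 0 $ 0" "p = A $ 0 $ 1" "q = A $ 0 $ 2"
    "b1 = A $ 1 $ 1" "b2 = A $ 2 $ 2" "m = B $ 0 $ 0" "c = B $ 0 $ 3"
  \<comment> \<open>Eigenvectors for distinct eigenvalues are orthogonal.\<close>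
  have "l1 * A $ 2 $ 1 = l2 * A $ 2 $ 1" using B1[of 2] B2[of 1] sA[of 1 2] sB[of 1 2] by simp
  then have A21: "A $ 2 $ 1 = 0" using l by simp
  have A: "A $ 0 $ 0 = a" "A $ 0 $ 1 = p" "A $ 0 $ 2 = q" "A $ 0 $ 3 = 0"
    "A $ 1 $ 0 = p" "A $ 1 $ 1 = b1" "A $ 1 $ 2 = 0" "A $ 1 $ 3 = 0"
    "A $ 2 $ 0 = q" "A $ 2 $ 1 = 0" "A $ 2 $ 2 = b2" "A $ 2 $ 3 = 0"
    "A $ 3 $ 0 = 0" "A $ 3 $ 1 = 0" "A $ 3 $ 2 = 0" "A $ 3 $ 3 = 0"
    using A21 A3 sA by (auto simp: abbr)
  have B: "B $ 0 $ 0 = m" "B $ 0 $ 1 = l1 * p" "B $ 0 $ 2 = l2 * q" "B $ 0 $ 3 = c"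
    "B $ 1 $ 0 = l1 * p" "B $ 1 $ 1 = l1 * b1" "B $ 1 $ 2 = 0" "B $ 1 $ 3 = 0"
    "B $ 2 $ 0 = l2 * q" "B $ 2 $ 1 = 0" "B $ 2 $ 2 = l2 * b2" "B $ 2 $ 3 = 0"
    "B $ 3 $ 0 = c" "B $ 3 $ 1 = 0" "B $ 3 $ 2 = 0" "B $ 3 $ 3 = 0"
    using B1 B2 A B33 sB[of 1 0] sB[of 2 0] sB[of 1 3] sB[of 2 3] by (auto simp: abbr sB[of 3 0])
  have "det (B - mscale l A) = - (c * c * ((l1 - l) * b1) * ((l2 - l) * b2))"
    by (simp add: det_UNIV4 A B algebra_simps)
  then have nz: "b1 \<noteq> 0" "b2 \<noteq> 0" "c \<noteq> 0" using d by auto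
  \<comment> \<open>The vector \<open>(1, s, r, 0)\<close> is orthogonal to basis vectors 1 and 2
    for both forms; \<open>a'\<close> is the value of \<open>A\<close> at it.\<close>
  define s r where sr: "s = - p / b1" "r = - q / b2"
  have s: "p + b1 * s = 0" and r: "q + b2 * r = 0" using nz by (simp_all add: sr)
  define a' where "a' = a + p * s + q * r"
  have a': "a' \<noteq> 0"
  proof
    assume "a' = 0"
    define x :: "'k^4" where "x = (\<chi> i. if i = 0 then 1 else if i = 1 then s else if i = 2 then r else 0)"
    have "A *v x = 0"
      using \<open>a' = 0\<close> s r unfolding vec_eq_iff all_UNIV4 a'_def
      by (simp add: x_def matrix_vector_mult_def sum_UNIV4 A)
    then show False using ker[of x] by (simp add: x_def)
  qed
  obtain t0 where t0: "t0 * t0 = 1 / a'" using square_root_exists by blast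
  obtain t1 where t1: "t1 * t1 = 1 / b1" using square_root_exists by blast
  obtain t2 where t2: "t2 * t2 = 1 / b2" using square_root_exists by blast
  have t_nz: "t0 \<noteq> 0" "t1 \<noteq> 0" "t2 \<noteq> 0" using t0 t1 t2 a' nz by auto
  txt \<open>Replacing \<open>B\<close> by \<open>\<mu> (B - \<gamma> A)\<close> moves the eigenvalues \<open>l1\<close>, \<open>l2\<close> to those of the nodal pair, 1 and 2.\<close>
  define \<mu> \<gamma> where mu: "\<mu> = 1 / (l2 - l1)" "\<gamma> = 2 * l1 - l2"
  have mu_nz: "\<mu> \<noteq> 0" using l by (simp add: mu)
  have mu1: "\<mu> * (l1 - \<gamma>) = 1" and mu2: "\<mu> * (l2 - \<gamma>) = 2"
    using l by (simp_all add: mu field_simps)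
  \<comment> \<open>Adding a multiple of vector 3 does not affect \<open>A\<close>; the multiple
    \<open>\<kappa>\<close> makes the new vector 0 isotropic for
    \<open>B - \<gamma> A\<close>.\<close>
  define \<kappa> where "\<kappa> = (\<gamma> - t0 * t0 * (m + l1 * p * s + l2 * q * r)) / (2 * t0 * c)"
  have kappa: "2 * t0 * c * \<kappa> = \<gamma> - t0 * t0 * (m + l1 * p * s + l2 * q * r)"
    using t_nz nz by (simp add: \<kappa>_def)
  \<comment> \<open>Scaled so that the entry (0, 3) of \<open>subst h C\<close> becomes the
    \<open>1 / 2\<close> of the nodal form.\<close>
  define t3 where "t3 = 1 / (2 * \<mu> * t0 * c)"
  have t3: "\<mu> * t0 * c * t3 = 1 / 2" using t_nz nz mu_nz by (simp add: t3_def)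
  have t3_nz: "t3 \<noteq> 0" using t_nz nz mu_nz by (simp add: t3_def)
  define h :: "'k mat4" where "h = (\<chi> i j.
      if j = 0 then (if i = 0 then t0 else if i = 1 then t0 * s else if i = 2 then t0 * r else \<kappa>)
      else if i \<noteq> j then 0 else if i = 1 then t1 else if i = 2 then t2 else t3)"
  have h: "h $ 0 $ 0 = t0" "h $ 1 $ 0 = t0 * s" "h $ 2 $ 0 = t0 * r" "h $ 3 $ 0 = \<kappa>"
    "h $ 0 $ 1 = 0" "h $ 1 $ 1 = t1" "h $ 2 $ 1 = 0" "h $ 3 $ 1 = 0"
    "h $ 0 $ 2 = 0" "h $ 1 $ 2 = 0" "h $ 2 $ 2 = t2" "h $ 3 $ 2 = 0"
    "h $ 0 $ 3 = 0" "h $ 1 $ 3 = 0" "h $ 2 $ 3 = 0" "h $ 3 $ 3 = t3"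
    by (simp_all add: h_def)
  have "det h = t0 * (t1 * (t2 * t3))" by (simp add: det_UNIV4 h)
  then have inv: "invertible h" using t_nz t3_nz by (simp add: invertible_det_nz)
  have p: "p = - (b1 * s)" and q: "q = - (b2 * r)" using s r by (simp_all add: eq_neg_iff_add_eq_0)
  have hA: "subst h A = node_Q0"
    unfolding vec_eq_iff all_UNIV4 subst_nth column_def matrix_vector_mult_def sum_UNIV4
    using t0 t1 t2 a' nz
    by (simp add: A h node_Q0_def a'_def p q)
      (simp add: algebra_simps nonzero_eq_divide_eq)
  define C where "C = mscale \<mu> B + mscale (- \<mu> * \<gamma>) A"
  have C: "C $ i $ j = \<mu> * B $ i $ j - \<mu> * \<gamma> * A $ i $ j" for i j by (simp add: C_def)
  have T: "t0 * t0 * a' = 1" "t1 * t1 * b1 = 1" "t2 * t2 * b2 = 1"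
    using t0 t1 t2 a' nz by simp_all
  \<comment> \<open>The entry (0, 0) of \<open>subst h C\<close> in the shape that simplification
    produces; the other nonzero entries follow in \<open>e1\<close>, \<open>e2\<close> and
    \<open>e3\<close>.\<close>
  have e: "t0 * ((\<mu> * m - \<mu> * \<gamma> * a) * t0 + (\<mu> * \<gamma> * (b1 * s) - \<mu> * (l1 * (b1 * s))) * (t0 * s) +
        (\<mu> * \<gamma> * (b2 * r) - \<mu> * (l2 * (b2 * r))) * (t0 * r) + \<mu> * c * \<kappa>) +
      t0 * s * ((\<mu> * \<gamma> * (b1 * s) - \<mu> * (l1 * (b1 * s))) * t0 + (\<mu> * (l1 * b1) - \<mu> * \<gamma> * b1) * (t0 * s)) +
      t0 * r * ((\<mu> * \<gamma> * (b2 * r) - \<mu> * (l2 * (b2 * r))) * t0 + (\<mu> * (l2 * b2) - \<mu> * \<gamma> * b2) * (t0 * r)) +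
      \<kappa> * (\<mu> * c * t0) = 0"
    using T(1) kappa unfolding a'_def p q by algebra
  have e1: "t1 * ((\<mu> * (l1 * b1) - \<mu> * \<gamma> * b1) * t1) = 1" using T(2) mu1 by algebra
  have e2: "t2 * ((\<mu> * (l2 * b2) - \<mu> * \<gamma> * b2) * t2) = 2" using T(3) mu2 by algebra
  have e3: "t0 * (\<mu> * c * t3) * 2 = 1" "t3 * (\<mu> * c * t0) * 2 = 1" using t3 by (simp_all add: ac_simps)
  have hC: "subst h C = node_Q1"
    unfolding vec_eq_iff all_UNIV4 subst_nth column_def matrix_vector_mult_def sum_UNIV4
    by (simp add: A B C h node_Q1_def p q e e1 e2 e3) (simp add: algebra_simps)
  have "mat4.span {A, B} = mat4.span {A, C}"
    using span_change[of 1 \<mu> 0 "- \<mu> * \<gamma>" A B] mu_nz by (simp add: C_def add.commute)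
  then have "act h (mat4.span {A, B}) = W_node"
    by (simp add: act_span hA hC W_node_def)
  then show ?thesis using O_node_act[OF inv] W_node_in_O_node by metis
qed

section \<open>Pairs of quadrics with a common tangency\<close>

definition from_columns :: "'k::field^4 \<Rightarrow> 'k^4 \<Rightarrow> 'k^4 \<Rightarrow> 'k^4 \<Rightarrow> 'k mat4" where
  "from_columns e0 e1 e2 e3 =
     (\<chi> i j. if j = 0 then e0 $ i else if j = 1 then e1 $ i else if j = 2 then e2 $ i else e3 $ i)"

lemma column_from_columns [simp]:
  "column 0 (from_columns e0 e1 e2 e3) = e0" "column 1 (from_columns e0 e1 e2 e3) = e1"
  "column 2 (from_columns e0 e1 e2 e3) = e2" "column 3 (from_columns e0 e1 e2 e3) = e3"
  by (simp_all add: from_columns_def column_def)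

lemma from_columns_vector:
  "from_columns e0 e1 e2 e3 *v x = x $ 0 *s e0 + x $ 1 *s e1 + x $ 2 *s e2 + x $ 3 *s e3"
  by (simp add: vec_eq_iff matrix_vector_mult_def sum_UNIV4 from_columns_def ac_simps)

lemma invertible_from_columns:
  fixes e0 e1 e2 e3 :: "'k::field^4"
  assumes "e3 \<noteq> 0" "e2 \<notin> vec.span {e3}" "e1 \<notin> vec.span {e2, e3}" "e0 \<notin> vec.span {e1, e2, e3}"
  shows "invertible (from_columns e0 e1 e2 e3)"
proof -
  have "x = 0" if "from_columns e0 e1 e2 e3 *v x = 0" for x
  proof -
    have z: "x $ 0 *s e0 + x $ 1 *s e1 + x $ 2 *s e2 + x $ 3 *s e3 = 0"
      using that by (simp add: from_columns_vector)
    have *: "c = 0" if "c *s v + w = 0" "w \<in> vec.span S" "v \<notin> vec.span S" for c w S and v :: "'k^4"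
    proof (rule ccontr)
      assume "c \<noteq> 0"
      have "v = inverse c *s (c *s v)" using \<open>c \<noteq> 0\<close> by simp
      also have "c *s v = - w" using that(1) by (simp add: eq_neg_iff_add_eq_0)
      finally show False
        using that(2,3) vec.span_scale[OF vec.span_neg[OF that(2)], of "inverse c"] by simp
    qed
    have s3: "a *s e1 + (b *s e2 + c *s e3) \<in> vec.span {e1, e2, e3}"
      and s2: "b *s e2 + c *s e3 \<in> vec.span {e2, e3}" and s1: "c *s e3 \<in> vec.span {e3}" for a b c
      by (intro vec.span_add vec.span_scale; simp add: vec.span_base)+
    have x0: "x $ 0 = 0"
      using *[OF _ s3 assms(4)] z by (simp add: add.assoc)
    have x1: "x $ 1 = 0"
      using *[OF _ s2 assms(3)] z x0 by (simp add: add.assoc)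
    have x2: "x $ 2 = 0"
      using *[OF _ s1 assms(2)] z x0 x1 by simp
    have "x $ 3 = 0" using z x0 x1 x2 assms(1) by simp
    then show "x = 0" using x0 x1 x2 by (simp add: vec_eq_iff all_UNIV4)
  qed
  then show ?thesis
    using matrix_left_invertible_ker[of "from_columns e0 e1 e2 e3"] by (simp add: invertible_left_inverse)
qed

lemma exists_not_in_span3: "\<exists>x. x \<notin> vec.span {a, b, c :: 'k::field^4}"
proof (rule ccontr)
  assume "\<nexists>x. x \<notin> vec.span {a, b, c}"
  then have "(UNIV :: ('k^4) set) \<subseteq> vec.span {a, b, c}" by auto
  then have "vec.dim (UNIV :: ('k^4) set) \<le> card {a, b, c}" by (rule vec.dim_le_card) simp
  also have "card {a, b, c} \<le> 3" by (simp add: card_insert_if)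
  finally show False by (simp add: vec.dim_UNIV card_cart_basis)
qed

lemma exists_invertible_column3:
  fixes x :: "'k::field^4"
  assumes "x \<noteq> 0" obtains g :: "'k mat4" where "invertible g" "column 3 g = x"
proof -
  obtain e2 where e2: "e2 \<notin> vec.span {x}" using exists_not_in_span3[of x x x] by auto
  obtain e1 where e1: "e1 \<notin> vec.span {e2, x}" using exists_not_in_span3[of e2 x x] by auto
  obtain e0 where e0: "e0 \<notin> vec.span {e1, e2, x}" using exists_not_in_span3 by blast
  show thesis using that[OF invertible_from_columns[OF assms e2 e1 e0]] by simp
qed

lemma matrix_vector_axis: "g *v axis k 1 = column k (g :: 'k::field^'n^'m)"
  by (simp add: vec_eq_iff matrix_vector_mult_def column_def axis_def if_distrib cong: if_cong)

lemma kernel_subst: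
  assumes "invertible g"
  shows "subst g P *v x = 0 \<longleftrightarrow> P *v (g *v x) = 0"
proof
  assume x: "subst g P *v x = 0"
  obtain g' where g': "g ** g' = mat 1" using assms by (auto simp: invertible_def)
  have "transpose g' ** transpose g = mat 1" using g' by (simp flip: matrix_transpose_mul)
  moreover have "transpose g *v (P *v (g *v x)) = 0"
    using x by (simp add: subst_def matrix_vector_mul_assoc matrix_mul_assoc)
  ultimately show "P *v (g *v x) = 0"
    by (metis matrix_vector_mul_assoc matrix_vector_mul_lid matrix_vector_mult_0_right)
qed (simp add: subst_def flip: matrix_vector_mul_assoc)

text \<open>For \<open>P\<close> with zero last row and column, \<open>det (P + unit33)\<close> is
  the upper left 3 by 3 minor; it is nonzero exactly if the last basis vector spans the kernel of
  \<open>P\<close>.\<close>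

definition unit33 :: "'k::field mat4" where
  "unit33 = (\<chi> i j. if i = 3 \<and> j = 3 then 1 else 0)"

lemma unit33_nth: "unit33 $ i $ j = (if i = 3 \<and> j = 3 then 1 else 0)"
  by (simp add: unit33_def)

text \<open>The last coordinate point is singular for \<open>P\<close> and lies on \<open>Q\<close>,
  so it is a base point of the pencil.\<close>

definition tangent_pair :: "'k::field mat4 \<Rightarrow> 'k mat4 \<Rightarrow> bool" where
  "tangent_pair P Q \<longleftrightarrow> P \<in> Sym2 \<and> Q \<in> Sym2 \<and> (\<forall>i. P $ i $ 3 = 0) \<and> Q $ 3 $ 3 = 0"

text \<open>The kernel vector \<open>e3\<close> of \<open>P\<close> plays the part of an eigenvector
  for the eigenvalue infinity. Eigenvectors for \<open>l1\<close>, \<open>l2\<close> and infinity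
  are independent because \<open>Q - l P\<close> is invertible for some \<open>l\<close>; with any
  fourth vector they form a basis adapted to \<open>node_normal_form\<close>.\<close>

lemma tangent_pair_eigenvectors:
  fixes P Q :: "'k::{alg_closed_field, field_char_0} mat4"
  assumes PQ: "tangent_pair P Q" and r: "det (P + unit33) \<noteq> 0"
    and l: "l1 \<noteq> l2" "det (Q - mscale l1 P) = 0" "det (Q - mscale l2 P) = 0" "det (Q - mscale l P) \<noteq> 0"
  shows "mat4.span {P, Q} \<in> O_node"
proof -
  have sym: "P \<in> Sym2" "Q \<in> Sym2" and P3: "\<And>i. P $ i $ 3 = 0" and Q33: "Q $ 3 $ 3 = 0"
    using PQ by (auto simp: tangent_pair_def)
  have diff: "(Q - mscale k P) *v x = Q *v x - k *s (P *v x)" for k x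
    by (simp add: matrix_vector_mult_diff_rdistrib mscale_vector)
  obtain e1 where e1: "e1 \<noteq> 0" "Q *v e1 = l1 *s (P *v e1)"
    using l(2) kernel_iff_det[of "Q - mscale l1 P"] by (auto simp: diff)
  obtain e2 where e2: "e2 \<noteq> 0" "Q *v e2 = l2 *s (P *v e2)"
    using l(3) kernel_iff_det[of "Q - mscale l2 P"] by (auto simp: diff)
  define e3 :: "'k^4" where "e3 = axis 3 1"
  have e3: "e3 $ 0 = 0" "e3 $ 1 = 0" "e3 $ 2 = 0" "e3 $ 3 = 1" by (simp_all add: e3_def axis_def)
  have Pe3: "P *v e3 = 0"
    by (simp add: vec_eq_iff matrix_vector_mult_def sum_UNIV4 e3 P3)
  have reg: "x = 0" if "Q *v x - l *s (P *v x) = 0" for x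
    using l(4) kernel_iff_det[of "Q - mscale l P"] that by (auto simp: diff)
  have ll: "l1 \<noteq> l" "l2 \<noteq> l" using l by auto
  have n2: "e2 \<notin> vec.span {e3}"
  proof
    assume "e2 \<in> vec.span {e3}"
    then obtain k where "e2 = k *s e3" by (auto simp: vec.span_singleton)
    then have "P *v e2 = 0" using Pe3 by (simp add: vector_scalar_commute)
    then show False using reg[of e2] e2 by simp
  qed
  have n1: "e1 \<notin> vec.span {e2, e3}"
  proof
    assume "e1 \<in> vec.span {e2, e3}"
    then obtain k where "e1 - k *s e2 \<in> vec.span {e3}" by (auto simp: vec.span_insert)
    then obtain j where "e1 - k *s e2 = j *s e3" by (auto simp: vec.span_singleton)
    then have "e1 = k *s e2 + j *s e3" by (simp add: diff_eq_eq add.commute)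
    then have Pe1: "P *v e1 = k *s (P *v e2)"
      using Pe3 by (simp add: matrix_vector_right_distrib vector_scalar_commute)
    \<comment> \<open>Chosen so that \<open>Q - l P\<close> annihilates \<open>e1 - k' e2\<close>.
      Hence this vector is zero, and comparing images under \<open>P\<close> yields
      \<open>k' = k\<close>.\<close>
    define k' where "k' = k * (l1 - l) / (l2 - l)"
    have k': "k' * (l2 - l) = k * (l1 - l)" using ll by (simp add: k'_def)
    have "Q *v (e1 - k' *s e2) - l *s (P *v (e1 - k' *s e2)) = (k * (l1 - l) - k' * (l2 - l)) *s (P *v e2)"
      by (simp add: matrix_vector_mult_diff_distrib vector_scalar_commute e1(2) e2(2) Pe1
          vec_eq_iff algebra_simps)
    then have "e1 = k' *s e2" using reg[of "e1 - k' *s e2"] k' by simp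
    then have "k' *s (P *v e2) = k *s (P *v e2)" using Pe1 by (simp add: vector_scalar_commute)
    then have "(k' - k) *s (P *v e2) = 0" by (simp add: vec_eq_iff algebra_simps)
    moreover have "P *v e2 \<noteq> 0" using reg[of e2] e2 by auto
    ultimately have "k' = k" by simp
    then have "k * (l2 - l1) = 0" using k' by (simp add: algebra_simps)
    then have "k = 0" using l(1) by simp
    then show False using \<open>e1 = k' *s e2\<close> \<open>k' = k\<close> e1(1) by simp
  qed
  obtain e0 where n0: "e0 \<notin> vec.span {e1, e2, e3}" using exists_not_in_span3 by blast
  define g where "g = from_columns e0 e1 e2 e3"
  have "e3 \<noteq> 0" using e3(4) by auto
  then have inv: "invertible g" unfolding g_def by (rule invertible_from_columns[OF _ n2 n1 n0])
  have col: "column 1 g = e1" "column 2 g = e2" "column 3 g = e3" by (simp_all add: g_def)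
  have g3: "g $ i $ 3 = e3 $ i" for i using col(3) by (auto simp: column_def vec_eq_iff)
  have "mat4.span {subst g P, subst g Q} \<in> O_node"
  proof (rule node_normal_form)
    show "subst g P \<in> Sym2" "subst g Q \<in> Sym2" using sym by (simp_all add: subst_Sym2)
    show "subst g P $ i $ 3 = 0" for i by (simp add: subst_nth col Pe3)
    show "subst g Q $ 3 $ 3 = 0"
      by (simp add: subst_nth col sum_UNIV4 g3 e3 matrix_vector_mult_def Q33)
    show "subst g Q $ i $ 1 = l1 * subst g P $ i $ 1" for i
      by (simp add: subst_nth col e1 sum_distrib_left algebra_simps)
    show "subst g Q $ i $ 2 = l2 * subst g P $ i $ 2" for i
      by (simp add: subst_nth col e2 sum_distrib_left algebra_simps)
    show "l1 \<noteq> l2" by (rule l(1))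
    have "subst g Q - mscale l (subst g P) = subst g (Q - mscale l P)"
      using subst_pair[of g 1 Q "- l" P] by (simp add: vec_eq_iff)
    then show "det (subst g Q - mscale l (subst g P)) \<noteq> 0"
      using l(4) inv by (simp add: det_subst invertible_det_nz)
    show "x $ 0 = 0" if x: "subst g P *v x = 0" for x
    proof -
      have y: "P *v (g *v x) = 0" using x by (simp add: kernel_subst[OF inv])
      obtain g' where g': "g' ** g = mat 1" using inv by (auto simp: invertible_def)
      define y where "y = g *v x"
      \<comment> \<open>As \<open>P + unit33\<close> is injective, the kernel of \<open>P\<close>
        consists of the multiples of \<open>e3\<close>, which is the image of the last basis vector
        under \<open>g\<close>.\<close>
      have "(P + unit33) *v (y - y $ 3 *s e3) = 0"
      proof -
        have "unit33 *v (y - y $ 3 *s e3) = 0"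
          by (simp add: vec_eq_iff all_UNIV4 matrix_vector_mult_def sum_UNIV4 unit33_nth e3)
        moreover have "P *v (y - y $ 3 *s e3) = 0"
          using y Pe3 by (simp add: y_def matrix_vector_mult_diff_distrib vector_scalar_commute)
        ultimately show ?thesis by (simp add: matrix_vector_mult_add_rdistrib)
      qed
      then have "y - y $ 3 *s e3 = 0" using r kernel_iff_det[of "P + unit33"] by blast
      then have "y = y $ 3 *s e3" by simp
      then have "g *v x = g *v (y $ 3 *s axis 3 1)"
        by (simp add: vector_scalar_commute matrix_vector_axis col(3) flip: y_def)
      then have "g' *v (g *v x) = g' *v (g *v (y $ 3 *s axis 3 1))" by simp
      then have "x = y $ 3 *s axis 3 1"
        by (simp only: matrix_vector_mul_assoc g' matrix_vector_mul_lid)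
      then show "x $ 0 = 0" by (simp add: axis_def)
    qed
  qed
  then show ?thesis using O_node_act[OF inv] by (simp flip: act_span)
qed

lemma quadratic_roots:
  fixes a b c :: "'k::{alg_closed_field, field_char_0}"
  assumes "a \<noteq> 0"
  obtains r s where "\<And>x. a * x * x + b * x + c = a * (x - r) * (x - s)" "a * a * (r - s) * (r - s) = b * b - 4 * a * c"
proof -
  obtain w where w: "w * w = b * b - 4 * a * c" using square_root_exists by blast
  define r s where rs: "r = (- b + w) / (2 * a)" "s = (- b - w) / (2 * a)"
  have 1: "a * (r + s) = - b" using assms by (simp add: rs field_simps)
  have 2: "a * (r - s) = w" using assms by (simp add: rs field_simps)
  have "4 * a * (a * r * s) = (a * (r + s)) * (a * (r + s)) - (a * (r - s)) * (a * (r - s))"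
    by (simp add: algebra_simps)
  then have "4 * a * (a * r * s) = 4 * a * c" unfolding 1 2 using w by simp
  then have 3: "a * r * s = c" using assms by simp
  show thesis
  proof (rule that[of r s])
    show "a * x * x + b * x + c = a * (x - r) * (x - s)" for x using 1 3 by algebra
    show "a * a * (r - s) * (r - s) = b * b - 4 * a * c"
      using w unfolding 2[symmetric] by (simp add: ac_simps)
  qed
qed

definition border :: "'k::field mat4 \<Rightarrow> 'k mat4 \<Rightarrow> 'k mat4" where
  "border P Q = (\<chi> i j. if i = 3 \<or> j = 3 then Q $ i $ j else P $ i $ j)"

text \<open>The first factor says that the kernel of \<open>P\<close> is no larger than forced; the other two are the leading
  coefficient and the discriminant of the quadratic polynomial \<open>l \<mapsto> det (Q - l P)\<close>.\<close>

definition genericity :: "'k::field mat4 \<Rightarrow> 'k mat4 \<Rightarrow> 'k" where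
  "genericity P Q = det (P + unit33) * det (border P Q) *
     ((det (border P Q) + det Q - det (Q - P)) ^ 2 - 4 * det (border P Q) * det Q)"

text \<open>The last row and column of \<open>Q - l P\<close> are those of \<open>Q\<close>, with
  corner entry zero, so the determinant is quadratic in the 3 by 3 block. The leading coefficient
  arises by using the block of \<open>P\<close> alone, and the middle one is read off from the value
  at \<open>l = 1\<close>.\<close>

lemma det_tangent_pair:
  assumes "tangent_pair P Q"
  shows "det (Q - mscale l P) =
     det (border P Q) * l * l + - (det (border P Q) + det Q - det (Q - P)) * l + det Q"
proof -
  have sP: "P $ i $ j = P $ j $ i" and sQ: "Q $ i $ j = Q $ j $ i" and P3: "P $ i $ 3 = 0"
    and P3': "P $ 3 $ i = 0" and Q33: "Q $ 3 $ 3 = 0" for i j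
    using assms by (auto simp: tangent_pair_def Sym2_iff)
  show ?thesis
    by (simp add: det_UNIV4 border_def P3 P3' Q33) (simp add: algebra_simps)
qed

lemma generic_tangent_pair:
  fixes P Q :: "'k::{alg_closed_field, field_char_0} mat4"
  assumes PQ: "tangent_pair P Q" and g: "genericity P Q \<noteq> 0"
  shows "mat4.span {P, Q} \<in> O_node"
proof -
  define a b where ab: "a = det (border P Q)" "b = - (a + det Q - det (Q - P))"
  have a: "a \<noteq> 0" and r: "det (P + unit33) \<noteq> 0" and disc: "b * b - 4 * a * det Q \<noteq> 0"
    using g unfolding genericity_def ab power2_eq_square minus_mult_minus by auto
  obtain r s where rs: "\<And>x. a * x * x + b * x + det Q = a * (x - r) * (x - s)"
      "a * a * (r - s) * (r - s) = b * b - 4 * a * det Q"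
    using quadratic_roots[OF a] by blast
  have d: "det (Q - mscale l P) = a * (l - r) * (l - s)" for l
    using det_tangent_pair[OF PQ, of l] rs(1)[of l] by (simp add: ab)
  have "r \<noteq> s" using rs(2) disc by auto
  have "infinite (UNIV - {r, s})" using infinite_UNIV_char_0[where 'a = 'k] by simp
  then obtain l where "l \<noteq> r" "l \<noteq> s" by (metis DiffD2 finite.emptyI insertI1 insertI2 ex_in_conv)
  then show ?thesis
    using a d by (intro tangent_pair_eigenvectors[OF PQ r \<open>r \<noteq> s\<close>]) auto
qed

lemma node_tangent_pair: "tangent_pair node_Q0 node_Q1"
  by (auto simp: tangent_pair_def Sym2_iff node_Q0_def node_Q1_def)

lemma genericity_node: "genericity node_Q0 (node_Q1 :: 'k::field_char_0 mat4) \<noteq> 0"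
  by (simp add: genericity_def det_UNIV4 border_def unit33_nth node_Q0_def node_Q1_def
      power2_eq_square field_simps)

lemma poly_fun_genericity:
  assumes "\<And>i j. poly_fun (\<lambda>u. A u $ i $ j)" "\<And>i j. poly_fun (\<lambda>u. B u $ i $ j)"
  shows "poly_fun (\<lambda>u. genericity (A u) (B u))"
proof -
  have "poly_fun (\<lambda>u. border (A u) (B u) $ i $ j)" for i j
    using assms by (cases "i = 3 \<or> j = 3") (auto simp: border_def)
  then show ?thesis
    unfolding genericity_def using assms
    by (intro poly_fun_mult poly_fun_diff poly_fun_add poly_fun_power poly_fun_det poly_fun_const)
      (auto intro: poly_fun_add poly_fun_diff)
qed

section \<open>Pencils with a repeated root\<close>

text \<open>The dehomogenized discriminant quartic. One variable suffices, because a change of basis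
  of the pencil brings a given root to \<open>u = 0\<close>. The degree drops below four when
  \<open>Q\<close> is singular.\<close>

definition pencil_poly :: "'k::field mat4 \<Rightarrow> 'k mat4 \<Rightarrow> 'k poly" where
  "pencil_poly P Q = det (\<chi> i j. [:P $ i $ j, Q $ i $ j:])"

lemma poly_pencil_poly: "poly (pencil_poly P Q) u = det (P + mscale u Q)"
proof -
  have "poly (pencil_poly P Q) u = det (\<chi> i j. poly ((\<chi> i j. [:P $ i $ j, Q $ i $ j:]) $ i $ j) u)"
    unfolding pencil_poly_def by (rule det_hom) simp_all
  also have "(\<chi> i j. poly ((\<chi> i j. [:P $ i $ j, Q $ i $ j:]) $ i $ j) u) = P + mscale u Q"
    by (simp add: vec_eq_iff)
  finally show ?thesis .
qed

lemma poly_eqI_infinite: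
  fixes p q :: "'k::field_char_0 poly"
  assumes "\<And>u. poly p u = poly q u" shows "p = q"
  using assms by (simp flip: poly_eq_poly_eq_iff add: fun_eq_iff)

lemma pencil_poly_subst:
  "pencil_poly (subst g P) (subst g Q) = smult (det g * det g) (pencil_poly P (Q :: 'k::field_char_0 mat4))"
proof (rule poly_eqI_infinite)
  fix u
  have "subst g P + mscale u (subst g Q) = subst g (P + mscale u Q)"
    using subst_pair[of g 1 P u Q] by simp
  then show "poly (pencil_poly (subst g P) (subst g Q)) u = poly (smult (det g * det g) (pencil_poly P Q)) u"
    by (simp add: poly_pencil_poly det_subst)
qed

definition tangential :: "'k::field mat4 \<Rightarrow> 'k mat4 \<Rightarrow> bool" where
  "tangential P Q \<longleftrightarrow> coeff (pencil_poly P Q) 0 = 0 \<and> coeff (pencil_poly P Q) 1 = 0"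

lemma coeff_0_pencil_poly: "coeff (pencil_poly P Q) 0 = det P"
  using poly_pencil_poly[of P Q 0] by (simp add: poly_0_coeff_0 vec_eq_iff)

lemma x_squared_dvd_iff:
  fixes p :: "'a::comm_ring_1 poly"
  shows "[:0, 1:]\<^sup>2 dvd p \<longleftrightarrow> coeff p 0 = 0 \<and> coeff p 1 = 0"
proof -
  have "[:0, 1:]\<^sup>2 = monom (1 :: 'a) 2" by (simp add: monom_altdef)
  moreover have "(\<forall>k<2. coeff p k = 0) \<longleftrightarrow> coeff p 0 = 0 \<and> coeff p 1 = 0"
    by (auto simp: less_2_cases_iff)
  ultimately show ?thesis using monom_1_dvd_iff'[of 2 p] by simp
qed

lemma tangential_iff_dvd: "tangential P Q \<longleftrightarrow> [:0, 1:]\<^sup>2 dvd pencil_poly P Q"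
  by (simp add: tangential_def x_squared_dvd_iff)

text \<open>Jacobi's formula: the coefficient is the trace of the product of the adjugate of
  \<open>P\<close> with \<open>Q\<close>, and the adjugate has at most the entry (3, 3).\<close>

lemma coeff_1_pencil_poly:
  assumes "\<And>i. P $ i $ 3 = 0" "\<And>i. P $ 3 $ i = 0"
  shows "coeff (pencil_poly P Q) 1 = det (P + unit33) * Q $ 3 $ 3"
  by (simp add: pencil_poly_def det_UNIV4 assms unit33_nth) (simp add: algebra_simps)

lemma quadratic_form_pencil:
  assumes "Q \<in> Sym2"
  shows "quadratic_form Q (w + t *s e) =
     quadratic_form Q e * t * t + 2 * (\<Sum>i\<in>UNIV. w $ i * (Q *v e) $ i) * t + quadratic_form Q w"
proof -
  have s: "Q $ i $ j = Q $ j $ i" for i j using assms by (auto simp: Sym2_iff)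
  show ?thesis
    unfolding quadratic_form_def matrix_vector_mult_def sum_UNIV4
    by (simp add: s[of 1 0] s[of 2 0] s[of 3 0] s[of 2 1] s[of 3 1] s[of 3 2])
      (simp add: algebra_simps)
qed

lemma subst_33: "subst g Q $ 3 $ 3 = quadratic_form Q (column 3 g)"
  unfolding subst_nth quadratic_form_def matrix_vector_mult_def sum_UNIV4
  by (simp add: column_def algebra_simps)

text \<open>If the kernel of \<open>P\<close> is a line, the vanishing derivative says that
  \<open>Q\<close> is zero on it. Otherwise the kernel contains a plane, and a binary quadratic form
  over an algebraically closed field has a nontrivial zero.\<close>

lemma tangential_isotropic:
  fixes P Q :: "'k::{alg_closed_field, field_char_0} mat4"
  assumes "P \<in> Sym2" "Q \<in> Sym2" and t: "tangential P Q"
  obtains x where "x \<noteq> 0" "P *v x = 0" "quadratic_form Q x = 0"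
proof -
  have "det P = 0" using t by (simp add: tangential_def coeff_0_pencil_poly)
  then obtain e where e: "e \<noteq> 0" "P *v e = 0" using kernel_iff_det[of P] by blast
  show thesis
  proof (cases "quadratic_form Q e = 0")
    case True
    then show thesis using that e by blast
  next
    case False
    obtain g :: "'k mat4" where g: "invertible g" "column 3 g = e"
      using exists_invertible_column3[OF e(1)] by blast
    have P3: "subst g P $ i $ 3 = 0" for i by (simp add: subst_nth g e)
    have P3': "subst g P $ 3 $ i = 0" for i
      using P3 subst_Sym2[OF assms(1), of g] by (simp add: Sym2_iff)
    have "coeff (pencil_poly (subst g P) (subst g Q)) 1 = 0"
      using t by (simp add: pencil_poly_subst tangential_def)
    \<comment> \<open>The derivative is this determinant times the nonzero value of \<open>Q\<close>
      at \<open>e\<close>. So there is a second kernel vector, with no component along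
      \<open>e\<close>.\<close>
    then have "det (subst g P + unit33) = 0"
      using coeff_1_pencil_poly[OF P3 P3', of "subst g Q"] False by (simp add: subst_33 g)
    then obtain y where y: "y \<noteq> 0" "(subst g P + unit33) *v y = 0"
      using kernel_iff_det by blast
    have "((subst g P + unit33) *v y) $ 3 = 0" using y(2) by simp
    then have y3: "y $ 3 = 0"
      by (simp add: matrix_vector_mult_def sum_UNIV4 P3' unit33_nth)
    have "unit33 *v y = 0"
      by (simp add: vec_eq_iff all_UNIV4 matrix_vector_mult_def sum_UNIV4 unit33_nth y3)
    then have "subst g P *v y = 0" using y(2) by (simp add: matrix_vector_mult_add_rdistrib)
    then have w: "P *v (g *v y) = 0" by (simp add: kernel_subst[OF g(1)])
    define w where "w = g *v y"
    obtain r s where "\<And>t. quadratic_form Q e * t * t + 2 * (\<Sum>i\<in>UNIV. w $ i * (Q *v e) $ i) * t + quadratic_form Q w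
        = quadratic_form Q e * (t - r) * (t - s)"
      by (rule quadratic_roots[OF False]) blast
    then have q: "quadratic_form Q (w + r *s e) = 0"
      by (simp add: quadratic_form_pencil[OF assms(2)])
    have "w + r *s e \<noteq> 0"
    proof
      assume "w + r *s e = 0"
      moreover have "e = g *v axis 3 1" using g(2) by (simp add: matrix_vector_axis)
      ultimately have "g *v (y + r *s axis 3 1) = 0"
        by (simp add: w_def matrix_vector_right_distrib vector_scalar_commute)
      then have z: "y + r *s axis 3 1 = 0"
        using g(1) kernel_iff_det[of g] by (auto simp: invertible_det_nz)
      have "y $ i = 0" for i
      proof (cases "i = 3")
        case False
        have "(y + r *s axis 3 1) $ i = 0" using z by simp
        then show ?thesis using False by (simp add: axis_def)
      qed (simp add: y3)
      then show False using y(1) by (simp add: vec_eq_iff)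
    qed
    moreover have "P *v (w + r *s e) = 0"
      using w e(2) by (simp add: w_def matrix_vector_right_distrib vector_scalar_commute)
    ultimately show thesis using that q by blast
  qed
qed

lemma W_node_in_Gr: "W_node \<in> (Gr :: 'k::field_char_0 mat4 set set)"
proof -
  have "pluecker node_Q0 (node_Q1 :: 'k mat4) ((0, 0), (0, 3)) \<noteq> 0"
    by (simp add: pluecker_def node_Q0_def node_Q1_def)
  then show ?thesis
    using node_tangent_pair unfolding W_node_def span_in_Gr_iff tangent_pair_def by blast
qed

lemma pluecker_nz_iff:
  "(\<exists>x. pluecker P Q x \<noteq> 0) \<longleftrightarrow> (\<forall>a b. mscale a P + mscale b Q = 0 \<longrightarrow> a = 0 \<and> b = 0)"
proof
  assume "\<exists>x. pluecker P Q x \<noteq> 0"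
  then obtain x where x: "pluecker P Q x \<noteq> 0" ..
  show "\<forall>a b. mscale a P + mscale b Q = 0 \<longrightarrow> a = 0 \<and> b = 0"
  proof (intro allI impI)
    fix a b assume "mscale a P + mscale b Q = 0"
    then show "a = 0 \<and> b = 0" using pluecker_eq_0_if_dependent[of a P b Q x] x by blast
  qed
next
  assume r: "\<forall>a b. mscale a P + mscale b Q = 0 \<longrightarrow> a = 0 \<and> b = 0"
  have "Q \<noteq> 0"
    using r[rule_format, of 0 1] by auto
  moreover have "P \<noteq> mscale k Q" for k
  proof
    assume "P = mscale k Q"
    then have "mscale 1 P + mscale (- k) Q = 0" by (simp add: vec_eq_iff)
    then show False using r[rule_format, of 1 "- k"] by simp
  qed
  moreover have "P \<noteq> Q" using \<open>\<And>k. P \<noteq> mscale k Q\<close>[of 1] by (auto simp: vec_eq_iff)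
  ultimately have "mat4.independent {P, Q} \<and> P \<noteq> Q"
    by (auto simp: mat4.independent_insert mat4.span_singleton)
  then show "\<exists>x. pluecker P Q x \<noteq> 0" by (simp only: independent_pair_iff)
qed

lemma Gr_act:
  assumes "invertible g" "W \<in> Gr" shows "act g W \<in> Gr"
proof -
  obtain P Q where W: "W = mat4.span {P, Q}" using Gr_span[OF assms(2)] by blast
  obtain h where h: "g ** h = mat 1" using assms(1) by (auto simp: invertible_def)
  have "a = 0 \<and> b = 0" if "mscale a (subst g P) + mscale b (subst g Q) = 0" for a b
  proof -
    have "subst h (subst g (mscale a P + mscale b Q)) = subst h 0" using that by (simp add: subst_pair)
    moreover have "subst h 0 = 0" by (simp add: subst_def matrix_matrix_mult_def vec_eq_iff)
    ultimately have "mscale a P + mscale b Q = 0" by (simp add: subst_subst h)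
    then show ?thesis using assms(2) unfolding W span_in_Gr_iff pluecker_nz_iff by blast
  qed
  then show ?thesis
    using assms(2) unfolding W act_span span_in_Gr_iff pluecker_nz_iff by (auto simp: subst_Sym2)
qed

lemma O_node_subset_Gr: "O_node \<subseteq> (Gr :: 'k::field_char_0 mat4 set set)"
  using W_node_in_Gr Gr_act unfolding O_node_def by blast

lemma poly_fun_subst:
  assumes "\<And>i j. poly_fun (\<lambda>u. g u $ i $ j)" "\<And>i j. poly_fun (\<lambda>u. A u $ i $ j)"
  shows "poly_fun (\<lambda>u. subst (g u) (A u) $ i $ j)"
  unfolding subst_def by (intro poly_fun_matrix_mult poly_fun_transpose assms)

lemma tangential_in_closure:
  fixes P Q :: "'k::{alg_closed_field, field_char_0} mat4"
  assumes G: "mat4.span {P, Q} \<in> Gr" and t: "tangential P Q"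
  shows "mat4.span {P, Q} \<in> zariski closure_of O_node"
proof -
  have sym: "P \<in> Sym2" "Q \<in> Sym2" using G by (simp_all add: span_in_Gr_iff)
  obtain x where x: "x \<noteq> 0" "P *v x = 0" "quadratic_form Q x = 0"
    using tangential_isotropic[OF sym t] by blast
  obtain g :: "'k mat4" where g: "invertible g" "column 3 g = x"
    using exists_invertible_column3[OF x(1)] by blast
  have tp: "tangent_pair (subst g P) (subst g Q)"
    using sym x by (simp add: tangent_pair_def subst_Sym2 subst_33 g) (simp add: subst_nth g x)
  obtain h where h: "g ** h = mat 1" "h ** g = mat 1" using g(1) by (auto simp: invertible_def)
  have h_inv: "invertible h" using h by (auto simp: invertible_def)
  \<comment> \<open>The line is drawn in coordinates adapted to \<open>x\<close>, where it stays
    among the tangent pairs; \<open>subst h\<close> carries it back.\<close>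
  define A where "A u = line (subst g P) node_Q0 u" for u
  define B where "B u = line (subst g Q) node_Q1 u" for u
  have AB: "poly_fun (\<lambda>u. A u $ i $ j)" "poly_fun (\<lambda>u. B u $ i $ j)" for i j
    unfolding A_def B_def by (rule poly_fun_line)+
  have tAB: "tangent_pair (A u) (B u)" for u
    using tp node_tangent_pair[where 'a = 'k] unfolding tangent_pair_def A_def B_def
    by (auto simp: line_Sym2) (simp_all add: line_nth)
  have AB0: "subst h (A 0) = P" "subst h (B 0) = Q"
    by (simp_all add: A_def B_def subst_subst h)
  have "mat4.span {subst h (A 0), subst h (B 0)} \<in> zariski closure_of O_node"
  proof (rule closure_curve[where A = "\<lambda>u. subst h (A u)" and B = "\<lambda>u. subst h (B u)"])
    show "poly_fun (\<lambda>u. subst h (A u) $ i $ j)" "poly_fun (\<lambda>u. subst h (B u) $ i $ j)" for i j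
      by (rule poly_fun_subst; simp add: AB)+
    show "poly_fun (\<lambda>u. genericity (A u) (B u))" by (rule poly_fun_genericity[OF AB])
    show "genericity (A 1) (B 1) \<noteq> 0" using genericity_node by (simp add: A_def B_def)
    show "mat4.span {subst h (A u), subst h (B u)} \<in> O_node" if "genericity (A u) (B u) \<noteq> 0" for u
      using generic_tangent_pair[OF tAB that] O_node_act[OF h_inv] by (simp flip: act_span)
  qed (use G AB0 O_node_subset_Gr in auto)
  then show ?thesis by (simp add: AB0)
qed

section \<open>The binary discriminant quartic and its restriction to one variable\<close>

lemma poly_altdef_le:
  fixes p :: "'a::comm_semiring_1 poly"
  shows "degree p \<le> n \<Longrightarrow> poly p x = (\<Sum>i\<le>n. coeff p i * x ^ i)"
  unfolding poly_altdef by (rule sum.mono_neutral_left) (auto simp: coeff_eq_0)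

text \<open>The outer variable is \<open>t\<close> and the inner one \<open>s\<close>, so
  \<open>t\<close> is substituted first, as a constant polynomial in \<open>s\<close>.\<close>

definition eval2 :: "'k::field poly poly \<Rightarrow> 'k \<Rightarrow> 'k \<Rightarrow> 'k" where
  "eval2 f s t = poly (poly f [:t:]) s"

lemma eval2_simps [simp]:
  "eval2 (f + g) s t = eval2 f s t + eval2 g s t" "eval2 (f - g) s t = eval2 f s t - eval2 g s t"
  "eval2 (f * g) s t = eval2 f s t * eval2 g s t" "eval2 (f ^ n) s t = eval2 f s t ^ n"
  "eval2 1 s t = 1" "eval2 s_var s t = s" "eval2 t_var s t = t" "eval2 (const2 c) s t = c"
  by (simp_all add: eval2_def)

lemma eval2_discriminant_quartic:
  "eval2 (discriminant_quartic P Q) s t = det (mscale s P + mscale t Q)"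
proof -
  define M where "M = (\<chi> i j. s_var * const2 (P $ i $ j) + t_var * const2 (Q $ i $ j))"
  have "eval2 (discriminant_quartic P Q) s t = det (\<chi> i j. eval2 (M $ i $ j) s t)"
    unfolding discriminant_quartic_def M_def[symmetric] by (rule det_hom) (simp_all only: eval2_simps)
  also have "(\<chi> i j. eval2 (M $ i $ j) s t) = mscale s P + mscale t Q"
    unfolding M_def by (simp only: vec_eq_iff vec_lambda_beta eval2_simps) simp
  finally show ?thesis .
qed

lemma poly_fun_poly: "poly_fun f \<Longrightarrow> poly_fun (\<lambda>u. poly p (f u))"
  unfolding poly_altdef by (intro poly_fun_sum poly_fun_mult poly_fun_power) auto

lemma eval2_altdef: "eval2 f s t = (\<Sum>i\<le>degree f. poly (coeff f i) s * t ^ i)"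
  by (simp add: eval2_def poly_altdef[of f] poly_sum)

lemma poly_fun_eval2: "poly_fun f \<Longrightarrow> poly_fun g \<Longrightarrow> poly_fun (\<lambda>u. eval2 F (f u) (g u))"
  unfolding eval2_altdef by (intro poly_fun_sum poly_fun_mult poly_fun_power poly_fun_poly)

text \<open>In a basis of the pencil that starts with the root \<open>[a : b]\<close>, the linear
  factor \<open>b s - a t\<close> becomes a multiple of \<open>u\<close>.\<close>

lemma tangential_if_repeated_root:
  fixes P Q :: "'k::field_char_0 mat4"
  assumes "has_repeated_root (discriminant_quartic P Q)"
  obtains P' Q' where "mat4.span {P', Q'} = mat4.span {P, Q}" "tangential P' Q'"
proof -
  obtain a b f where ab: "(a, b) \<noteq> (0, 0)"
    and f: "discriminant_quartic P Q = (const2 b * s_var - const2 a * t_var)\<^sup>2 * f"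
    using assms by (auto simp: has_repeated_root_def dvd_def)
  \<comment> \<open>A coordinate vector independent of \<open>(a, b)\<close>, completing it to a
    basis.\<close>
  define c d :: 'k where cd: "c = (if a = 0 then 1 else 0)" "d = (if a = 0 then 0 else 1)"
  have nz: "a * d - b * c \<noteq> 0" using ab by (auto simp: cd)
  define P' Q' where PQ': "P' = mscale a P + mscale b Q" "Q' = mscale c P + mscale d Q"
  have "poly_fun (\<lambda>u. eval2 f (a + u * c) (b + u * d))"
    by (intro poly_fun_eval2 poly_fun_add poly_fun_mult poly_fun_id poly_fun_const)
  then obtain r where r: "\<And>u. eval2 f (a + u * c) (b + u * d) = poly r u"
    by (auto simp: poly_fun_def)
  have "pencil_poly P' Q' = [:0, 1:]\<^sup>2 * smult ((b * c - a * d)\<^sup>2) r"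
  proof (rule poly_eqI_infinite)
    fix u
    have "P' + mscale u Q' = mscale (a + u * c) P + mscale (b + u * d) Q"
      by (simp add: PQ' vec_eq_iff algebra_simps)
    then have "poly (pencil_poly P' Q') u = eval2 (discriminant_quartic P Q) (a + u * c) (b + u * d)"
      by (simp add: poly_pencil_poly eval2_discriminant_quartic)
    also have "\<dots> = (b * (a + u * c) - a * (b + u * d))\<^sup>2 * poly r u"
      unfolding f eval2_simps r ..
    also have "b * (a + u * c) - a * (b + u * d) = u * (b * c - a * d)" by (simp add: algebra_simps)
    finally show "poly (pencil_poly P' Q') u = poly ([:0, 1:]\<^sup>2 * smult ((b * c - a * d)\<^sup>2) r) u"
      by (simp add: power_mult_distrib)
  qed
  then have "tangential P' Q'" unfolding tangential_iff_dvd by (rule dvdI)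
  moreover have "mat4.span {P', Q'} = mat4.span {P, Q}" unfolding PQ' by (rule span_change[OF nz])
  ultimately show thesis using that by blast
qed

text \<open>By homogeneity the quartic at \<open>(s, t)\<close> is \<open>s^4\<close> times the
  pencil polynomial at \<open>t / s\<close>, so for each nonzero \<open>s\<close> its two lowest
  coefficients in \<open>t\<close> vanish. These are polynomials in \<open>s\<close> with infinitely
  many zeros, hence zero, and the repeated root is \<open>[1 : 0]\<close>.\<close>

lemma repeated_root_if_tangential:
  fixes P Q :: "'k::field_char_0 mat4"
  assumes "tangential P Q"
  shows "has_repeated_root (discriminant_quartic P Q)"
proof -
  let ?f = "discriminant_quartic P Q"
  obtain r where r: "pencil_poly P Q = [:0, 1:]\<^sup>2 * r"
    using assms unfolding tangential_iff_dvd by (auto simp: dvd_def)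
  have z: "poly (coeff ?f i) s = 0" if "s \<noteq> 0" "i < 2" for s i
  proof -
    define fs where "fs = map_poly (\<lambda>p. poly p s) ?f"
    have cfs: "coeff fs j = poly (coeff ?f j) s" for j by (simp add: fs_def coeff_map_poly)
    have "fs = [:0, 1:]\<^sup>2 * smult (s\<^sup>2) (r \<circ>\<^sub>p [:0, 1 / s:])"
    proof (rule poly_eqI_infinite)
      fix t
      have "degree fs \<le> degree ?f" by (intro degree_le) (auto simp: cfs coeff_eq_0)
      then have "poly fs t = eval2 ?f s t"
        unfolding eval2_altdef by (simp add: poly_altdef_le cfs)
      also have "\<dots> = det (mat s ** (P + mscale (t / s) Q))"
      proof -
        have "mscale s P + mscale t Q = mat s ** (P + mscale (t / s) Q)"
          using that(1) unfolding vec_eq_iff all_UNIV4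
          by (simp add: matrix_matrix_mult_def mat_def sum_UNIV4 algebra_simps)
        then show ?thesis by (simp add: eval2_discriminant_quartic)
      qed
      also have "\<dots> = s ^ 4 * poly (pencil_poly P Q) (t / s)"
        by (simp add: det_mul poly_pencil_poly) (simp add: det_UNIV4 mat_def power4_eq_xxxx)
      also have "\<dots> = poly ([:0, 1:]\<^sup>2 * smult (s\<^sup>2) (r \<circ>\<^sub>p [:0, 1 / s:])) t"
        using that(1) by (simp add: r poly_pcompose field_simps power2_eq_square power4_eq_xxxx)
      finally show "poly fs t = \<dots>" .
    qed
    then have "[:0, 1:]\<^sup>2 dvd fs" by (rule dvdI)
    then have "coeff fs 0 = 0 \<and> coeff fs 1 = 0" by (simp only: x_squared_dvd_iff)
    then show ?thesis using that(2) by (auto simp: cfs less_2_cases_iff)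
  qed
  have "coeff ?f i = 0" if "i < 2" for i
  proof (rule ccontr)
    assume "coeff ?f i \<noteq> 0"
    then have "finite {s. poly (coeff ?f i) s = 0}" by (rule poly_roots_finite)
    moreover have "UNIV - {0} \<subseteq> {s. poly (coeff ?f i) s = 0}" using z[OF _ that] by auto
    ultimately have "finite (UNIV - {0 :: 'k})" by (rule finite_subset[rotated])
    then show False using infinite_UNIV_char_0[where 'a = 'k] by simp
  qed
  then have "t_var\<^sup>2 dvd ?f" by (simp only: x_squared_dvd_iff)
  moreover have "(const2 0 * s_var - const2 1 * t_var)\<^sup>2 = (t_var :: 'k poly poly)\<^sup>2"
    by (simp add: power2_eq_square)
  ultimately show ?thesis
    unfolding has_repeated_root_def by (intro exI[of _ 1] exI[of _ 0]) (simp only: prod.inject, simp)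
qed

lemma repeated_root_pencils_iff:
  "W \<in> repeated_root_pencils \<longleftrightarrow>
     W \<in> Gr \<and> (\<exists>P Q. W = mat4.span {P, Q :: 'k::field_char_0 mat4} \<and> tangential P Q)"
  using repeated_root_if_tangential tangential_if_repeated_root
  unfolding repeated_root_pencils_def by (smt (verit, ccfv_threshold) mem_Collect_eq)

section \<open>Tangency to the determinantal hypersurface\<close>

lemma det_derivative_eq: "det_derivative P Q = coeff (pencil_poly P Q) 1"
  by (simp add: det_derivative_def pencil_poly_def)

lemma det_derivative_subst:
  "det_derivative (subst g P) (subst g (Q :: 'k::field_char_0 mat4)) = det g * det g * det_derivative P Q"
  by (simp add: det_derivative_eq pencil_poly_subst)

lemma span_extend:
  assumes "Q \<in> mat4.span {A, B}" "Q \<noteq> 0"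
  obtains M where "mat4.span {A, B} = mat4.span {Q, M}"
proof -
  obtain a b where Q: "Q = mscale a A + mscale b B" using assms(1) by (rule mat4_span_pair)
  show thesis
  proof (cases "a = 0")
    case False
    then show thesis using that[of B] span_change[of a 1 b 0 A B] by (simp add: Q)
  next
    case True
    then have "b \<noteq> 0" using assms(2) Q by auto
    then show thesis using that[of A] span_change[of a 0 b 1 A B] by (simp add: Q)
  qed
qed

lemma tangent_pencils_subset:
  "tangent_pencils \<subseteq> (repeated_root_pencils :: 'k::field_char_0 mat4 set set)"
proof
  fix W :: "'k mat4 set" assume "W \<in> tangent_pencils"
  then obtain Q where W: "W \<in> Gr" and Q: "tangent_to_D_at W Q" by (auto simp: tangent_pencils_def)
  have Q': "Q \<in> W" "Q \<noteq> 0" "det Q = 0" "W \<subseteq> tangent_space_D Q"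
    using Q by (auto simp: tangent_to_D_at_def smooth_point_D_def on_D_def)
  obtain A B where "W = mat4.span {A, B}" using Gr_span[OF W] by blast
  then obtain M where M: "W = mat4.span {Q, M}" using Q'(1,2) span_extend by metis
  have "M \<in> W" by (simp add: M mat4.span_base)
  then have "det_derivative Q M = 0" using Q'(4) by (auto simp: tangent_space_D_def)
  then have "tangential Q M"
    using Q'(3) by (simp only: tangential_def coeff_0_pencil_poly det_derivative_eq)
  then show "W \<in> repeated_root_pencils" using W M by (auto simp: repeated_root_pencils_iff)
qed

text \<open>The double root \<open>t = 0\<close> is the cone \<open>node_Q0\<close>; the two other
  roots are simple.\<close>

lemma det_node_pencil:
  "det (mscale s node_Q0 + mscale t node_Q1) = - (1 / 4) * t * t * (s + t) * (s + 2 * t)"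
  for s t :: "'k::field_char_0"
  by (simp add: det_UNIV4 node_Q0_def node_Q1_def)

lemma pencil_poly_node:
  fixes a b c d :: "'k::field_char_0"
  shows "pencil_poly (mscale a node_Q0 + mscale b node_Q1) (mscale c node_Q0 + mscale d node_Q1) =
    smult (- (1 / 4)) ([:b, d:] * [:b, d:] * [:a + b, c + d:] * [:a + 2 * b, c + 2 * d:])"
proof (rule poly_eqI_infinite)
  fix u
  have "mscale a node_Q0 + mscale b node_Q1 + mscale u (mscale c node_Q0 + mscale d node_Q1) =
      mscale (a + u * c) node_Q0 + mscale (b + u * d) (node_Q1 :: 'k mat4)"
    by (simp add: vec_eq_iff algebra_simps)
  then show "poly (pencil_poly (mscale a node_Q0 + mscale b node_Q1) (mscale c node_Q0 + mscale d node_Q1)) u =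
    poly (smult (- (1 / 4)) ([:b, d:] * [:b, d:] * [:a + b, c + d:] * [:a + 2 * b, c + 2 * d:])) u"
    unfolding poly_pencil_poly by (simp only: det_node_pencil) (simp add: algebra_simps)
qed

text \<open>The double root is a quadric of corank one, hence a smooth point of \<open>D\<close>
  where the pencil is tangent. At the two other singular members the determinant has a simple zero
  along the pencil, and this one nonzero derivative gives both smoothness and
  transversality.\<close>

lemma O_node_subset_tangent_pencils:
  "O_node \<subseteq> (tangent_pencils :: 'k::field_char_0 mat4 set set)"
proof
  fix W :: "'k mat4 set" assume "W \<in> O_node"
  then obtain g where g: "invertible g" and Wg: "W = act g W_node" by (auto simp: O_node_def)
  have dg: "det g \<noteq> 0" using g by (simp add: invertible_det_nz)
  define N where "N a b = mscale a node_Q0 + mscale b (node_Q1 :: 'k mat4)" for a b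
  have W: "W = {subst g (N a b) | a b. True}"
    unfolding Wg W_node_def act_def span_pair subst_def[symmetric] N_def by auto
  have NS: "N a b \<in> Sym2" for a b
    using node_tangent_pair[where 'a = 'k] by (auto simp: N_def tangent_pair_def Sym2_iff)
  have dd: "det_derivative (N a b) (N c d) = - (1 / 4) *
      (2 * b * d * (a + b) * (a + 2 * b) + b * b * ((c + d) * (a + 2 * b) + (a + b) * (c + 2 * d)))" for a b c d
    unfolding det_derivative_eq N_def pencil_poly_node by simp (simp add: algebra_simps)
  have detN: "det (N a b) = - (1 / 4) * b * b * (a + b) * (a + 2 * b)" for a b
    unfolding N_def by (rule det_node_pencil)
  define Q where "Q = subst g (N 1 0)"
  have ginj: "subst g A = 0 \<Longrightarrow> A = 0" for A
  proof -
    assume "subst g A = 0"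
    moreover obtain h where "g ** h = mat 1" using g by (auto simp: invertible_def)
    ultimately show "A = 0"
      using subst_subst[of h g A] subst_pair[of h 0 0 0 0] by simp
  qed
  have on: "on_D (subst g (N a b)) \<longleftrightarrow> subst g (N a b) \<noteq> 0 \<and> det (N a b) = 0" for a b
    using dg NS by (auto simp: on_D_def subst_Sym2 det_subst)
  have WG: "W \<in> Gr" using O_node_subset_Gr \<open>W \<in> O_node\<close> by blast
  have "W \<in> tangent_pencils"
    unfolding tangent_pencils_def mem_Collect_eq
  proof (intro conjI exI ballI impI)
    show "W \<in> Gr" by (rule WG)
    have QW: "Q \<in> W" by (auto simp: W Q_def)
    have U: "(unit33 :: 'k mat4) \<in> Sym2" by (auto simp: Sym2_iff unit33_nth)
    have N10: "N 1 0 = node_Q0" by (simp add: N_def)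
    have "det_derivative (N 1 0) unit33 = 1"
      unfolding det_derivative_eq N10
      by (subst coeff_1_pencil_poly) (auto simp: node_Q0_def unit33_nth det_UNIV4)
    then have "det_derivative Q (subst g unit33) \<noteq> 0"
      using dg by (simp add: Q_def det_derivative_subst)
    moreover have "Q \<noteq> 0"
    proof
      assume "Q = 0"
      then have "node_Q0 $ 0 $ 0 = (0 :: 'k)" using ginj[of "N 1 0"] by (simp add: Q_def N10)
      then show False by (simp add: node_Q0_def)
    qed
    moreover have "det (N 1 0) = 0" by (simp add: detN)
    ultimately have "smooth_point_D Q"
      using on[of 1 0] subst_Sym2[OF U, of g] by (auto simp: smooth_point_D_def Q_def)
    moreover have "W \<subseteq> tangent_space_D Q"
      using NS by (auto simp: W tangent_space_D_def Q_def subst_Sym2 det_derivative_subst dd)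
    ultimately show "tangent_to_D_at W Q" using QW by (simp add: tangent_to_D_at_def)
    fix Q' assume "Q' \<in> W" and Q': "on_D Q' \<and> Q' \<notin> mat4.span {Q}"
    then obtain a b where ab: "Q' = subst g (N a b)" by (auto simp: W)
    have "b \<noteq> 0"
    proof
      assume "b = 0"
      then have "Q' = mscale a Q" using subst_pair[of g a "N 1 0" 0 0] by (simp add: ab Q_def N_def)
      then show False using Q' by (auto simp: mat4.span_singleton)
    qed
    then have "(a + b) * (a + 2 * b) = 0" using Q' on[of a b] by (auto simp: ab detN)
    then have "a = - b \<or> a = - (2 * b)" by (auto simp: add_eq_0_iff2)
    then have "det_derivative (N a b) (N 1 0) \<noteq> 0" using \<open>b \<noteq> 0\<close> by (auto simp: dd)
    then have nz: "det_derivative Q' Q \<noteq> 0" using dg by (simp add: ab Q_def det_derivative_subst)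
    moreover have "Q \<in> Sym2" using NS by (simp add: Q_def subst_Sym2)
    ultimately show "transverse_to_D_at W Q'"
      using Q' QW \<open>Q' \<in> W\<close> by (auto simp: transverse_to_D_at_def smooth_point_D_def tangent_space_D_def)
  qed
  then show "W \<in> tangent_pencils" .
qed

section \<open>Equality of the three closures\<close>

lemma repeated_root_pencils_subset_closure:
  "repeated_root_pencils \<subseteq> zariski closure_of (O_node :: 'k::{alg_closed_field, field_char_0} mat4 set set)"
  using tangential_in_closure by (auto simp: repeated_root_pencils_iff)

lemma tangency_locus_eq:
  "tangency_locus = zariski closure_of (O_node :: 'k::{alg_closed_field, field_char_0} mat4 set set)"
  unfolding tangency_locus_def
  using tangent_pencils_subset repeated_root_pencils_subset_closure O_node_subset_tangent_pencils
  by (meson closedin_closure_of closure_of_minimal closure_of_mono order_trans subset_antisym)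

lemma F_inf_eq:
  "F_inf = zariski closure_of (O_node :: 'k::{alg_closed_field, field_char_0} mat4 set set)"
  unfolding F_inf_def
  using tangent_pencils_subset repeated_root_pencils_subset_closure O_node_subset_tangent_pencils
  by (meson closedin_closure_of closure_of_minimal closure_of_mono order_trans subset_antisym)

section \<open>Polynomial functions on an affine chart\<close>

text \<open>The inductive form allows homogenization and expansion in one entry to be proved by rule
  induction. Restricted to chart pairs, these functions form the coordinate ring of the
  chart.\<close>

inductive pair_poly :: "('k::field mat4 \<Rightarrow> 'k mat4 \<Rightarrow> 'k) \<Rightarrow> bool" where
  const [intro, simp]: "pair_poly (\<lambda>P Q. c)"
| fst [intro, simp]: "pair_poly (\<lambda>P Q. P $ i $ j)"
| snd [intro, simp]: "pair_poly (\<lambda>P Q. Q $ i $ j)"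
| add [intro, simp]: "pair_poly f \<Longrightarrow> pair_poly g \<Longrightarrow> pair_poly (\<lambda>P Q. f P Q + g P Q)"
| mult [intro, simp]: "pair_poly f \<Longrightarrow> pair_poly g \<Longrightarrow> pair_poly (\<lambda>P Q. f P Q * g P Q)"

lemma pair_poly_uminus [intro, simp]: "pair_poly f \<Longrightarrow> pair_poly (\<lambda>P Q. - f P Q)"
  using pair_poly.mult[OF pair_poly.const[of "- 1"], of f] by simp

lemma pair_poly_diff [intro, simp]: "pair_poly f \<Longrightarrow> pair_poly g \<Longrightarrow> pair_poly (\<lambda>P Q. f P Q - g P Q)"
  using pair_poly.add[of f "\<lambda>P Q. - g P Q"] by simp

lemma pair_poly_power [intro, simp]: "pair_poly f \<Longrightarrow> pair_poly (\<lambda>P Q. f P Q ^ n)"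
  by (induction n) simp_all

lemma pair_poly_sum [intro]: "(\<And>i. i \<in> S \<Longrightarrow> pair_poly (f i)) \<Longrightarrow> pair_poly (\<lambda>P Q. \<Sum>i\<in>S. f i P Q)"
  by (induction S rule: infinite_finite_induct) simp_all

lemma pair_poly_prod [intro]: "(\<And>i. i \<in> S \<Longrightarrow> pair_poly (f i)) \<Longrightarrow> pair_poly (\<lambda>P Q. \<Prod>i\<in>S. f i P Q)"
  by (induction S rule: infinite_finite_induct) simp_all

lemma pair_poly_mv_eval: "pair_poly (\<lambda>P Q. mv_eval G (pluecker P Q))"
proof -
  have "pair_poly (\<lambda>P Q. pluecker P Q x)" for x
    unfolding pluecker_def split_beta by (intro pair_poly_diff pair_poly.mult pair_poly.fst pair_poly.snd)
  then show ?thesis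
    unfolding mv_eval_def by (intro pair_poly_sum pair_poly.mult pair_poly_prod pair_poly_power pair_poly.const)
qed

lemma poly_fun_pair_poly:
  assumes "pair_poly f" "\<And>i j. poly_fun (\<lambda>u. A u $ i $ j)" "\<And>i j. poly_fun (\<lambda>u. B u $ i $ j)"
  shows "poly_fun (\<lambda>u. f (A u) (B u))"
  using assms(1) by induction (simp_all add: assms(2,3))

lemma exists_common_nonzero:
  fixes f g :: "'k::field_char_0 \<Rightarrow> 'k"
  assumes "poly_fun f" "poly_fun g" "f u0 \<noteq> 0" "g u1 \<noteq> 0"
  obtains u where "f u \<noteq> 0" "g u \<noteq> 0"
proof -
  have "finite ({u. f u = 0} \<union> {u. g u = 0})"
    using poly_fun_finite_zeros assms by blast
  then obtain u where "u \<notin> {u. f u = 0} \<union> {u. g u = 0}"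
    using ex_new_if_finite infinite_UNIV_char_0 by blast
  then show thesis using that by blast
qed

text \<open>Row-reduced bases of the pencils whose Pluecker coordinate at
  \<open>((0, 0), (1, 1))\<close> is nonzero: an affine space of dimension 16 in which both entries
  at (3, 3) remain free.\<close>

definition chart :: "'k::field mat4 \<Rightarrow> 'k mat4 \<Rightarrow> bool" where
  "chart P Q \<longleftrightarrow> P \<in> Sym2 \<and> Q \<in> Sym2 \<and>
     P $ 0 $ 0 = 1 \<and> P $ 1 $ 1 = 0 \<and> Q $ 0 $ 0 = 0 \<and> Q $ 1 $ 1 = 1"

lemma chart_pluecker:
  assumes "chart P Q"
  shows "pluecker P Q ((i, j), (1, 1)) = P $ i $ j" "pluecker P Q ((0, 0), (i, j)) = Q $ i $ j"
  using assms by (simp_all add: chart_def pluecker_def)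

lemma chart_Gr: "chart P Q \<Longrightarrow> mat4.span {P, Q} \<in> Gr"
  using chart_pluecker(1)[of P Q 0 0] unfolding span_in_Gr_iff chart_def by (metis zero_neq_one)

lemma chart_line: "chart P Q \<Longrightarrow> chart P' Q' \<Longrightarrow> chart (line P P' u) (line Q Q' u)"
  by (simp add: chart_def line_Sym2 line_nth)

lemma chart_basis_exists:
  assumes "mat4.span {P, Q} \<in> Gr" and p: "pluecker P Q ((0, 0), (1, 1)) \<noteq> 0"
  obtains P' Q' where "chart P' Q'" "mat4.span {P', Q'} = mat4.span {P, Q}"
proof -
  define p where "p = P $ 0 $ 0 * Q $ 1 $ 1 - P $ 1 $ 1 * Q $ 0 $ 0"
  have p_nz: "p \<noteq> 0" using p by (simp add: p_def pluecker_def)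
  define P' where "P' = mscale (Q $ 1 $ 1 / p) P + mscale (- P $ 1 $ 1 / p) Q"
  define Q' where "Q' = mscale (- Q $ 0 $ 0 / p) P + mscale (P $ 0 $ 0 / p) Q"
  have "Q $ 1 $ 1 / p * (P $ 0 $ 0 / p) - (- P $ 1 $ 1 / p) * (- Q $ 0 $ 0 / p) = p / (p * p)"
    by (simp add: p_def diff_divide_distrib mult.commute)
  then have "mat4.span {P', Q'} = mat4.span {P, Q}"
    unfolding P'_def Q'_def using p_nz by (intro span_change) simp
  moreover have "chart P' Q'"
  proof -
    have "P \<in> Sym2" "Q \<in> Sym2" using assms(1) by (simp_all add: span_in_Gr_iff)
    then have "P' \<in> Sym2" "Q' \<in> Sym2" by (simp_all add: Sym2_iff P'_def Q'_def)
    moreover have "P' $ 0 $ 0 = (P $ 0 $ 0 * Q $ 1 $ 1 - P $ 1 $ 1 * Q $ 0 $ 0) / p" "P' $ 1 $ 1 = 0"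
      "Q' $ 0 $ 0 = 0" "Q' $ 1 $ 1 = (P $ 0 $ 0 * Q $ 1 $ 1 - P $ 1 $ 1 * Q $ 0 $ 0) / p"
      by (simp_all add: P'_def Q'_def diff_divide_distrib mult.commute)
    ultimately show ?thesis using p_nz by (simp add: chart_def flip: p_def)
  qed
  ultimately show thesis using that by blast
qed

definition mv_var :: "'i \<Rightarrow> ('i, 'k::field) mvpoly" where
  "mv_var x = Poly_Mapping.single (Poly_Mapping.single x 1) 1"

lemma mv_eval_var: "mv_eval (mv_var x) p = p (x :: 'i::finite)"
proof -
  have "(\<Prod>i\<in>UNIV. p i ^ Poly_Mapping.lookup (Poly_Mapping.single x (1 :: nat)) i) =
      (\<Prod>i\<in>UNIV. if i = x then p i else 1)"
    by (intro prod.cong) (auto simp: lookup_single)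
  then show ?thesis by (simp add: mv_var_def mv_eval_single)
qed

lemma mv_homogeneous_var: "mv_homogeneous 1 (mv_var (x :: 'i::finite))"
proof -
  have "(\<Sum>i\<in>UNIV. Poly_Mapping.lookup (Poly_Mapping.single x (1 :: nat)) i) = (\<Sum>i\<in>UNIV. if i = x then 1 else 0)"
    by (intro sum.cong) (auto simp: lookup_single)
  then show ?thesis by (simp add: mv_homogeneous_def mv_var_def)
qed

lemma mv_eval_1 [simp]: "mv_eval 1 x = 1"
  using mv_eval_single[of 0 1 x] by simp

lemma mv_homogeneous_power: "mv_homogeneous d f \<Longrightarrow> mv_homogeneous (n * d) (f ^ n)"
  by (induction n) (auto simp: mv_homogeneous_mult, simp add: mv_homogeneous_def)

lemma mv_eval_power: "mv_eval (f ^ n) x = mv_eval f x ^ n"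
  by (induction n) (simp_all add: mv_eval_mult)

lemma mv_homogeneous_add:
  "mv_homogeneous d f \<Longrightarrow> mv_homogeneous d g \<Longrightarrow> mv_homogeneous d (f + g)"
  using keys_add[of f g] by (auto simp: mv_homogeneous_def)

text \<open>The Pluecker coordinate at \<open>((0, 0), (1, 1))\<close> equals 1 on chart pairs, so
  its powers equalize the degrees of two summands without changing values.\<close>

lemma pair_poly_homogenize:
  assumes "pair_poly f"
  shows "\<exists>d G. mv_homogeneous d G \<and> (\<forall>P Q. chart P Q \<longrightarrow> mv_eval G (pluecker P Q) = f P Q)"
  using assms
proof induction
  case (const c)
  have "mv_homogeneous 0 (Poly_Mapping.single 0 c :: ((4 \<times> 4) \<times> (4 \<times> 4), 'a) mvpoly)"
    by (simp add: mv_homogeneous_def)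
  moreover have "mv_eval (Poly_Mapping.single 0 c) x = c" for x :: "(4 \<times> 4) \<times> (4 \<times> 4) \<Rightarrow> 'a"
    by (simp add: mv_eval_single)
  ultimately show ?case by blast
next
  case (fst i j)
  show ?case using mv_homogeneous_var by (metis mv_eval_var chart_pluecker(1))
next
  case (snd i j)
  show ?case using mv_homogeneous_var by (metis mv_eval_var chart_pluecker(2))
next
  case (add f g)
  then obtain d F e G where F: "mv_homogeneous d F" "\<And>P Q. chart P Q \<Longrightarrow> mv_eval F (pluecker P Q) = f P Q"
    and G: "mv_homogeneous e G" "\<And>P Q. chart P Q \<Longrightarrow> mv_eval G (pluecker P Q) = g P Q" by metis
  let ?v = "mv_var ((0, 0), (1, 1)) :: ((4 \<times> 4) \<times> (4 \<times> 4), 'a) mvpoly"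
  have v: "mv_homogeneous n (?v ^ n)" for n
    using mv_homogeneous_power[OF mv_homogeneous_var] by (metis mult.right_neutral)
  have "mv_homogeneous (d + e) (F * ?v ^ e + G * ?v ^ d)"
    using mv_homogeneous_mult[OF F(1) v[of e]] mv_homogeneous_mult[OF G(1) v[of d]]
    by (intro mv_homogeneous_add) (simp_all add: add.commute)
  moreover have "mv_eval (F * ?v ^ e + G * ?v ^ d) (pluecker P Q) = f P Q + g P Q" if "chart P Q" for P Q
    using F(2) G(2) that chart_pluecker(1)[OF that, of 0 0]
    by (simp add: mv_eval_add mv_eval_mult mv_eval_power mv_eval_var chart_def)
  ultimately show ?case by blast
next
  case (mult f g)
  then obtain d F e G where F: "mv_homogeneous d F" "\<And>P Q. chart P Q \<Longrightarrow> mv_eval F (pluecker P Q) = f P Q"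
    and G: "mv_homogeneous e G" "\<And>P Q. chart P Q \<Longrightarrow> mv_eval G (pluecker P Q) = g P Q" by metis
  show ?case using mv_homogeneous_mult[OF F(1) G(1)] F(2) G(2) by (metis mv_eval_mult)
qed

text \<open>Pencils outside the chart are included in the closed set.\<close>

lemma chart_closed_set:
  assumes "pair_poly f"
  obtains Z where "closedin zariski Z"
    "\<And>P Q. chart P Q \<Longrightarrow> mat4.span {P, Q} \<in> Z \<longleftrightarrow> f P Q = 0"
    "\<And>W. W \<in> Gr \<Longrightarrow> W \<notin> Z \<Longrightarrow> \<exists>P Q. chart P Q \<and> W = mat4.span {P, Q}"
proof -
  obtain d G where G: "mv_homogeneous d G" "\<And>P Q. chart P Q \<Longrightarrow> mv_eval G (pluecker P Q) = f P Q"
    using pair_poly_homogenize[OF assms] by blast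
  let ?v = "mv_var ((0, 0), (1, 1)) :: ((4 \<times> 4) \<times> (4 \<times> 4), 'a) mvpoly"
  \<comment> \<open>The extra factor vanishes at every pencil outside the chart.\<close>
  have h: "mv_homogeneous (d + 1) (G * ?v)" by (rule mv_homogeneous_mult[OF G(1) mv_homogeneous_var])
  show thesis
  proof (rule that)
    show "closedin zariski (zero_locus {G * ?v})" by (rule closedin_zero_locus_single[OF h])
    show "mat4.span {P, Q} \<in> zero_locus {G * ?v} \<longleftrightarrow> f P Q = 0" if "chart P Q" for P Q
      using in_zero_locus_iff[OF h chart_Gr[OF that]] G(2)[OF that] chart_pluecker(1)[OF that, of 0 0] that
      by (simp add: mv_eval_mult mv_eval_var chart_def)
    show "\<exists>P Q. chart P Q \<and> W = mat4.span {P, Q}" if W: "W \<in> Gr" "W \<notin> zero_locus {G * ?v}" for W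
    proof -
      obtain P Q where PQ: "W = mat4.span {P, Q}" using Gr_span[OF W(1)] by blast
      then have "mv_eval (G * ?v) (pluecker P Q) \<noteq> 0"
        using in_zero_locus_iff[OF h, of P Q] W by simp
      then have "pluecker P Q ((0, 0), (1, 1)) \<noteq> 0" by (simp add: mv_eval_mult mv_eval_var)
      then show ?thesis using chart_basis_exists[of P Q] W(1) PQ by metis
    qed
  qed
qed

definition nonzero_on_chart :: "('k::field mat4 \<Rightarrow> 'k mat4 \<Rightarrow> 'k) \<Rightarrow> bool" where
  "nonzero_on_chart f \<longleftrightarrow> (\<exists>P Q. chart P Q \<and> f P Q \<noteq> 0)"

text \<open>The coordinate ring of the chart is a domain: on the line joining two chart pairs, both
  factors restrict to nonzero polynomials.\<close>

lemma nonzero_on_chart_mult: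
  fixes f g :: "'k::field_char_0 mat4 \<Rightarrow> 'k mat4 \<Rightarrow> 'k"
  assumes "pair_poly f" "pair_poly g" "nonzero_on_chart f" "nonzero_on_chart g"
  shows "nonzero_on_chart (\<lambda>P Q. f P Q * g P Q)"
proof -
  obtain P Q P' Q' where c: "chart P Q" "f P Q \<noteq> 0" "chart P' Q'" "g P' Q' \<noteq> 0"
    using assms(3,4) by (auto simp: nonzero_on_chart_def)
  have pf: "poly_fun (\<lambda>u. f (line P P' u) (line Q Q' u))" "poly_fun (\<lambda>u. g (line P P' u) (line Q Q' u))"
    by (rule poly_fun_pair_poly; simp add: assms poly_fun_line)+
  obtain u where "f (line P P' u) (line Q Q' u) \<noteq> 0" "g (line P P' u) (line Q Q' u) \<noteq> 0"
    by (rule exists_common_nonzero[OF pf, of 0 1]) (use c in auto)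
  then show ?thesis using chart_line[OF c(1,3)] by (auto simp: nonzero_on_chart_def)
qed

definition poly_family :: "('k::field mat4 \<Rightarrow> 'k mat4 \<Rightarrow> 'k poly) \<Rightarrow> bool" where
  "poly_family F \<longleftrightarrow> (\<forall>i. pair_poly (\<lambda>P Q. coeff (F P Q) i))"

lemma poly_family_add [intro]: "poly_family F \<Longrightarrow> poly_family G \<Longrightarrow> poly_family (\<lambda>P Q. F P Q + G P Q)"
  and poly_family_diff [intro]: "poly_family F \<Longrightarrow> poly_family G \<Longrightarrow> poly_family (\<lambda>P Q. F P Q - G P Q)"
  and poly_family_mult [intro]: "poly_family F \<Longrightarrow> poly_family G \<Longrightarrow> poly_family (\<lambda>P Q. F P Q * G P Q)"
  by (auto simp: poly_family_def coeff_mult intro!: pair_poly_sum)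

lemma poly_family_linear [intro]:
  assumes "pair_poly f" "pair_poly g" shows "poly_family (\<lambda>P Q. [:f P Q, g P Q:])"
  unfolding poly_family_def
proof
  fix i
  show "pair_poly (\<lambda>P Q. coeff [:f P Q, g P Q:] i)"
    using assms by (cases i; cases "i - 1") (auto simp: coeff_pCons split: nat.split)
qed

lemma poly_family_pencil_poly:
  assumes "\<And>i j. pair_poly (\<lambda>P Q. A P Q $ i $ j)" "\<And>i j. pair_poly (\<lambda>P Q. B P Q $ i $ j)"
  shows "poly_family (\<lambda>P Q. pencil_poly (A P Q) (B P Q))"
proof -
  have "poly_family (\<lambda>P Q. [:A P Q $ i $ j, B P Q $ i $ j:])" for i j
    by (rule poly_family_linear[OF assms])
  then show ?thesis
    unfolding pencil_poly_def det_UNIV4 vec_lambda_beta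
    by (intro poly_family_add poly_family_diff poly_family_mult)
qed

lemma pair_poly_coeff_pencil_poly:
  "pair_poly (\<lambda>P (Q :: 'k::field mat4). coeff (pencil_poly P Q) i)"
  using poly_family_pencil_poly[where 'a = 'k, of "\<lambda>P Q. P" "\<lambda>P Q. Q"] by (simp add: poly_family_def)

section \<open>Variation of the two diagonal entries at (3, 3)\<close>

definition corner :: "'k::field mat4 \<Rightarrow> 'k mat4" where
  "corner A = (\<chi> i j. if i = 3 \<or> j = 3 then 0 else A $ i $ j)"

lemma det_add_unit33: "det (A + mscale c unit33) = det A + c * det (corner A + unit33)"
  by (simp add: det_UNIV4 corner_def unit33_nth) (simp add: algebra_simps)

text \<open>The upper left 3 by 3 minor of \<open>P + u Q\<close>; the added \<open>unit33\<close>
  turns it into a 4 by 4 determinant, so that it is again a \<open>pencil_poly\<close>.\<close>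

definition minor_poly :: "'k::field mat4 \<Rightarrow> 'k mat4 \<Rightarrow> 'k poly" where
  "minor_poly P Q = pencil_poly (corner P + unit33) (corner Q)"

text \<open>The determinant is affine in the entry (3, 3), with the minor as slope, and this entry
  is shifted by \<open>z + w u\<close>.\<close>

lemma pencil_poly_shift:
  "pencil_poly (P + mscale z unit33) (Q + mscale w unit33) =
     pencil_poly P Q + [:z, w:] * minor_poly P (Q :: 'k::field_char_0 mat4)"
proof (rule poly_eqI_infinite)
  fix u
  have e: "P + mscale z unit33 + mscale u (Q + mscale w unit33) = P + mscale u Q + mscale (z + u * w) unit33"
    by (simp add: vec_eq_iff algebra_simps)
  have c: "corner (P + mscale u Q) + unit33 = corner P + unit33 + mscale u (corner Q)"
    by (simp add: vec_eq_iff corner_def)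
  show "poly (pencil_poly (P + mscale z unit33) (Q + mscale w unit33)) u =
      poly (pencil_poly P Q + [:z, w:] * minor_poly P Q) u"
    unfolding poly_add poly_mult poly_pencil_poly minor_poly_def e det_add_unit33 c by simp
qed

lemma coeff_1_pcompose_linear: "coeff (p \<circ>\<^sub>p [:t, 1:]) 1 = poly (pderiv p) (t :: 'k::field_char_0)"
proof -
  have "coeff (p \<circ>\<^sub>p [:t, 1:]) 1 = poly (pderiv (p \<circ>\<^sub>p [:t, 1:])) 0"
    by (simp add: poly_0_coeff_0 coeff_pderiv)
  then show ?thesis by (simp add: pderiv_pcompose poly_pcompose pderiv_pCons)
qed

text \<open>Replacing \<open>P\<close> by \<open>P + t Q\<close> moves the root to 0 within the same
  pencil.\<close>

lemma double_root_in_closure: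
  fixes P Q :: "'k::{alg_closed_field, field_char_0} mat4"
  assumes "mat4.span {P, Q} \<in> Gr" "poly (pencil_poly P Q) t = 0" "poly (pderiv (pencil_poly P Q)) t = 0"
  shows "mat4.span {P, Q} \<in> zariski closure_of O_node"
proof -
  have "pencil_poly (P + mscale t Q) Q = pencil_poly P Q \<circ>\<^sub>p [:t, 1:]"
  proof (rule poly_eqI_infinite)
    fix u
    have e: "P + mscale t Q + mscale u Q = P + mscale (t + u) Q"
      by (simp add: vec_eq_iff algebra_simps)
    show "poly (pencil_poly (P + mscale t Q) Q) u = poly (pencil_poly P Q \<circ>\<^sub>p [:t, 1:]) u"
      unfolding poly_pcompose poly_pencil_poly e by simp
  qed
  then have "tangential (P + mscale t Q) Q"
    unfolding tangential_def using assms(2,3)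
    by (simp only: coeff_1_pcompose_linear) (simp flip: poly_0_coeff_0 add: poly_pcompose)
  moreover have "mat4.span {P + mscale t Q, Q} = mat4.span {P, Q}"
    using span_change[of 1 1 t 0 P Q] by simp
  ultimately show ?thesis using tangential_in_closure[of "P + mscale t Q" Q] assms(1) by simp
qed

text \<open>The numerator of the derivative of the quotient of the quartic by the cubic minor.\<close>

definition wronskian :: "'k::field mat4 \<Rightarrow> 'k mat4 \<Rightarrow> 'k poly" where
  "wronskian P Q = pderiv (pencil_poly P Q) * minor_poly P Q - pencil_poly P Q * pderiv (minor_poly P Q)"

text \<open>Zero if the derivative of that quotient is constant. Adding multiples of \<open>unit33\<close> to \<open>P\<close> and \<open>Q\<close>
  changes the quotient only by a linear polynomial.\<close>

definition nonconstancy :: "'k::field mat4 \<Rightarrow> 'k mat4 \<Rightarrow> 'k" where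
  "nonconstancy P Q = poly (wronskian P Q) 0 * (poly (minor_poly P Q) 1)\<^sup>2
     - poly (wronskian P Q) 1 * (poly (minor_poly P Q) 0)\<^sup>2"

lemma degree_pencil_poly_le: "degree (pencil_poly P Q) \<le> 4"
proof -
  have "degree (of_int (sign p) * (\<Prod>i\<in>UNIV. [:P $ i $ p i, Q $ i $ p i:])) \<le> 4" for p
  proof -
    have "degree (\<Prod>i\<in>UNIV. [:P $ i $ p i, Q $ i $ p i:]) \<le> sum (degree \<circ> (\<lambda>i. [:P $ i $ p i, Q $ i $ p i:])) UNIV"
      by (rule degree_prod_sum_le) simp
    also have "\<dots> \<le> (\<Sum>i\<in>(UNIV :: 4 set). 1)" by (rule sum_mono) simp
    finally have "degree (\<Prod>i\<in>UNIV. [:P $ i $ p i, Q $ i $ p i:]) \<le> 4" by simp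
    then show ?thesis
      using degree_mult_le[of "of_int (sign p)" "\<Prod>i\<in>UNIV. [:P $ i $ p i, Q $ i $ p i:]"] by simp
  qed
  then show ?thesis unfolding pencil_poly_def det_def by (intro degree_sum_le) (simp_all add: finite_permutations)
qed

text \<open>A degree bound uniform in the pair turns evaluation into a sum of fixed length.\<close>

lemma pair_poly_poly:
  assumes "poly_family F" "\<And>P Q. degree (F P Q) \<le> n"
  shows "pair_poly (\<lambda>P Q. poly (F P Q) c)"
  using assms unfolding poly_altdef_le[OF assms(2)] poly_family_def
  by (intro pair_poly_sum pair_poly.mult) auto

lemma pair_poly_nonconstancy: "pair_poly (nonconstancy :: 'k::field_char_0 mat4 \<Rightarrow> 'k mat4 \<Rightarrow> 'k)"
proof -
  have pp: "poly_family (\<lambda>P (Q :: 'k mat4). pencil_poly P Q)"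
    by (rule poly_family_pencil_poly) simp_all
  have c: "pair_poly (\<lambda>P (Q :: 'k mat4). (corner P + unit33) $ i $ j)"
    "pair_poly (\<lambda>(P :: 'k mat4) Q. corner Q $ i $ j)" for i j
    by (cases "i = 3 \<or> j = 3"; auto simp: corner_def)+
  have mp: "poly_family (\<lambda>P (Q :: 'k mat4). minor_poly P Q)"
    unfolding minor_poly_def by (rule poly_family_pencil_poly) (rule c)+
  have pd: "poly_family (\<lambda>P Q. pderiv (F P Q))" if "poly_family F" for F :: "'k mat4 \<Rightarrow> 'k mat4 \<Rightarrow> 'k poly"
    using that by (auto simp: poly_family_def coeff_pderiv)
  have d: "degree (pencil_poly P Q) \<le> 4" "degree (minor_poly P Q) \<le> 4"
    "degree (pderiv (pencil_poly P Q)) \<le> 4" "degree (pderiv (minor_poly P Q)) \<le> 4" for P Q :: "'k mat4"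
    using degree_pencil_poly_le[of P Q] degree_pencil_poly_le[of "corner P + unit33" "corner Q"]
    by (simp_all add: minor_poly_def degree_pderiv)
  show ?thesis
    unfolding nonconstancy_def[abs_def] wronskian_def poly_diff poly_mult
    by (intro pair_poly_diff pair_poly.mult pair_poly_power pair_poly_poly[OF pp d(1)] pair_poly_poly[OF mp d(2)]
        pair_poly_poly[OF pd[OF pp] d(3)] pair_poly_poly[OF pd[OF mp] d(4)])
qed

text \<open>Together with \<open>ref_Q\<close> this gives the quartic -1 and the minor
  \<open>u\<close>, whose quotient has a nonconstant derivative. The pair also serves as a base
  point of the chart.\<close>

definition ref_P :: "'k::field mat4" where
  "ref_P = (\<chi> i j. if (i, j) \<in> {(0, 0), (2, 2), (1, 3), (3, 1)} then 1 else 0)"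

definition ref_Q :: "'k::field mat4" where
  "ref_Q = (\<chi> i j. if (i, j) = (1, 1) then 1 else 0)"

lemma chart_ref: "chart ref_P ref_Q"
  by (auto simp: chart_def Sym2_iff ref_P_def ref_Q_def)

lemma nonconstancy_ref: "nonconstancy ref_P (ref_Q :: 'k::field_char_0 mat4) \<noteq> 0"
proof -
  have 1: "pencil_poly ref_P (ref_Q :: 'k mat4) = [:- 1:]"
    by (rule poly_eqI_infinite) (simp add: poly_pencil_poly det_UNIV4 ref_P_def ref_Q_def)
  have 2: "minor_poly ref_P (ref_Q :: 'k mat4) = [:0, 1:]"
    unfolding minor_poly_def
    by (rule poly_eqI_infinite) (simp add: poly_pencil_poly det_UNIV4 ref_P_def ref_Q_def corner_def unit33_nth)
  show ?thesis by (simp add: nonconstancy_def wronskian_def 1 2 pderiv_pCons)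
qed

text \<open>The ring A of the overview. The entry \<open>Q $ 3 $ 3\<close> is among its
  variables.\<close>

definition indep33 :: "('k::field mat4 \<Rightarrow> 'k mat4 \<Rightarrow> 'k) \<Rightarrow> bool" where
  "indep33 c \<longleftrightarrow> pair_poly c \<and> (\<forall>P Q z. c (P + mscale z unit33) Q = c P Q)"

text \<open>At a generic pair with \<open>c\<close> nonzero, \<open>c\<close> as a function of a
  shift \<open>w\<close> of \<open>Q $ 3 $ 3\<close> has finitely many zeros. Yet it vanishes at
  every \<open>\<omega> t\<close>, because a shift of \<open>P $ 3 $ 3\<close>, which
  \<open>c\<close> does not notice, then creates a double root at \<open>t\<close>.\<close>

lemma indep33_vanishing:
  fixes c :: "'k::{alg_closed_field, field_char_0} mat4 \<Rightarrow> 'k mat4 \<Rightarrow> 'k"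
  assumes c: "indep33 c"
    and van: "\<And>P Q. chart P Q \<Longrightarrow> mat4.span {P, Q} \<in> zariski closure_of O_node \<Longrightarrow> c P Q = 0"
  shows "\<not> nonzero_on_chart c"
proof
  assume nz: "nonzero_on_chart c"
  have cp: "pair_poly c" and ci: "\<And>P Q z. c (P + mscale z unit33) Q = c P Q"
    using c by (auto simp: indep33_def)
  have "nonzero_on_chart (nonconstancy :: 'k mat4 \<Rightarrow> 'k mat4 \<Rightarrow> 'k)"
    using chart_ref nonconstancy_ref unfolding nonzero_on_chart_def by blast
  then have "nonzero_on_chart (\<lambda>P Q. c P Q * nonconstancy P Q)"
    by (rule nonzero_on_chart_mult[OF cp pair_poly_nonconstancy nz])
  then obtain P Q where PQ: "chart P Q" "c P Q \<noteq> 0" "nonconstancy P Q \<noteq> 0"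
    by (auto simp: nonzero_on_chart_def)
  define f b N where fbN: "f = pencil_poly P Q" "b = minor_poly P Q" "N = wronskian P Q"
  define \<gamma> where "\<gamma> w = c P (Q + mscale w unit33)" for w
  \<comment> \<open>Minus the derivative of \<open>f / b\<close>: the shift of \<open>Q\<close>
    required by a double root at \<open>t\<close>.\<close>
  define \<omega> where "\<omega> t = - poly N t / (poly b t)\<^sup>2" for t
  have "poly_fun \<gamma>"
    unfolding \<gamma>_def[abs_def] by (rule poly_fun_pair_poly[OF cp]) simp_all
  moreover have "\<gamma> 0 \<noteq> 0" using PQ(2) by (simp add: \<gamma>_def)
  ultimately have fin: "finite {w. \<gamma> w = 0}" by (rule poly_fun_finite_zeros)
  have g0: "\<gamma> (\<omega> t) = 0" if bt: "poly b t \<noteq> 0" for t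
  proof -
    define w z where wz: "w = \<omega> t" "z = - poly f t / poly b t - t * w"
    define P' Q' where PQ': "P' = P + mscale z unit33" "Q' = Q + mscale w unit33"
    have ch: "chart P' Q'" using PQ(1) by (auto simp: chart_def Sym2_iff PQ' unit33_nth)
    have sh: "pencil_poly P' Q' = f + [:z, w:] * b" unfolding PQ' fbN by (rule pencil_poly_shift)
    have zw: "(z + t * w) * poly b t = - poly f t" using bt by (simp add: wz)
    have w2: "w * (poly b t * poly b t) = - (poly (pderiv f) t * poly b t - poly f t * poly (pderiv b) t)"
      using bt by (simp add: wz \<omega>_def power2_eq_square fbN wronskian_def)
    have "poly (pencil_poly P' Q') t = 0" using zw by (simp add: sh algebra_simps)
    moreover have "poly (pderiv (pencil_poly P' Q')) t * poly b t = 0"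
      unfolding sh pderiv_add pderiv_mult using zw w2 by (simp add: pderiv_pCons) algebra
    then have "poly (pderiv (pencil_poly P' Q')) t = 0" using bt by simp
    ultimately have "c P' Q' = 0"
      using double_root_in_closure[OF chart_Gr[OF ch]] van[OF ch] by blast
    then show ?thesis by (simp add: PQ' ci \<gamma>_def wz(1))
  qed
  have "b \<noteq> 0" using PQ(3) by (auto simp: nonconstancy_def fbN)
  then have "finite {t. poly b t = 0}" by (rule poly_roots_finite)
  then have inf: "infinite {t. poly b t \<noteq> 0}"
    using infinite_UNIV_char_0[where 'a = 'k] finite_Collect_not by blast
  \<comment> \<open>With finitely many values, one value \<open>k\<close> is taken infinitely often.
    Then \<open>N + k b^2\<close> is the zero polynomial, which makes \<open>nonconstancy\<close>
    vanish.\<close>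
  moreover have "finite (\<omega> ` {t. poly b t \<noteq> 0})"
    using g0 by (intro finite_subset[OF _ fin]) auto
  ultimately obtain t0 where t0: "infinite {t \<in> {t. poly b t \<noteq> 0}. \<omega> t = \<omega> t0}"
    using pigeonhole_infinite by blast
  define k where "k = \<omega> t0"
  have "{t \<in> {t. poly b t \<noteq> 0}. \<omega> t = k} \<subseteq> {t. poly (N + smult k (b\<^sup>2)) t = 0}"
    by (auto simp: \<omega>_def field_simps)
  then have "infinite {t. poly (N + smult k (b\<^sup>2)) t = 0}"
    using t0 finite_subset unfolding k_def by blast
  then have "N + smult k (b\<^sup>2) = 0" using poly_roots_finite by blast
  then have "N = - smult k (b\<^sup>2)" by (simp add: eq_neg_iff_add_eq_0)
  then have "nonconstancy P Q = 0"
    unfolding nonconstancy_def by (simp flip: fbN)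
  then show False using PQ(3) by simp
qed

section \<open>Maximality of the closure of the nodal orbit\<close>

text \<open>Degree in \<open>z = P $ 3 $ 3\<close> over A. The family \<open>F\<close> represents
  \<open>f\<close> on chart pairs only, and its coefficient of degree \<open>n\<close> may
  vanish.\<close>

definition z_degree_le :: "nat \<Rightarrow> ('k::field mat4 \<Rightarrow> 'k mat4 \<Rightarrow> 'k) \<Rightarrow> bool" where
  "z_degree_le n f \<longleftrightarrow> (\<exists>F. (\<forall>i. indep33 (\<lambda>P Q. coeff (F P Q) i)) \<and> (\<forall>P Q. degree (F P Q) \<le> n) \<and>
     (\<forall>P Q. chart P Q \<longrightarrow> f P Q = poly (F P Q) (P $ 3 $ 3)))"

lemma indep33_const [simp]: "indep33 (\<lambda>P Q. c)"
  by (simp add: indep33_def)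

lemma indep33_add [simp]: "indep33 f \<Longrightarrow> indep33 g \<Longrightarrow> indep33 (\<lambda>P Q. f P Q + g P Q)"
  and indep33_diff [simp]: "indep33 f \<Longrightarrow> indep33 g \<Longrightarrow> indep33 (\<lambda>P Q. f P Q - g P Q)"
  and indep33_mult [simp]: "indep33 f \<Longrightarrow> indep33 g \<Longrightarrow> indep33 (\<lambda>P Q. f P Q * g P Q)"
  by (simp_all add: indep33_def)

lemma indep33_sum: "(\<And>i. i \<in> S \<Longrightarrow> indep33 (f i)) \<Longrightarrow> indep33 (\<lambda>P Q. \<Sum>i\<in>S. f i P Q)"
  by (induction S rule: infinite_finite_induct) simp_all

lemma pair_poly_z_degree:
  assumes "pair_poly f" shows "\<exists>n. z_degree_le n f"
  using assms
proof induction
  case (const c)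
  have "z_degree_le 0 (\<lambda>P Q. c)"
    unfolding z_degree_le_def by (intro exI[of _ "\<lambda>P Q. [:c:]"]) (auto simp: coeff_pCons split: nat.split)
  then show ?case ..
next
  case (fst i j)
  show ?case
  proof (cases "i = 3 \<and> j = 3")
    case True
    have "z_degree_le 1 (\<lambda>(P :: 'a mat4) Q. P $ i $ j)"
      unfolding z_degree_le_def using True
      by (intro exI[of _ "\<lambda>P Q. [:0, 1:]"]) (auto simp: coeff_pCons split: nat.split)
    then show ?thesis ..
  next
    case False
    then have "indep33 (\<lambda>(P :: 'a mat4) Q. P $ i $ j)" by (auto simp: indep33_def unit33_nth)
    then have "indep33 (\<lambda>(P :: 'a mat4) Q. coeff [:P $ i $ j:] k)" for k by (cases k) simp_all
    then have "z_degree_le 0 (\<lambda>(P :: 'a mat4) Q. P $ i $ j)"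
      unfolding z_degree_le_def by (intro exI[of _ "\<lambda>P Q. [:P $ i $ j:]"]) simp
    then show ?thesis ..
  qed
next
  case (snd i j)
  have "indep33 (\<lambda>P (Q :: 'a mat4). Q $ i $ j)" by (simp add: indep33_def)
  then have "indep33 (\<lambda>P (Q :: 'a mat4). coeff [:Q $ i $ j:] k)" for k by (cases k) simp_all
  then have "z_degree_le 0 (\<lambda>P (Q :: 'a mat4). Q $ i $ j)"
    unfolding z_degree_le_def by (intro exI[of _ "\<lambda>P Q. [:Q $ i $ j:]"]) simp
  then show ?case ..
next
  case (add f g)
  then obtain m n F G where F: "\<And>i. indep33 (\<lambda>P Q. coeff (F P Q) i)" "\<And>P Q. degree (F P Q) \<le> m"
      "\<And>P Q. chart P Q \<Longrightarrow> f P Q = poly (F P Q) (P $ 3 $ 3)"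
    and G: "\<And>i. indep33 (\<lambda>P Q. coeff (G P Q) i)" "\<And>P Q. degree (G P Q) \<le> n"
      "\<And>P Q. chart P Q \<Longrightarrow> g P Q = poly (G P Q) (P $ 3 $ 3)"
    unfolding z_degree_le_def by metis
  have "degree (F P Q + G P Q) \<le> max m n" for P Q
    using degree_add_le_max[of "F P Q" "G P Q"] F(2)[of P Q] G(2)[of P Q] by linarith
  then have "z_degree_le (max m n) (\<lambda>P Q. f P Q + g P Q)"
    unfolding z_degree_le_def using F G by (intro exI[of _ "\<lambda>P Q. F P Q + G P Q"]) simp
  then show ?case ..
next
  case (mult f g)
  then obtain m n F G where F: "\<And>i. indep33 (\<lambda>P Q. coeff (F P Q) i)" "\<And>P Q. degree (F P Q) \<le> m"
      "\<And>P Q. chart P Q \<Longrightarrow> f P Q = poly (F P Q) (P $ 3 $ 3)"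
    and G: "\<And>i. indep33 (\<lambda>P Q. coeff (G P Q) i)" "\<And>P Q. degree (G P Q) \<le> n"
      "\<And>P Q. chart P Q \<Longrightarrow> g P Q = poly (G P Q) (P $ 3 $ 3)"
    unfolding z_degree_le_def by metis
  have "degree (F P Q * G P Q) \<le> m + n" for P Q
    using degree_mult_le[of "F P Q" "G P Q"] F(2)[of P Q] G(2)[of P Q] by linarith
  moreover have "indep33 (\<lambda>P Q. coeff (F P Q * G P Q) i)" for i
    unfolding coeff_mult by (intro indep33_sum indep33_mult F G)
  ultimately have "z_degree_le (m + n) (\<lambda>P Q. f P Q * g P Q)"
    unfolding z_degree_le_def using F G by (intro exI[of _ "\<lambda>P Q. F P Q * G P Q"]) simp
  then show ?case ..
qed

text \<open>Division in \<open>Frac(A)[z]\<close> with the denominators cleared, for \<open>z = P $ 3 $ 3\<close>; \<open>c\<close> is the denominator.\<close>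

lemma pseudo_division:
  fixes f h :: "'k::field_char_0 mat4 \<Rightarrow> 'k mat4 \<Rightarrow> 'k"
  assumes K_mult: "\<And>f g. pair_poly g \<Longrightarrow> K f \<Longrightarrow> K (\<lambda>P Q. g P Q * f P Q)"
    and K_diff: "\<And>f g. K f \<Longrightarrow> K g \<Longrightarrow> K (\<lambda>P Q. f P Q - g P Q)"
    and h: "pair_poly h" "K h" "nonzero_on_chart h" "z_degree_le m h" "m > 0"
    and least: "\<And>f n. pair_poly f \<Longrightarrow> K f \<Longrightarrow> nonzero_on_chart f \<Longrightarrow> z_degree_le n f \<Longrightarrow> m \<le> n"
    and f: "pair_poly f" "K f" "z_degree_le n f"
  shows "\<exists>c q. indep33 c \<and> nonzero_on_chart c \<and> pair_poly q \<and> z_degree_le (n - m) q \<and>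
    (\<forall>P Q. chart P Q \<longrightarrow> c P Q * f P Q = q P Q * h P Q)"
  using f
proof (induction n arbitrary: f rule: less_induct)
  case (less n f)
  have one: "nonzero_on_chart (\<lambda>P Q :: 'k mat4. 1 :: 'k)"
    using chart_ref[where 'a = 'k] by (auto simp: nonzero_on_chart_def)
  show ?case
  proof (cases "n < m")
    case True
    \<comment> \<open>Below the least degree only zero remains, with quotient zero.\<close>
    then have z: "\<not> nonzero_on_chart f" using least[OF less.prems(1,2) _ less.prems(3)] by auto
    have "z_degree_le (n - m) (\<lambda>P Q :: 'k mat4. 0 :: 'k)"
      unfolding z_degree_le_def by (intro exI[of _ "\<lambda>P Q. 0"]) simp
    then show ?thesis
      using z one by (intro exI[of _ "\<lambda>P Q. 1"] exI[of _ "\<lambda>P Q. 0"]) (auto simp: nonzero_on_chart_def)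
  next
    case False
    then have mn: "m \<le> n" "n > 0" using h(5) by auto
    obtain F where F: "\<And>i. indep33 (\<lambda>P Q. coeff (F P Q) i)" "\<And>P Q. degree (F P Q) \<le> n"
      "\<And>P Q. chart P Q \<Longrightarrow> f P Q = poly (F P Q) (P $ 3 $ 3)"
      using less.prems(3) unfolding z_degree_le_def by metis
    obtain H where H: "\<And>i. indep33 (\<lambda>P Q. coeff (H P Q) i)" "\<And>P Q. degree (H P Q) \<le> m"
      "\<And>P Q. chart P Q \<Longrightarrow> h P Q = poly (H P Q) (P $ 3 $ 3)"
      using h(4) unfolding z_degree_le_def by metis
    define a where "a P Q = coeff (F P Q) n" for P Q
    define b where "b P Q = coeff (H P Q) m" for P Q
    have a: "indep33 a" and b: "indep33 b"
      unfolding a_def[abs_def] b_def[abs_def] using F(1) H(1) by simp_all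
    then have pab: "pair_poly a" "pair_poly b" by (simp_all add: indep33_def)
    have deg_pred: "degree p \<le> k - 1" if "degree p \<le> k" "coeff p k = 0" for p :: "'k poly" and k
      using that by (metis One_nat_def Suc_pred coeff_0 diff_le_self eq_zero_or_degree_less le_trans less_Suc_eq_le degree_0 neq0_conv zero_le)
    \<comment> \<open>Otherwise the leading term of \<open>h\<close> could be dropped, against the
      minimality of \<open>m\<close>.\<close>
    have b_nz: "nonzero_on_chart b"
    proof (rule ccontr)
      assume "\<not> nonzero_on_chart b"
      then have b0: "b P Q = 0" if "chart P Q" for P Q using that by (auto simp: nonzero_on_chart_def)
      define H' where "H' P Q = H P Q - monom (b P Q) m" for P Q
      have "indep33 (\<lambda>P Q. coeff (H' P Q) i)" for i
        using H(1) b by (cases "i = m") (simp_all add: H'_def coeff_diff)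
      moreover have "degree (H' P Q) \<le> m - 1" for P Q
      proof (rule deg_pred)
        show "degree (H' P Q) \<le> m"
          unfolding H'_def using H(2) by (intro degree_diff_le) (auto intro: degree_monom_le)
      qed (simp add: H'_def b_def)
      moreover have "h P Q = poly (H' P Q) (P $ 3 $ 3)" if "chart P Q" for P Q
        using that H(3) b0 by (simp add: H'_def)
      ultimately have "z_degree_le (m - 1) h" unfolding z_degree_le_def by blast
      then have "m \<le> m - 1" using least h(1-3) by blast
      then show False using h(5) by simp
    qed
    \<comment> \<open>Cancellation of leading terms, multiplying by \<open>b\<close> instead of
      dividing by it.\<close>
    define f' where "f' P Q = b P Q * f P Q - (a P Q * P $ 3 $ 3 ^ (n - m)) * h P Q" for P Q
    have pf': "pair_poly f'"
      unfolding f'_def[abs_def] using pab less.prems(1) h(1) by auto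
    have Kf': "K f'"
      unfolding f'_def[abs_def] using pab by (intro K_diff K_mult less.prems(2) h(2)) auto
    define F' where "F' P Q = smult (b P Q) (F P Q) - monom (a P Q) (n - m) * H P Q" for P Q
    have "indep33 (\<lambda>P Q. coeff (F' P Q) i)" for i
    proof (cases "i < n - m")
      case True
      then show ?thesis using F(1) b by (simp add: F'_def coeff_monom_mult)
    next
      case False
      then show ?thesis using F(1) H(1) a b by (simp add: F'_def coeff_monom_mult)
    qed
    moreover have "degree (F' P Q) \<le> n - 1" for P Q
    proof (rule deg_pred)
      have "degree (monom (a P Q) (n - m) * H P Q) \<le> n"
        using degree_mult_le[of "monom (a P Q) (n - m)" "H P Q"] degree_monom_le[of "a P Q" "n - m"] H(2)[of P Q] mn
        by linarith
      then show "degree (F' P Q) \<le> n"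
        unfolding F'_def using F(2)[of P Q] degree_smult_le[of "b P Q" "F P Q"]
        by (intro degree_diff_le) simp_all
      show "coeff (F' P Q) n = 0" using mn by (simp add: F'_def coeff_monom_mult a_def b_def)
    qed
    moreover have "f' P Q = poly (F' P Q) (P $ 3 $ 3)" if "chart P Q" for P Q
      using F(3)[OF that] H(3)[OF that] by (simp add: f'_def F'_def poly_monom)
    ultimately have zf': "z_degree_le (n - 1) f'" unfolding z_degree_le_def by blast
    obtain c q where c: "indep33 c" "nonzero_on_chart c" "pair_poly q" "z_degree_le (n - 1 - m) q"
      "\<And>P Q. chart P Q \<Longrightarrow> c P Q * f' P Q = q P Q * h P Q"
      using less.IH[OF _ pf' Kf' zf'] mn(2) by auto
    have pc: "pair_poly c" using c(1) by (simp add: indep33_def)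
    obtain G where G: "\<And>i. indep33 (\<lambda>P Q. coeff (G P Q) i)" "\<And>P Q. degree (G P Q) \<le> n - 1 - m"
      "\<And>P Q. chart P Q \<Longrightarrow> q P Q = poly (G P Q) (P $ 3 $ 3)"
      using c(4) unfolding z_degree_le_def by metis
    define q' where "q' P Q = q P Q + c P Q * a P Q * P $ 3 $ 3 ^ (n - m)" for P Q
    have "z_degree_le (n - m) q'"
      unfolding z_degree_le_def
    proof (intro exI conjI allI impI)
      fix i
      show "indep33 (\<lambda>P Q. coeff (G P Q + monom (c P Q * a P Q) (n - m)) i)"
        using G(1) c(1) a by (cases "i = n - m") simp_all
    next
      fix P Q
      \<comment> \<open>For \<open>n = m\<close> truncated subtraction gives
        \<open>n - 1 - m = 0\<close>, which is still at most \<open>n - m\<close>.\<close>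
      show "degree (G P Q + monom (c P Q * a P Q) (n - m)) \<le> n - m"
        using G(2)[of P Q] by (intro degree_add_le degree_monom_le) linarith
    qed (use G(3) in \<open>simp add: q'_def poly_monom\<close>)
    moreover have "pair_poly q'" unfolding q'_def[abs_def] using c(3) pc pab by auto
    moreover have "nonzero_on_chart (\<lambda>P Q. c P Q * b P Q)"
      by (rule nonzero_on_chart_mult[OF pc pab(2) c(2) b_nz])
    moreover have "c P Q * b P Q * f P Q = q' P Q * h P Q" if "chart P Q" for P Q
      using c(5)[OF that] by (simp add: f'_def q'_def algebra_simps)
    ultimately show ?thesis using c(1) b by (intro exI[of _ "\<lambda>P Q. c P Q * b P Q"] exI[of _ q']) simp
  qed
qed

text \<open>The chart is dense: on the line towards the reference pair, neither the given form nor
  the coordinate at \<open>((0, 0), (1, 1))\<close> vanishes identically.\<close>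

lemma exists_chart_nonzero:
  fixes P Q :: "'k::field_char_0 mat4"
  assumes "P \<in> Sym2" "Q \<in> Sym2" "mv_homogeneous d G" "mv_eval G (pluecker P Q) \<noteq> 0"
  obtains P' Q' where "chart P' Q'" "mv_eval G (pluecker P' Q') \<noteq> 0"
proof -
  define A where "A = line P (ref_P :: 'k mat4)"
  define B where "B = line Q (ref_Q :: 'k mat4)"
  have AB: "poly_fun (\<lambda>u. A u $ i $ j)" "poly_fun (\<lambda>u. B u $ i $ j)" for i j
    unfolding A_def B_def by (rule poly_fun_line)+
  have p: "poly_fun (\<lambda>u. mv_eval G (pluecker (A u) (B u)))" by (rule poly_fun_mv_eval[OF AB])
  have q: "poly_fun (\<lambda>u. pluecker (A u) (B u) ((0, 0), (1, 1)))"
    unfolding pluecker_def split_beta by (intro poly_fun_diff poly_fun_mult AB)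
  have "pluecker (A 1) (B 1) ((0, 0), (1, 1)) \<noteq> 0"
    using chart_pluecker(1)[OF chart_ref[where 'a = 'k], of 0 0] chart_ref[where 'a = 'k] by (simp add: A_def B_def chart_def)
  moreover have "mv_eval G (pluecker (A 0) (B 0)) \<noteq> 0" using assms(4) by (simp add: A_def B_def)
  ultimately obtain u where u: "mv_eval G (pluecker (A u) (B u)) \<noteq> 0" "pluecker (A u) (B u) ((0, 0), (1, 1)) \<noteq> 0"
    using exists_common_nonzero[OF p q] by blast
  have "(ref_P :: 'k mat4) \<in> Sym2" "(ref_Q :: 'k mat4) \<in> Sym2" using chart_ref[where 'a = 'k] by (simp_all add: chart_def)
  then have "mat4.span {A u, B u} \<in> Gr"
    unfolding span_in_Gr_iff A_def B_def using assms(1,2) u(2) line_Sym2 A_def B_def by metis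
  then obtain P' Q' where PQ': "chart P' Q'" "mat4.span {P', Q'} = mat4.span {A u, B u}"
    using chart_basis_exists u(2) by blast
  then show thesis using that zero_locus_basis[OF assms(3) PQ'(2)] u(1) by blast
qed

lemma closure_O_node_maximal:
  fixes Y :: "'k::{alg_closed_field, field_char_0} mat4 set set"
  assumes Y: "irreducible_closed zariski Y" and TY: "zariski closure_of O_node \<subset> Y"
  shows "Y = Gr"
proof (rule ccontr)
  define T :: "'k mat4 set set" where "T = zariski closure_of O_node"
  assume "Y \<noteq> Gr"
  have Y_closed: "closedin zariski Y" and Y_irr: "\<And>A B. closedin zariski A \<Longrightarrow> closedin zariski B \<Longrightarrow>
      Y \<subseteq> A \<union> B \<Longrightarrow> Y \<subseteq> A \<or> Y \<subseteq> B" and YGr: "Y \<subseteq> Gr"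
    using Y by (auto simp: irreducible_closed_def irreducible_in_def topspace_zariski)
  have T_closed: "closedin zariski T" unfolding T_def by (rule closedin_closure_of)
  define K where "K f \<longleftrightarrow> (\<forall>P Q. chart P Q \<longrightarrow> mat4.span {P, Q} \<in> T \<longrightarrow> f P Q = 0)" for f :: "'k mat4 \<Rightarrow> 'k mat4 \<Rightarrow> 'k"
  define J where "J f \<longleftrightarrow> (\<forall>P Q. chart P Q \<longrightarrow> mat4.span {P, Q} \<in> Y \<longrightarrow> f P Q = 0)" for f :: "'k mat4 \<Rightarrow> 'k mat4 \<Rightarrow> 'k"
  have JK: "K f" if "J f" for f using that TY by (auto simp: J_def K_def T_def)
  have K_indep: "\<not> nonzero_on_chart c" if "indep33 c" "K c" for c
    using indep33_vanishing[OF that(1)] that(2) by (auto simp: K_def T_def)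
  \<comment> \<open>Primality is the irreducibility of \<open>Y\<close>. The closed set
    \<open>A\<close> contains everything outside the chart, so the zeros on the chart decide whether
    \<open>A\<close> and \<open>B\<close> cover \<open>Y\<close>.\<close>
  have J_prime: "J f \<or> J g" if fg: "pair_poly f" "pair_poly g" "J (\<lambda>P Q. f P Q * g P Q)" for f g
  proof -
    obtain A where A: "closedin zariski A" "\<And>P Q. chart P Q \<Longrightarrow> mat4.span {P, Q} \<in> A \<longleftrightarrow> f P Q = 0"
      "\<And>W. W \<in> Gr \<Longrightarrow> W \<notin> A \<Longrightarrow> \<exists>P Q. chart P Q \<and> W = mat4.span {P, Q}"
      by (rule chart_closed_set[OF fg(1)]) blast
    obtain B where B: "closedin zariski B" "\<And>P Q. chart P Q \<Longrightarrow> mat4.span {P, Q} \<in> B \<longleftrightarrow> g P Q = 0"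
      by (rule chart_closed_set[OF fg(2)]) blast
    have "Y \<subseteq> A \<union> B"
    proof
      fix W assume "W \<in> Y"
      show "W \<in> A \<union> B"
      proof (cases "W \<in> A")
        case False
        then obtain P Q where "chart P Q" "W = mat4.span {P, Q}" using A(3) YGr \<open>W \<in> Y\<close> by blast
        then show ?thesis using A(2) B(2) fg(3) \<open>W \<in> Y\<close> by (auto simp: J_def)
      qed simp
    qed
    then have "Y \<subseteq> A \<or> Y \<subseteq> B" by (rule Y_irr[OF A(1) B(1)])
    then show ?thesis using A(2) B(2) by (auto simp: J_def)
  qed
  have "\<exists>f. pair_poly f \<and> J f \<and> nonzero_on_chart f"
  proof -
    obtain W where W: "W \<in> Gr" "W \<notin> Y" using \<open>Y \<noteq> Gr\<close> YGr by blast
    obtain P Q where PQ: "W = mat4.span {P, Q}" using Gr_span[OF W(1)] by blast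
    obtain d G where G: "mv_homogeneous d G" "mv_eval G (pluecker P Q) \<noteq> 0" "Y \<subseteq> zero_locus {G}"
      by (rule closedin_zero_locus[OF Y_closed W PQ]) blast
    have "P \<in> Sym2" "Q \<in> Sym2" using W(1) unfolding PQ span_in_Gr_iff by simp_all
    then obtain P' Q' where "chart P' Q'" "mv_eval G (pluecker P' Q') \<noteq> 0"
      using exists_chart_nonzero G(1,2) by blast
    then have "nonzero_on_chart (\<lambda>P Q. mv_eval G (pluecker P Q))" by (auto simp: nonzero_on_chart_def)
    moreover have "J (\<lambda>P Q. mv_eval G (pluecker P Q))" using G(3) by (auto simp: J_def zero_locus_def)
    ultimately show ?thesis using pair_poly_mv_eval by blast
  qed
  then obtain n where n: "\<exists>f. pair_poly f \<and> J f \<and> nonzero_on_chart f \<and> z_degree_le n f"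
    using pair_poly_z_degree by blast
  define n0 where "n0 = (LEAST n. \<exists>f. pair_poly f \<and> J f \<and> nonzero_on_chart f \<and> z_degree_le n f)"
  obtain f where f: "pair_poly f" "J f" "nonzero_on_chart f" "z_degree_le n0 f"
    using LeastI[of "\<lambda>n. \<exists>f. pair_poly f \<and> J f \<and> nonzero_on_chart f \<and> z_degree_le n f", OF n]
    unfolding n0_def by blast
  have n0: "n0 \<le> k" if "pair_poly g" "J g" "nonzero_on_chart g" "z_degree_le k g" for g k
    unfolding n0_def using that by (intro Least_le) blast
  define m where "m = (LEAST n. \<exists>f. pair_poly f \<and> K f \<and> nonzero_on_chart f \<and> z_degree_le n f)"
  have n': "\<exists>f. pair_poly f \<and> K f \<and> nonzero_on_chart f \<and> z_degree_le n0 f" using f JK by blast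
  obtain h where h: "pair_poly h" "K h" "nonzero_on_chart h" "z_degree_le m h"
    using LeastI[of "\<lambda>n. \<exists>f. pair_poly f \<and> K f \<and> nonzero_on_chart f \<and> z_degree_le n f", OF n']
    unfolding m_def by blast
  have m: "m \<le> k" if "pair_poly g" "K g" "nonzero_on_chart g" "z_degree_le k g" for g k
    unfolding m_def using that by (intro Least_le) blast
  \<comment> \<open>A nonzero element of \<open>K\<close> of degree 0 would lie in A.\<close>
  have "m > 0"
  proof (rule ccontr)
    assume "\<not> m > 0"
    then obtain F where F: "\<And>i. indep33 (\<lambda>P Q. coeff (F P Q) i)" "\<And>P Q. degree (F P Q) \<le> 0"
      "\<And>P Q. chart P Q \<Longrightarrow> h P Q = poly (F P Q) (P $ 3 $ 3)"
      using h(4) unfolding z_degree_le_def by auto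
    have eq: "h P Q = coeff (F P Q) 0" if "chart P Q" for P Q
      using F(3)[OF that] poly_altdef_le[OF F(2)[of P Q]] by simp
    have "K (\<lambda>P Q. coeff (F P Q) 0)" using h(2) eq by (simp add: K_def)
    moreover have "nonzero_on_chart (\<lambda>P Q. coeff (F P Q) 0)"
      using h(3) eq unfolding nonzero_on_chart_def by metis
    ultimately show False using K_indep[OF F(1)] by blast
  qed
  have division: "\<exists>c q. indep33 c \<and> nonzero_on_chart c \<and> pair_poly q \<and> z_degree_le (k - m) q \<and>
      (\<forall>P Q. chart P Q \<longrightarrow> c P Q * g P Q = q P Q * h P Q)"
    if "pair_poly g" "K g" "z_degree_le k g" for g k
    by (rule pseudo_division[where K = K, OF _ _ h \<open>m > 0\<close> m that]) (simp_all add: K_def)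
  obtain c q where c: "indep33 c" "nonzero_on_chart c" "pair_poly q" "z_degree_le (n0 - m) q"
    "\<And>P Q. chart P Q \<Longrightarrow> c P Q * f P Q = q P Q * h P Q"
    using division[OF f(1) JK[OF f(2)] f(4)] by blast
  have "J (\<lambda>P Q. q P Q * h P Q)" using f(2) by (simp add: J_def flip: c(5))
  then have "J q \<or> J h" by (rule J_prime[OF c(3) h(1)])
  \<comment> \<open>The quotient \<open>q\<close> is nonzero of degree at most
    \<open>n0 - m\<close>, which is less than the least degree \<open>n0\<close> in
    \<open>J\<close>.\<close>
  moreover have "\<not> J q"
  proof
    assume "J q"
    have "nonzero_on_chart (\<lambda>P Q. c P Q * f P Q)"
      using c(1) by (intro nonzero_on_chart_mult f(1,3) c(2)) (simp add: indep33_def)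
    then have "nonzero_on_chart q" using c(5) unfolding nonzero_on_chart_def by force
    then have "n0 \<le> n0 - m" using n0 c(3,4) \<open>J q\<close> by blast
    moreover have "m \<le> n0" using m f JK by blast
    ultimately show False using \<open>m > 0\<close> by linarith
  qed
  ultimately have Jh: "J h" by blast
  \<comment> \<open>The product \<open>c g = q h\<close> lies in the prime \<open>J\<close>, while
    \<open>c\<close>, being nonzero in A, is not even in \<open>K\<close>.\<close>
  have KJ: "J g" if g: "pair_poly g" "K g" for g
  proof -
    obtain k where "z_degree_le k g" using pair_poly_z_degree[OF g(1)] by blast
    then obtain c q where c: "indep33 c" "nonzero_on_chart c" "pair_poly q"
      "\<And>P Q. chart P Q \<Longrightarrow> c P Q * g P Q = q P Q * h P Q"
      using division[OF g] by blast
    have "J (\<lambda>P Q. c P Q * g P Q)" using Jh c(4) by (auto simp: J_def)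
    then have "J c \<or> J g" using c(1) by (intro J_prime g(1)) (simp_all add: indep33_def)
    then show "J g" using K_indep[OF c(1)] c(2) JK by blast
  qed
  \<comment> \<open>\<open>Z\<close> is the complement of the chart. Equality of the ideals gives
    \<open>Y \<subseteq> T\<close> only up to \<open>Z\<close>, which irreducibility removes because
    \<open>T\<close> meets the chart.\<close>
  obtain Z :: "'k mat4 set set" where Z: "closedin zariski Z" "\<And>P Q. chart P Q \<Longrightarrow> mat4.span {P, Q} \<in> Z \<longleftrightarrow> (1 :: 'k) = 0"
      "\<And>W. W \<in> Gr \<Longrightarrow> W \<notin> Z \<Longrightarrow> \<exists>P Q. chart P Q \<and> W = mat4.span {P, Q}"
    by (rule chart_closed_set[OF pair_poly.const[of 1]]) blast
  have "Y \<subseteq> T \<union> Z"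
  proof (rule subsetI, rule ccontr)
    fix W assume W: "W \<in> Y" "W \<notin> T \<union> Z"
    then have WG: "W \<in> Gr" using YGr by blast
    then obtain P Q where PQ: "chart P Q" "W = mat4.span {P, Q}" using Z(3) W by blast
    obtain d G where G: "mv_homogeneous d G" "mv_eval G (pluecker P Q) \<noteq> 0" "T \<subseteq> zero_locus {G}"
      by (rule closedin_zero_locus[OF T_closed WG _ PQ(2)]) (use W in auto)
    have "K (\<lambda>P Q. mv_eval G (pluecker P Q))" using G(3) by (auto simp: K_def zero_locus_def)
    then have "J (\<lambda>P Q. mv_eval G (pluecker P Q))" by (rule KJ[OF pair_poly_mv_eval])
    then show False using PQ W(1) G(2) by (auto simp: J_def)
  qed
  then have "Y \<subseteq> T \<or> Y \<subseteq> Z" by (rule Y_irr[OF T_closed Z(1)])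
  moreover have "\<not> Y \<subseteq> Z"
  proof
    assume "Y \<subseteq> Z"
    then have "K (\<lambda>P Q. 1)" using Z(2) TY by (auto simp: K_def T_def)
    then have "\<not> nonzero_on_chart (\<lambda>P Q :: 'k mat4. 1 :: 'k)" by (intro K_indep) simp_all
    then show False using chart_ref[where 'a = 'k] by (auto simp: nonzero_on_chart_def)
  qed
  ultimately show False using TY by (auto simp: T_def)
qed

section \<open>Irreducibility, properness and codimension of the closure\<close>

lemma irreducible_O_node: "irreducible_in zariski (O_node :: 'k::field_char_0 mat4 set set)"
proof (rule irreducible_by_curves)
  show "O_node \<subseteq> (Gr :: 'k mat4 set set)" by (rule O_node_subset_Gr)
  show "O_node \<noteq> ({} :: 'k mat4 set set)" using W_node_in_O_node by blast
  fix W W' :: "'k mat4 set" assume "W \<in> O_node" "W' \<in> O_node"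
  then obtain g g' where g: "invertible g" "W = act g W_node" "invertible g'" "W' = act g' W_node"
    by (auto simp: O_node_def)
  \<comment> \<open>The orbit is parametrized by invertible matrices, and the line joining
    \<open>g\<close> and \<open>g'\<close> leaves them only at zeros of the determinant.\<close>
  define A B where "A u = subst (line g g' u) node_Q0" and "B u = subst (line g g' u) node_Q1" for u
  have "poly_fun (\<lambda>u. A u $ i $ j)" "poly_fun (\<lambda>u. B u $ i $ j)" for i j
    unfolding A_def B_def by (rule poly_fun_subst; simp add: poly_fun_line)+
  moreover have "poly_fun (\<lambda>u. det (line g g' u))" by (intro poly_fun_det poly_fun_line)
  moreover have "det (line g g' 0) \<noteq> 0" using g(1) by (simp add: invertible_det_nz)
  moreover have AB: "mat4.span {A u, B u} = act (line g g' u) W_node" for u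
    by (simp add: A_def B_def W_node_def act_span)
  then have "W = mat4.span {A 0, B 0}" "W' = mat4.span {A 1, B 1}" using g by simp_all
  moreover have "mat4.span {A u, B u} \<in> O_node" if "det (line g g' u) \<noteq> 0" for u
    using that unfolding AB O_node_def by (auto simp: invertible_det_nz)
  ultimately show "\<exists>A B \<phi> u0 u1. (\<forall>i j. poly_fun (\<lambda>u. A u $ i $ j)) \<and> (\<forall>i j. poly_fun (\<lambda>u. B u $ i $ j)) \<and>
      poly_fun \<phi> \<and> \<phi> u0 \<noteq> 0 \<and> W = mat4.span {A u0, B u0} \<and> W' = mat4.span {A u1, B u1} \<and>
      (\<forall>u. \<phi> u \<noteq> 0 \<longrightarrow> mat4.span {A u, B u} \<in> O_node)"
    by blast
qed

lemma irreducible_closed_Gr: "irreducible_closed zariski (Gr :: 'k::field_char_0 mat4 set set)"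
proof -
  have "irreducible_in zariski (Gr :: 'k mat4 set set)"
  proof (rule irreducible_by_curves)
    show "Gr \<noteq> ({} :: 'k mat4 set set)" using chart_Gr[OF chart_ref[where 'a = 'k]] by blast
    fix W W' :: "'k mat4 set" assume W: "W \<in> Gr" "W' \<in> Gr"
    obtain P Q P' Q' where PQ: "W = mat4.span {P, Q}" "W' = mat4.span {P', Q'}"
      using Gr_span W by metis
    have sym: "P \<in> Sym2" "Q \<in> Sym2" "P' \<in> Sym2" "Q' \<in> Sym2" and "\<exists>x. pluecker P Q x \<noteq> 0"
      using W by (simp_all add: PQ span_in_Gr_iff)
    then obtain x where x: "pluecker P Q x \<noteq> 0" by blast
    define A B where "A u = line P P' u" and "B u = line Q Q' u" for u
    have AB: "poly_fun (\<lambda>u. A u $ i $ j)" "poly_fun (\<lambda>u. B u $ i $ j)" for i j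
      unfolding A_def B_def by (rule poly_fun_line)+
    moreover have "poly_fun (\<lambda>u. pluecker (A u) (B u) x)"
      unfolding pluecker_def split_beta by (intro poly_fun_diff poly_fun_mult AB)
    moreover have "pluecker (A 0) (B 0) x \<noteq> 0" "W = mat4.span {A 0, B 0}" "W' = mat4.span {A 1, B 1}"
      using x PQ by (simp_all add: A_def B_def)
    moreover have "mat4.span {A u, B u} \<in> Gr" if "pluecker (A u) (B u) x \<noteq> 0" for u
      using that sym unfolding span_in_Gr_iff A_def B_def by (blast intro: line_Sym2)
    ultimately show "\<exists>A B \<phi> u0 u1. (\<forall>i j. poly_fun (\<lambda>u. A u $ i $ j)) \<and> (\<forall>i j. poly_fun (\<lambda>u. B u $ i $ j)) \<and>
        poly_fun \<phi> \<and> \<phi> u0 \<noteq> 0 \<and> W = mat4.span {A u0, B u0} \<and> W' = mat4.span {A u1, B u1} \<and>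
        (\<forall>u. \<phi> u \<noteq> 0 \<longrightarrow> mat4.span {A u, B u} \<in> Gr)"
      by (intro exI[of _ A] exI[of _ B] exI[of _ "\<lambda>u. pluecker (A u) (B u) x"] exI[of _ 0] exI[of _ 1]) simp
  qed simp
  then show ?thesis
    using closedin_topspace[of "zariski :: 'k mat4 set topology"]
    by (simp add: irreducible_closed_def topspace_zariski)
qed

text \<open>\<open>4 I\<^sup>3 - J\<^sup>2\<close> for the classical invariants \<open>I\<close> and \<open>J\<close> of a binary quartic, which is 27 times its discriminant.\<close>

definition quartic_disc :: "'k::field \<Rightarrow> 'k \<Rightarrow> 'k \<Rightarrow> 'k \<Rightarrow> 'k \<Rightarrow> 'k" where
  "quartic_disc a b c d e = 4 * (12 * a * e - 3 * b * d + c\<^sup>2) ^ 3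
     - (72 * a * c * e + 9 * b * c * d - 27 * a * d\<^sup>2 - 27 * b\<^sup>2 * e - 2 * c ^ 3)\<^sup>2"

text \<open>The arguments are the coefficients of \<open>(m + n u)^2 (x + y u + z u^2)\<close>; for
  \<open>n = 0\<close> the double root is at infinity.\<close>

lemma quartic_disc_double_root:
  "quartic_disc (m\<^sup>2 * x) (2 * m * n * x + m\<^sup>2 * y) (n\<^sup>2 * x + 2 * m * n * y + m\<^sup>2 * z)
     (n\<^sup>2 * y + 2 * m * n * z) (n\<^sup>2 * z) = 0"
  unfolding quartic_disc_def by algebra

definition pencil_disc :: "'k::field mat4 \<Rightarrow> 'k mat4 \<Rightarrow> 'k" where
  "pencil_disc P Q = quartic_disc (coeff (pencil_poly P Q) 0) (coeff (pencil_poly P Q) 1)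
     (coeff (pencil_poly P Q) 2) (coeff (pencil_poly P Q) 3) (coeff (pencil_poly P Q) 4)"

lemma pair_poly_pencil_disc: "pair_poly (pencil_disc :: 'k::field mat4 \<Rightarrow> 'k mat4 \<Rightarrow> 'k)"
  unfolding pencil_disc_def[abs_def] quartic_disc_def
  by (intro pair_poly_diff pair_poly.add pair_poly.mult pair_poly_power pair_poly.const pair_poly_coeff_pencil_poly)

lemma pencil_disc_O_node:
  fixes P Q :: "'k::field_char_0 mat4"
  assumes "mat4.span {P, Q} \<in> O_node"
  shows "pencil_disc P Q = 0"
proof -
  obtain g where g: "mat4.span {P, Q} = act g W_node" using assms by (auto simp: O_node_def)
  have "P \<in> act g W_node" "Q \<in> act g W_node" by (simp_all add: mat4.span_base flip: g)
  then obtain a b c d where P: "P = subst g (mscale a node_Q0 + mscale b node_Q1)"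
    and Q: "Q = subst g (mscale c node_Q0 + mscale d node_Q1)"
    unfolding act_def W_node_def span_pair subst_def[symmetric] by auto
  define k where "k = det g * det g * - (1 / 4)"
  \<comment> \<open>The coefficients of the quadratic cofactor of
    \<open>(b + d u)^2\<close>.\<close>
  define x y z where xyz: "x = k * (a + b) * (a + 2 * b)"
    "y = k * ((a + b) * (c + 2 * d) + (c + d) * (a + 2 * b))" "z = k * (c + d) * (c + 2 * d)"
  have "pencil_poly P Q = [:b\<^sup>2 * x, 2 * b * d * x + b\<^sup>2 * y, d\<^sup>2 * x + 2 * b * d * y + b\<^sup>2 * z,
      d\<^sup>2 * y + 2 * b * d * z, d\<^sup>2 * z:]"
    unfolding P Q pencil_poly_subst pencil_poly_node smult_smult k_def[symmetric]
    by (simp add: xyz power2_eq_square) (simp add: algebra_simps)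
  then show ?thesis
    using quartic_disc_double_root[of b x d y z] by (simp add: pencil_disc_def numeral_eq_Suc)
qed

lemma closure_O_node_neq_Gr: "zariski closure_of O_node \<noteq> (Gr :: 'k::field_char_0 mat4 set set)"
proof -
  obtain Z :: "'k mat4 set set" where Z: "closedin zariski Z"
    "\<And>P Q. chart P Q \<Longrightarrow> mat4.span {P, Q} \<in> Z \<longleftrightarrow> pencil_disc P Q = 0"
    "\<And>W. W \<in> Gr \<Longrightarrow> W \<notin> Z \<Longrightarrow> \<exists>P Q. chart P Q \<and> W = mat4.span {P, Q}"
    by (rule chart_closed_set[OF pair_poly_pencil_disc]) blast
  have "O_node \<subseteq> Z"
  proof (rule subsetI, rule ccontr)
    fix W assume W: "W \<in> O_node" "W \<notin> Z"
    then obtain P Q where "chart P Q" "W = mat4.span {P, Q}" using Z(3) O_node_subset_Gr by blast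
    then show False using Z(2) pencil_disc_O_node W by blast
  qed
  then have "zariski closure_of O_node \<subseteq> Z" by (rule closure_of_minimal[OF _ Z(1)])
  \<comment> \<open>A diagonal pencil with the four simple roots 0, 1, -1 and infinity.\<close>
  define P :: "'k mat4" where "P = (\<chi> i j. if i = j \<and> i \<noteq> 1 then 1 else 0)"
  define Q :: "'k mat4" where "Q = (\<chi> i j. if i \<noteq> j then 0 else if i = 0 then 0 else if i = 3 then - 1 else 1)"
  have "chart P Q" by (auto simp: chart_def Sym2_iff P_def Q_def)
  moreover have "pencil_poly P Q = [:0, 1, 0, - 1:]"
    by (rule poly_eqI_infinite) (simp add: poly_pencil_poly det_UNIV4 P_def Q_def algebra_simps)
  then have "pencil_disc P Q \<noteq> 0"
    by (simp add: pencil_disc_def quartic_disc_def numeral_eq_Suc)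
  ultimately have "mat4.span {P, Q} \<notin> Z" "mat4.span {P, Q} \<in> Gr" using Z(2) chart_Gr by blast+
  then show ?thesis using \<open>zariski closure_of O_node \<subseteq> Z\<close> by blast
qed

lemma codim_irreducible_ge_1:
  fixes Y :: "'k::field_char_0 mat4 set set"
  assumes "irreducible_closed zariski Y" "Y \<noteq> Gr"
  shows "codim_irreducible zariski Y \<ge> 1"
  unfolding codim_irreducible_def
proof (rule Sup_upper, rule CollectI, intro exI[of _ 1] exI[of _ "\<lambda>i :: nat. if i = 0 then Y else Gr"] conjI)
  have "Y \<subseteq> Gr" using assms(1) by (auto simp: irreducible_closed_def irreducible_in_def topspace_zariski)
  then show "\<forall>i<1. (if i = 0 then Y else Gr) \<subset> (if Suc i = 0 then Y else Gr)" using assms(2) by auto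
qed (use assms(1) irreducible_closed_Gr in \<open>auto simp: one_enat_def\<close>)

lemma irreducible_closed_closure_O_node:
  "irreducible_closed zariski (zariski closure_of (O_node :: 'k::field_char_0 mat4 set set))"
  by (rule irreducible_closure_of[OF irreducible_O_node])

lemma codim_closure_O_node:
  "codim zariski (zariski closure_of (O_node :: 'k::{alg_closed_field, field_char_0} mat4 set set)) = 1"
proof -
  let ?T = "zariski closure_of (O_node :: 'k mat4 set set)"
  have Gr: "Y \<subseteq> Gr" if "irreducible_closed zariski Y" for Y :: "'k mat4 set set"
    using that by (auto simp: irreducible_closed_def irreducible_in_def topspace_zariski)
  have "codim_irreducible zariski ?T \<le> 1"
    unfolding codim_irreducible_def
  proof (rule Sup_least, elim CollectE exE conjE)
    fix x n and C :: "nat \<Rightarrow> 'k mat4 set set"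
    assume x: "x = enat n" and C: "C 0 = ?T" "\<forall>i\<le>n. irreducible_closed zariski (C i)" "\<forall>i<n. C i \<subset> C (Suc i)"
    have "n \<le> 1"
    proof (rule ccontr)
      assume "\<not> n \<le> 1"
      then have n: "n \<ge> 2" by simp
      \<comment> \<open>In a chain of length two or more, \<open>C 1\<close> is already
        \<open>Gr\<close> by maximality, which leaves no room for \<open>C 2\<close>.\<close>
      have "?T \<subset> C 1" using C(3)[rule_format, of 0] C(1) n by simp
      moreover have "irreducible_closed zariski (C 1)" "irreducible_closed zariski (C 2)" using C(2) n by auto
      ultimately have "C 1 = Gr" using closure_O_node_maximal by blast
      moreover have "C 1 \<subset> C 2" using C(3)[rule_format, of 1] n by (simp add: numeral_2_eq_2)
      ultimately show False using Gr \<open>irreducible_closed zariski (C 2)\<close> by blast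
    qed
    then show "x \<le> 1" by (simp add: x one_enat_def)
  qed
  then have "codim zariski ?T \<le> 1"
    unfolding codim_def using irreducible_closed_closure_O_node[where 'k = 'k] by (intro INF_lower2[of ?T]) auto
  moreover have "1 \<le> codim zariski ?T"
    unfolding codim_def
  proof (rule INF_greatest)
    fix Y assume "Y \<in> {Y. irreducible_closed zariski Y \<and> Y \<subseteq> ?T}"
    then have Y: "irreducible_closed zariski Y" "Y \<subseteq> ?T" by auto
    have "Y \<noteq> Gr" using Y(2) closure_O_node_neq_Gr Gr[OF irreducible_closed_closure_O_node] by blast
    then show "1 \<le> codim_irreducible zariski Y" by (rule codim_irreducible_ge_1[OF Y(1)])
  qed
  ultimately show ?thesis by (rule antisym)
qed

lemma irreducible_components_irreducible:
  "irreducible_in X S \<Longrightarrow> irreducible_components X S = {S}"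
  by (auto simp: irreducible_components_def)

theorem theorem4p9:
  shows "(\<exists>Z :: 'k::{alg_closed_field, field_char_0} mat4 set set.
           closedin zariski Z \<and> codim zariski Z \<ge> 2 \<and> F_inf = tangency_locus \<union> Z)
    \<and> irreducible_closed zariski (tangency_locus :: 'k mat4 set set)
    \<and> codim zariski (tangency_locus :: 'k mat4 set set) = 1
    \<and> {Y \<in> irreducible_components zariski (F_inf :: 'k mat4 set set). codim zariski Y = 1}
        = {tangency_locus}
    \<and> (tangency_locus :: 'k mat4 set set) = zariski closure_of O_node"
proof (intro conjI)
  have "codim zariski ({} :: 'k mat4 set set) = top"
  proof -
    \<comment> \<open>Irreducible sets are nonempty, so the infimum runs over the empty
      family.\<close>
    have "{Y. irreducible_closed zariski Y \<and> Y \<subseteq> ({} :: 'k mat4 set set)} = {}"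
      by (auto simp: irreducible_closed_def irreducible_in_def)
    then show ?thesis by (simp add: codim_def)
  qed
  then show "\<exists>Z :: 'k mat4 set set. closedin zariski Z \<and> codim zariski Z \<ge> 2 \<and> F_inf = tangency_locus \<union> Z"
    by (intro exI[of _ "{}"]) (simp add: F_inf_eq tangency_locus_eq)
  show T: "irreducible_closed zariski (tangency_locus :: 'k mat4 set set)"
    unfolding tangency_locus_eq by (rule irreducible_closed_closure_O_node)
  show c: "codim zariski (tangency_locus :: 'k mat4 set set) = 1"
    unfolding tangency_locus_eq by (rule codim_closure_O_node)
  have "irreducible_components zariski (F_inf :: 'k mat4 set set) = {tangency_locus}"
    using T irreducible_components_irreducible by (simp add: F_inf_eq tangency_locus_eq irreducible_closed_def)
  then show "{Y \<in> irreducible_components zariski (F_inf :: 'k mat4 set set). codim zariski Y = 1} = {tangency_locus}"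
    using c by auto
qed (rule tangency_locus_eq)

end
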